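(* Let $\mathbf{k}$ be an infinite field, let $n\ge 3$, and let $A=\{a_1=0,a_2,\dots,a_n\}$ be a set of integers with $0=a_1<a_2<\cdots<a_n$ and $\gcd(a_2,\dots,a_n)=1$. Let $\mathbf{k}[C_A]$ be the homogeneous coordinate ring of the monomial projective curve $C_A\subset\mathbb{P}^{n-1}_{\mathbf{k}}$ associated to $A$. If the two-dimensional ring $\mathbf{k}[C_A]$ is Cohen-Macaulay, then its Castelnuovo-Mumford regularity satisfies $$ \operatorname{reg}(\mathbf{k}[C_A])\le \left\lceil \frac{a_n-1}{n-2}\right\rceil . $$
   Context: The monomial projective curve $C_A\subset\mathbb{P}^{n-1}_{\mathbf{k}}$ is the curve defined by the homogeneous ideal $I_A=\ker(\psi)$, where $\psi:\mathbf{k}[X_1,\dots,X_n]\to\mathbf{k}[u,v]$ is the $\mathbf{k}$-algebra morphism with $\psi(X_i)=u^{a_n-a_i}v^{a_i}$. Its homogeneous coordinate ring is $\mathbf{k}[C_A]=\mathbf{k}[X_1,\dots,X_n]/I_A$, with the standard grading $\deg X_i=1$. The regularity $\operatorname{reg}(\mathbf{k}[C_A])$ is the Castelnuovo-Mumford regularity of $\mathbf{k}[C_A]$ as a finitely generated graded module over $S=\mathbf{k}[X_1,\dots,X_n]$, i.e. $\max\{j-i \mid \operatorname{Tor}^S_i(\mathbf{k}[C_A],\mathbf{k})_j\neq 0\}$. *)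

theory Defs
  imports
    Complex_Main
    "HOL-Library.Poly_Mapping"
    "HOL-Library.Extended_Nat"
    "HOL-Library.Extended_Real"
    "HOL-Algebra.QuotRing"
    "HOL-Algebra.Module"
    "HOL-Algebra.Ring_Divisibility"
begin

section \<open>Polynomial rings\<close>

text \<open>A monomial is an exponent vector \<open>nat \<Rightarrow>\<^sub>0 nat\<close>; the type \<open>'k mpoly\<close> is the polynomial ring
  in variables indexed by all natural numbers, and the ring in \<open>X\<^sub>1, \<dots>, X\<^sub>n\<close> is cut out of it as
  the carrier of a ring record.\<close>

type_synonym 'k mpoly = "(nat \<Rightarrow>\<^sub>0 nat) \<Rightarrow>\<^sub>0 'k"

definition mpoly_ring :: "nat \<Rightarrow> 'k::field mpoly ring" where
  "mpoly_ring n =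
     \<lparr>carrier = {p. \<forall>m\<in>Poly_Mapping.keys p. Poly_Mapping.keys m \<subseteq> {1..n}},
      mult = (*), one = 1, zero = 0, add = (+)\<rparr>"

definition var :: "nat \<Rightarrow> 'k::field mpoly" where
  "var i = Poly_Mapping.single (Poly_Mapping.single i 1) 1"

definition mdeg :: "(nat \<Rightarrow>\<^sub>0 nat) \<Rightarrow> nat" where
  "mdeg m = (\<Sum>i\<in>Poly_Mapping.keys m. Poly_Mapping.lookup m i)"

text \<open>The graded piece of degree \<open>j\<close> for the standard grading; it is zero for \<open>j < 0\<close>.\<close>

definition homog :: "nat \<Rightarrow> int \<Rightarrow> 'k::field mpoly set" where
  "homog n j = {p \<in> carrier (mpoly_ring n). \<forall>m\<in>Poly_Mapping.keys p. int (mdeg m) = j}"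

text \<open>The \<open>'k\<close>-algebra morphism with \<open>X\<^sub>i \<mapsto> g i\<close>.\<close>

definition subst_mpoly :: "(nat \<Rightarrow> 'k::field mpoly) \<Rightarrow> 'k mpoly \<Rightarrow> 'k mpoly" where
  "subst_mpoly g p =
     (\<Sum>m\<in>Poly_Mapping.keys p. Poly_Mapping.single 0 (Poly_Mapping.lookup p m) *
        (\<Prod>i\<in>Poly_Mapping.keys m. g i ^ Poly_Mapping.lookup m i))"


section \<open>Cohen--Macaulay rings\<close>

text \<open>A Noetherian ring is Cohen--Macaulay iff every maximal ideal \<open>P\<close> satisfies
  depth = codimension, where the depth of \<open>P\<close> is taken on the ring itself (so that no localization
  is needed).\<close>

definition regular_sequence :: "('r, 'x) ring_scheme \<Rightarrow> 'r list \<Rightarrow> bool" where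
  "regular_sequence R xs \<longleftrightarrow>
     set xs \<subseteq> carrier R \<and>
     genideal R (set xs) \<noteq> carrier R \<and>
     (\<forall>i<length xs. \<forall>r\<in>carrier R.
        xs ! i \<otimes>\<^bsub>R\<^esub> r \<in> genideal R (set (take i xs)) \<longrightarrow> r \<in> genideal R (set (take i xs)))"

definition ideal_depth :: "('r, 'x) ring_scheme \<Rightarrow> 'r set \<Rightarrow> enat" where
  "ideal_depth R P = Sup {enat (length xs) |xs. set xs \<subseteq> P \<and> regular_sequence R xs}"

definition prime_height :: "('r, 'x) ring_scheme \<Rightarrow> 'r set \<Rightarrow> enat" where
  "prime_height R P =
     Sup {enat (length Qs - 1) |Qs.
       Qs \<noteq> [] \<and> last Qs = P \<and> sorted_wrt (\<subset>) Qs \<and> (\<forall>Q\<in>set Qs. primeideal Q R)}"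

definition cohen_macaulay :: "('r, 'x) ring_scheme \<Rightarrow> bool" where
  "cohen_macaulay R \<longleftrightarrow>
     cring R \<and> noetherian_ring R \<and>
     (\<forall>P. maximalideal P R \<longrightarrow> ideal_depth R P = prime_height R P)"


section \<open>Graded free resolutions\<close>

text \<open>Put \<open>S = mpoly_ring n\<close>. The free module with basis \<open>e\<^sub>b\<close> (\<open>b \<in> B\<close>) consists of the finitely
  supported vectors with entries in \<open>S\<close> and support in \<open>B\<close>. Bases are sets of natural numbers; a
  finitely generated graded \<open>S\<close>-module has a graded free resolution of this kind, even with finite
  bases.\<close>

type_synonym 'k pvec = "nat \<Rightarrow>\<^sub>0 'k mpoly"

definition free_mod :: "nat \<Rightarrow> nat set \<Rightarrow> 'k::field pvec set" where
  "free_mod n B = {f. Poly_Mapping.keys f \<subseteq> B \<and>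
     (\<forall>b. Poly_Mapping.lookup f b \<in> carrier (mpoly_ring n))}"

definition scale :: "'c::semiring_0 \<Rightarrow> (nat \<Rightarrow>\<^sub>0 'c) \<Rightarrow> (nat \<Rightarrow>\<^sub>0 'c)" where
  "scale c v = Poly_Mapping.map (\<lambda>x. c * x) v"

definition lin_ext :: "(nat \<Rightarrow> (nat \<Rightarrow>\<^sub>0 'c::semiring_0)) \<Rightarrow> (nat \<Rightarrow>\<^sub>0 'c) \<Rightarrow> (nat \<Rightarrow>\<^sub>0 'c)" where
  "lin_ext w v = (\<Sum>b\<in>Poly_Mapping.keys v. scale (Poly_Mapping.lookup v b) (w b))"

text \<open>\<open>basis F i\<close> is the basis of \<open>F\<^sub>i\<close>, \<open>bdeg F i b\<close> the degree of its element \<open>e\<^sub>b\<close>,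
  \<open>bdiff F i b\<close> the image of the basis element \<open>e\<^sub>b\<close> of \<open>F\<^sub>i\<^sub>+\<^sub>1\<close> under
  \<open>F\<^sub>i\<^sub>+\<^sub>1 \<rightarrow> F\<^sub>i\<close>, and \<open>baug F b\<close> the image of the basis element \<open>e\<^sub>b\<close> of \<open>F\<^sub>0\<close> in the resolved
  module.\<close>

record (overloaded) ('k::zero, 'm) free_complex =
  basis :: "nat \<Rightarrow> nat set"
  bdeg :: "nat \<Rightarrow> nat \<Rightarrow> int"
  bdiff :: "nat \<Rightarrow> nat \<Rightarrow> 'k pvec"
  baug :: "nat \<Rightarrow> 'm"

definition differential :: "('k::field, 'm) free_complex \<Rightarrow> nat \<Rightarrow> 'k pvec \<Rightarrow> 'k pvec" where
  "differential F i = lin_ext (bdiff F i)"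

definition augmentation ::
    "('k::field mpoly, 'm) module \<Rightarrow> ('k, 'm) free_complex \<Rightarrow> 'k pvec \<Rightarrow> 'm" where
  "augmentation M F f =
     (\<Oplus>\<^bsub>M\<^esub> b\<in>Poly_Mapping.keys f. Poly_Mapping.lookup f b \<odot>\<^bsub>M\<^esub> baug F b)"

text \<open>Here \<open>M\<close> is an \<open>S\<close>-module and \<open>gr j\<close> is its graded piece of degree \<open>j\<close>. The first two
  conditions say that all maps are homogeneous of degree 0, the remaining ones that
  \<open>\<dots> \<rightarrow> F\<^sub>1 \<rightarrow> F\<^sub>0 \<rightarrow> M \<rightarrow> 0\<close> is exact.\<close>

definition graded_free_resolution ::
    "nat \<Rightarrow> ('k::field mpoly, 'm) module \<Rightarrow> (int \<Rightarrow> 'm set) \<Rightarrow> ('k, 'm) free_complex \<Rightarrow> bool" where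
  "graded_free_resolution n M gr F \<longleftrightarrow>
     (\<forall>b\<in>basis F 0. baug F b \<in> gr (bdeg F 0 b)) \<and>
     (\<forall>i. \<forall>b\<in>basis F (Suc i). bdiff F i b \<in> free_mod n (basis F i) \<and>
        (\<forall>c\<in>basis F i.
           Poly_Mapping.lookup (bdiff F i b) c \<in> homog n (bdeg F (Suc i) b - bdeg F i c))) \<and>
     augmentation M F ` free_mod n (basis F 0) = carrier M \<and>
     {f \<in> free_mod n (basis F 0). augmentation M F f = \<zero>\<^bsub>M\<^esub>} =
        differential F 0 ` free_mod n (basis F 1) \<and>
     (\<forall>i. {f \<in> free_mod n (basis F (Suc i)). differential F i f = 0} =
        differential F (Suc i) ` free_mod n (basis F (Suc (Suc i))))"


section \<open>Tor with coefficients in the residue field, and regularity\<close>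

text \<open>The residue field is \<open>S / (X\<^sub>1, \<dots>, X\<^sub>n)\<close>, so tensoring \<open>F\<close> with it replaces the free modules by
  vector spaces with the same bases and the matrices of the differentials by their constant terms.
  Everything is taken in internal degree \<open>j\<close>.\<close>

definition tensor_space :: "('k::field, 'm) free_complex \<Rightarrow> nat \<Rightarrow> int \<Rightarrow> (nat \<Rightarrow>\<^sub>0 'k) set" where
  "tensor_space F i j = {v. Poly_Mapping.keys v \<subseteq> {b \<in> basis F i. bdeg F i b = j}}"

definition tensor_diff ::
    "('k::field, 'm) free_complex \<Rightarrow> nat \<Rightarrow> (nat \<Rightarrow>\<^sub>0 'k) \<Rightarrow> (nat \<Rightarrow>\<^sub>0 'k)" where
  "tensor_diff F i =
     lin_ext (\<lambda>b. Poly_Mapping.map (\<lambda>p. Poly_Mapping.lookup p 0) (bdiff F i b))"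

definition tensor_cycles :: "('k::field, 'm) free_complex \<Rightarrow> nat \<Rightarrow> int \<Rightarrow> (nat \<Rightarrow>\<^sub>0 'k) set" where
  "tensor_cycles F i j =
     {v \<in> tensor_space F i j. case i of 0 \<Rightarrow> True | Suc l \<Rightarrow> tensor_diff F l v = 0}"

definition tensor_boundaries :: "('k::field, 'm) free_complex \<Rightarrow> nat \<Rightarrow> int \<Rightarrow> (nat \<Rightarrow>\<^sub>0 'k) set"
  where "tensor_boundaries F i j = tensor_diff F i ` tensor_space F (Suc i) j"

definition tensor_homology ::
    "('k::field, 'm) free_complex \<Rightarrow> nat \<Rightarrow> int \<Rightarrow> (nat \<Rightarrow>\<^sub>0 'k) set set" where
  "tensor_homology F i j =
     tensor_cycles F i j //
       {(x, y). x \<in> tensor_cycles F i j \<and> y \<in> tensor_cycles F i j \<and>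
                x - y \<in> tensor_boundaries F i j}"

text \<open>As usual, \<open>Tor\<close> is computed from one chosen graded free resolution; up to isomorphism it does
  not depend on the choice.\<close>

definition Tor ::
    "nat \<Rightarrow> ('k::field mpoly, 'm) module \<Rightarrow> (int \<Rightarrow> 'm set) \<Rightarrow> nat \<Rightarrow> int \<Rightarrow> (nat \<Rightarrow>\<^sub>0 'k) set set" where
  "Tor n M gr i j = tensor_homology (SOME F. graded_free_resolution n M gr F) i j"

text \<open>The maximum is taken as a supremum in the extended reals, so that an inequality
  \<open>regularity n M gr \<le> c\<close> means exactly that every \<open>j - i\<close> with \<open>Tor\<^sub>i(M, k)\<^sub>j \<noteq> 0\<close> is at most \<open>c\<close>.
  A quotient of vector spaces is zero iff it has a single element.\<close>

definition regularity :: "nat \<Rightarrow> ('k::field mpoly, 'm) module \<Rightarrow> (int \<Rightarrow> 'm set) \<Rightarrow> ereal" where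
  "regularity n M gr =
     Sup {ereal (real_of_int (j - int i)) |i j. \<not> is_singleton (Tor n M gr i j)}"


section \<open>Monomial projective curves\<close>

text \<open>The ring \<open>k[u, v]\<close> is \<open>mpoly_ring 2\<close> with \<open>u = var 1\<close> and \<open>v = var 2\<close>.\<close>

definition curve_map :: "nat \<Rightarrow> (nat \<Rightarrow> nat) \<Rightarrow> 'k::field mpoly \<Rightarrow> 'k mpoly" where
  "curve_map n a = subst_mpoly (\<lambda>i. var 1 ^ (a n - a i) * var 2 ^ a i)"

definition curve_ideal :: "nat \<Rightarrow> (nat \<Rightarrow> nat) \<Rightarrow> 'k::field mpoly set" where
  "curve_ideal n a = a_kernel (mpoly_ring n) (mpoly_ring 2) (curve_map n a)"

definition coord_ring :: "nat \<Rightarrow> (nat \<Rightarrow> nat) \<Rightarrow> 'k::field mpoly set ring" where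
  "coord_ring n a = mpoly_ring n Quot curve_ideal n a"

text \<open>The same quotient as a graded module over \<open>mpoly_ring n\<close>.\<close>

definition coord_module :: "nat \<Rightarrow> (nat \<Rightarrow> nat) \<Rightarrow> ('k::field mpoly, 'k mpoly set) module" where
  "coord_module n a = ring.extend (coord_ring n a)
     (module.fields (\<lambda>s x. (curve_ideal n a +>\<^bsub>mpoly_ring n\<^esub> s) \<otimes>\<^bsub>coord_ring n a\<^esub> x))"

definition coord_grading :: "nat \<Rightarrow> (nat \<Rightarrow> nat) \<Rightarrow> int \<Rightarrow> 'k::field mpoly set set" where
  "coord_grading n a j = (\<lambda>p. curve_ideal n a +>\<^bsub>mpoly_ring n\<^esub> p) ` homog n j"

definition curve_regularity :: "'k::field itself \<Rightarrow> nat \<Rightarrow> (nat \<Rightarrow> nat) \<Rightarrow> ereal" where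
  "curve_regularity _ n a =
     regularity n (coord_module n a :: ('k mpoly, 'k mpoly set) module) (coord_grading n a)"

end

theory Submission
  imports Defs "HOL-Library.Set_Algebras"
begin

text \<open>Put \<open>d = a\<^sub>n\<close>, and let \<open>tA\<close> be the \<open>t\<close>-fold sumset of \<open>A\<close>. The coordinate ring is the span of the
  monomials \<open>u\<^bsup>td-x\<^esup> v\<^bsup>x\<^esup>\<close> with \<open>x \<in> tA\<close>. If it is Cohen--Macaulay, then a regular sequence of length
  2 in the irrelevant ideal shows that \<open>x, x + d \<in> (t+1)A\<close> implies \<open>x \<in> tA\<close>; equivalently, \<open>X\<^sub>1\<close> and \<open>X\<^sub>n\<close>
  form a regular sequence. Reducing an arbitrary graded free resolution modulo the variables, one at
  a time and starting with \<open>X\<^sub>1\<close> and \<open>X\<^sub>n\<close>, shows that the regularity is at most the largest degree in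
  which the quotient by \<open>X\<^sub>1\<close> and \<open>X\<^sub>n\<close> is nonzero.

  An element of that quotient of degree \<open>s + 1\<close> is a residue class modulo \<open>d\<close> that is missing from
  \<open>sA\<close>. It remains to see that \<open>d \<ge> s (n - 2) + 2\<close> when \<open>sA\<close> does not meet all classes. If sumsets
  with \<open>A\<close> modulo \<open>d\<close> always grow by at least \<open>n - 2\<close>, this is clear. Otherwise, an isoperimetric
  argument gives a subgroup \<open>H\<close> such that \<open>A + H\<close> has few holes, and the Cohen--Macaulay property, by
  which a class that is new in \<open>tA\<close> is represented by only one integer there, determines how
  the multiples of \<open>A\<close> fill the cosets of \<open>H\<close>.\<close>

section \<open>Periodic sets of integers\<close>

text \<open>The obstacle is that the inequality |X + Y| >= |X| + |Y| - 1, which holds for finite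
  nonempty sets of integers, can fail modulo \<open>d\<close> when \<open>Y\<close> is close to a
  union of cosets of a subgroup. The Cohen-Macaulay property makes the integer inequality usable
  exactly there: in a coset of \<open>H\<close> that an iterated sumset meets for the first time,
  distinct integers have distinct residues. The constant arises as follows. The endpoints 0 and
  \<open>d\<close> of \<open>A\<close> agree modulo \<open>d\<close>, so \<open>A\<close> has n - 1
  classes and ideal growth is n - 2 per step. A nonzero element of degree s + 1 in the quotient
  gives s (n - 2) + 2 <= d, that is s < (d - 1) / (n - 2), so s + 1 is at most the ceiling of the
  right-hand side. On the algebraic side \<open>Tor\<close> is read off from a resolution picked by
  \<open>SOME\<close>, possibly neither minimal nor finite. Hence no property of a special
  resolution may be used, and some resolution has to be constructed.\<close>

locale modulus =
  fixes d :: int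
  assumes d_pos: "0 < d"
begin

text \<open>A subset of Z/d is represented by its full preimage in the integers, so that cosets,
  subgroups and sumsets of Z/d need no quotient type.\<close>

definition periodic :: "int set \<Rightarrow> bool" where
  "periodic X \<longleftrightarrow> (\<forall>x. x + d \<in> X \<longleftrightarrow> x \<in> X)"

text \<open>The size in Z/d. Taking residues rather than intersecting with \<open>{0..<d}\<close>
  gives the right count for finite sets of integers as well.\<close>

definition dens :: "int set \<Rightarrow> nat" where
  "dens X = card ((\<lambda>x. x mod d) ` X)"

lemma residues_subset: "(\<lambda>x. x mod d) ` X \<subseteq> {0..<d}"
  using d_pos by auto

lemma finite_residues [simp]: "finite ((\<lambda>x. x mod d) ` X)"
  using residues_subset finite_subset by blast

lemma periodic_add_mult: "periodic X \<Longrightarrow> x + k * d \<in> X \<longleftrightarrow> x \<in> X"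
proof (induction k arbitrary: x rule: int_induct[where k = 0])
  case (step1 i)
  then show ?case using periodic_def[of X] by (metis add.commute add.left_commute distrib_right mult_1)
next
  case (step2 i)
  have "x + (i - 1) * d + d = x + i * d" by (simp add: algebra_simps)
  then show ?case using step2 periodic_def[of X] by metis
qed simp

lemma periodic_cong:
  assumes "periodic X" "x mod d = y mod d"
  shows "x \<in> X \<longleftrightarrow> y \<in> X"
proof -
  have "y + (x div d - y div d) * d = x"
    using assms(2) div_mult_mod_eq[of x d] div_mult_mod_eq[of y d] unfolding left_diff_distrib by linarith
  then show ?thesis using periodic_add_mult[OF assms(1)] by metis
qed

lemma periodic_mod: "periodic X \<Longrightarrow> x mod d \<in> X \<longleftrightarrow> x \<in> X"
  by (rule periodic_cong) auto

lemma residues_periodic: "periodic X \<Longrightarrow> (\<lambda>x. x mod d) ` X = X \<inter> {0..<d}"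
  using d_pos by (force simp: periodic_mod image_iff)

lemma dens_periodic: "periodic X \<Longrightarrow> dens X = card (X \<inter> {0..<d})"
  by (simp add: dens_def residues_periodic)

lemma periodic_Un: "periodic X \<Longrightarrow> periodic Y \<Longrightarrow> periodic (X \<union> Y)"
  and periodic_Int: "periodic X \<Longrightarrow> periodic Y \<Longrightarrow> periodic (X \<inter> Y)"
  and periodic_Diff: "periodic X \<Longrightarrow> periodic Y \<Longrightarrow> periodic (X - Y)"
  and periodic_Compl: "periodic X \<Longrightarrow> periodic (- X)"
  and periodic_UNIV: "periodic UNIV"
  by (auto simp: periodic_def)

lemma periodic_uminus:
  assumes "periodic X" shows "periodic (uminus ` X)"
proof -
  have "x \<in> uminus ` X \<longleftrightarrow> - x \<in> X" for x using image_iff by fastforce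
  moreover have "- (x + d) \<in> X \<longleftrightarrow> - x \<in> X" for x
    using assms unfolding periodic_def by (metis add.commute diff_add_cancel minus_add_distrib uminus_add_conv_diff)
  ultimately show ?thesis by (simp add: periodic_def)
qed

lemma periodic_plus:
  assumes "periodic X" shows "periodic (X + Y)"
  unfolding periodic_def
proof (intro allI iffI)
  fix z assume "z + d \<in> X + Y"
  then obtain x y where "x \<in> X" "y \<in> Y" "z + d = x + y" by (auto simp: set_plus_def)
  moreover from this have "x - d \<in> X" using assms unfolding periodic_def by (metis diff_add_cancel)
  ultimately have "(x - d) + y \<in> X + Y" "(x - d) + y = z" by auto
  then show "z \<in> X + Y" by simp
next
  fix z assume "z \<in> X + Y"
  then obtain x y where "x \<in> X" "y \<in> Y" "z = x + y" by (auto simp: set_plus_def)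
  then have "x + d \<in> X" "z + d = (x + d) + y" using assms by (auto simp: periodic_def)
  then show "z + d \<in> X + Y" using \<open>y \<in> Y\<close> by (metis set_plus_intro)
qed

lemma periodic_plus_left: "periodic Y \<Longrightarrow> periodic (X + Y)"
  using periodic_plus[of Y X] by (simp add: add.commute)

section \<open>Counting residue classes\<close>

lemma dens_mono: "X \<subseteq> Y \<Longrightarrow> dens X \<le> dens Y"
  unfolding dens_def by (intro card_mono image_mono) auto

lemma dens_UNIV: "dens UNIV = nat d"
  by (simp add: dens_periodic periodic_UNIV)

lemma dens_le: "dens X \<le> nat d"
  using dens_mono[of X UNIV] dens_UNIV by simp

lemma dens_empty [simp]: "dens {} = 0"
  by (simp add: dens_def)

lemma dens_pos: "X \<noteq> {} \<Longrightarrow> 0 < dens X"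
  by (simp add: dens_def card_gt_0_iff)

lemma dens_Un_Int:
  assumes "periodic X" "periodic Y"
  shows "dens (X \<union> Y) + dens (X \<inter> Y) = dens X + dens Y"
proof -
  have "card ((X \<inter> {0..<d}) \<union> (Y \<inter> {0..<d})) + card ((X \<inter> {0..<d}) \<inter> (Y \<inter> {0..<d}))
     = card (X \<inter> {0..<d}) + card (Y \<inter> {0..<d})"
    by (subst card_Un_Int[of "X \<inter> {0..<d}" "Y \<inter> {0..<d}"]) auto
  then show ?thesis
    using assms by (simp add: dens_periodic periodic_Un periodic_Int Int_Un_distrib2 [symmetric] Int_ac)
qed

lemma dens_Un_disjoint:
  assumes "periodic X" "periodic Y" "X \<inter> Y = {}"
  shows "dens (X \<union> Y) = dens X + dens Y"
  using dens_Un_Int[OF assms(1,2)] assms(3) by simp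

lemma dens_Diff:
  assumes "periodic X" "periodic Y" "X \<subseteq> Y"
  shows "dens Y = dens X + dens (Y - X)"
  using dens_Un_disjoint[of X "Y - X"] assms by (simp add: periodic_Diff Un_absorb1)

lemma dens_eqD:
  assumes "periodic X" "periodic Y" "X \<subseteq> Y" "dens Y \<le> dens X"
  shows "X = Y"
  using dens_Diff[OF assms(1-3)] assms dens_pos[of "Y - X"] by force

lemma dens_UNIV_D: "periodic X \<Longrightarrow> nat d \<le> dens X \<Longrightarrow> X = UNIV"
  using dens_eqD[of X UNIV] by (simp add: periodic_UNIV dens_UNIV)

lemma dens_translate [simp]: "dens ({c} + X) = dens X"
  and dens_uminus [simp]: "dens (uminus ` X) = dens X"
proof -
  have "inj_on (\<lambda>x. (c + x) mod d) {0..<d}"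
    by (rule inj_onI) (metis atLeastLessThan_iff mod_add_left_eq mod_pos_pos_trivial add.commute add_diff_cancel_left' mod_diff_left_eq)
  then have "inj_on (\<lambda>x. (c + x) mod d) ((\<lambda>x. x mod d) ` X)"
    using residues_subset inj_on_subset by blast
  moreover have "(\<lambda>x. x mod d) ` ({c} + X) = (\<lambda>x. (c + x) mod d) ` (\<lambda>x. x mod d) ` X"
    by (force simp: set_plus_def image_iff mod_add_right_eq)
  ultimately show "dens ({c} + X) = dens X"
    by (simp add: dens_def card_image)
  have "inj_on (\<lambda>x. (- x) mod d) {0..<d}"
    by (rule inj_onI) (metis atLeastLessThan_iff mod_minus_eq mod_pos_pos_trivial minus_minus)
  then have "inj_on (\<lambda>x. (- x) mod d) ((\<lambda>x. x mod d) ` X)"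
    using residues_subset inj_on_subset by blast
  moreover have "(\<lambda>x. x mod d) ` uminus ` X = (\<lambda>x. (- x) mod d) ` (\<lambda>x. x mod d) ` X"
    by (force simp: image_iff mod_minus_eq)
  ultimately show "dens (uminus ` X) = dens X"
    by (simp add: dens_def card_image)
qed

lemma subset_plus: "0 \<in> S \<Longrightarrow> X \<subseteq> X + (S :: int set)"
  by (force simp: set_plus_def)

lemma translate_cancel: "{-c} + ({c} + X) = (X :: int set)"
proof -
  have "{-c} + {c} = {0 :: int}" by (auto simp: set_plus_def)
  then show ?thesis by (simp add: add.assoc [symmetric])
qed

lemma uminus_image_iff: "x \<in> uminus ` X \<longleftrightarrow> - x \<in> (X :: int set)"
  using image_iff by fastforce

text \<open>Hamidoune's isoperimetric method: the atoms (smallest sets with minimal boundary) of \<open>S\<close>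
  intersect trivially, so an atom containing 0 is a subgroup.\<close>

theorem atom_subgroup:
  assumes S: "periodic S" "0 \<in> S" and X0: "periodic X0" "X0 \<noteq> {}" "X0 + S \<noteq> UNIV"
  obtains H \<kappa> where "periodic H" "0 \<in> H" "\<And>x y. x \<in> H \<Longrightarrow> y \<in> H \<Longrightarrow> x - y \<in> H"
    "H + S \<noteq> UNIV" "dens (H + S) = dens H + \<kappa>"
    "\<And>X. periodic X \<Longrightarrow> X \<noteq> {} \<Longrightarrow> X + S \<noteq> UNIV \<Longrightarrow> dens X + \<kappa> \<le> dens (X + S)"
proof -
  define Fr where "Fr X \<longleftrightarrow> periodic X \<and> X \<noteq> {} \<and> X + S \<noteq> UNIV" for X
  \<comment> \<open>Since \<open>0 \<in> S\<close>, the set \<open>X\<close> is contained in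
    \<open>X + S\<close>, so truncated subtraction loses nothing.\<close>
  define bd where "bd X = dens (X + S) - dens X" for X
  have dle: "dens X \<le> dens (X + S)" for X using dens_mono subset_plus S(2) by blast
  have "Fr X0" using X0 Fr_def by auto
  then obtain X1 where X1: "Fr X1" "\<And>X. Fr X \<Longrightarrow> bd X1 \<le> bd X"
    using exists_least_iff[of "\<lambda>k. \<exists>X. Fr X \<and> bd X = k"] by (metis linorder_not_less)
  define \<kappa> where "\<kappa> = bd X1"
  define At where "At X \<longleftrightarrow> Fr X \<and> bd X = \<kappa>" for X
  have "At X1" using X1 At_def \<kappa>_def by auto
  then obtain M where M: "At M" "\<And>X. At X \<Longrightarrow> dens M \<le> dens X"
    using exists_least_iff[of "\<lambda>k. \<exists>X. At X \<and> dens X = k"] by (metis linorder_not_less)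
  have lb: "dens X + \<kappa> \<le> dens (X + S)" if "Fr X" for X
    using X1(2)[OF that] dle[of X] by (simp add: bd_def \<kappa>_def)
  have At_iff: "At X \<longleftrightarrow> Fr X \<and> dens (X + S) = dens X + \<kappa>" for X
    unfolding At_def bd_def using dle[of X] by auto
  have frM: "periodic M" "M \<noteq> {}" "M + S \<noteq> UNIV" and dM: "dens (M + S) = dens M + \<kappa>"
    using M(1) by (auto simp: At_iff Fr_def)
  have trans: "At ({c} + X)" if "At X" for c X
  proof -
    have e: "({c} + X) + S = {c} + (X + S)" by (simp add: add.assoc)
    have "{c} + (X + S) \<noteq> UNIV"
    proof
      assume "{c} + (X + S) = UNIV"
      then have "{-c} + ({c} + (X + S)) = {- c} + UNIV" by simp
      moreover have "{-c} + ({c} + (X + S)) = X + S" by (rule translate_cancel)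
      moreover have "x \<in> {-c} + (UNIV :: int set)" for x
        using set_plus_intro[of "-c" "{-c}" "x + c" UNIV] by simp
      ultimately show False using that by (auto simp: At_iff Fr_def)
    qed
    moreover have "{c} + X \<noteq> {}" using that by (auto simp: At_iff Fr_def set_plus_def)
    ultimately show ?thesis using that unfolding At_iff Fr_def e by (simp add: periodic_plus_left)
  qed
  \<comment> \<open>Duality: the negated complement of \<open>M + S\<close> is admissible and its
    boundary is no larger than that of \<open>M\<close>. By the choice of \<open>M\<close> it has at
    least \<open>dens M\<close> classes. The negation turns the usual dual statement about -S into
    one about \<open>S\<close> itself.\<close>
  have half: "2 * dens M + \<kappa> \<le> nat d"
  proof -
    define Y where "Y = uminus ` (- (M + S))"
    have pMS: "periodic (M + S)" using frM periodic_plus by blast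
    have pY: "periodic Y" unfolding Y_def using pMS periodic_Compl periodic_uminus by blast
    have dY: "dens Y + dens (M + S) = nat d"
      using dens_Diff[OF pMS periodic_UNIV] by (simp add: Y_def dens_UNIV Compl_eq_Diff_UNIV)
    have neY: "Y \<noteq> {}" using frM(3) by (auto simp: Y_def)
    have sub: "Y + S \<subseteq> - (uminus ` M)"
    proof
      fix z assume "z \<in> Y + S"
      then obtain y s where ys: "y \<in> Y" "s \<in> S" "z = y + s" by (auto simp: set_plus_def)
      show "z \<in> - (uminus ` M)"
      proof
        assume "z \<in> uminus ` M"
        then have "- z \<in> M" by (simp add: uminus_image_iff)
        then have "- z + s \<in> M + S" using ys(2) by blast
        then have "- y \<in> M + S" using ys(3) by simp
        then show False using ys(1) by (simp add: Y_def uminus_image_iff)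
      qed
    qed
    have pm: "periodic (uminus ` M)" using frM periodic_uminus by blast
    have "dens (- (uminus ` M)) + dens M = nat d"
      using dens_Diff[OF pm periodic_UNIV] by (simp add: dens_UNIV Compl_eq_Diff_UNIV)
    then have dYS: "dens (Y + S) + dens M \<le> nat d" using dens_mono[OF sub] by linarith
    have "Y + S \<noteq> UNIV" using sub frM(2) by blast
    then have "Fr Y" using pY neY by (simp add: Fr_def)
    moreover from lb[OF this] have "dens (Y + S) = dens Y + \<kappa>" using dYS dY dM by linarith
    ultimately have "At Y" by (simp add: At_iff)
    then have "dens M \<le> dens Y" using M(2) by blast
    then show ?thesis using dY dM by linarith
  qed
  \<comment> \<open>Submodularity: a proper intersection is too small to have minimal boundary, so
    its boundary is at least \<open>\<kappa> + 1\<close>, which pushes that of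
    \<open>M \<union> N\<close> below \<open>\<kappa>\<close>. The bound \<open>half\<close>
    prevents \<open>(M \<union> N) + S\<close> from being everything.\<close>
  have inter: "N = M" if N: "At N" "dens N = dens M" "M \<inter> N \<noteq> {}" for N
  proof (rule ccontr)
    assume "N \<noteq> M"
    have frN: "periodic N" "N \<noteq> {}" "N + S \<noteq> UNIV" and dN: "dens (N + S) = dens M + \<kappa>"
      using N by (auto simp: At_iff Fr_def)
    define I where "I = M \<inter> N"
    have pI: "periodic I" using frM frN periodic_Int I_def by blast
    have "I \<noteq> M"
      using dens_eqD[of M N] frM frN N(2) \<open>N \<noteq> M\<close> unfolding I_def by (metis inf.absorb_iff1 order_refl)
    then have "dens I < dens M"
      using dens_eqD[of I M] pI frM unfolding I_def by (metis inf.cobounded1 linorder_not_less)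
    moreover have IS: "I + S \<subseteq> (M + S) \<inter> (N + S)" unfolding I_def by (auto simp: set_plus_def)
    then have frI: "Fr I" using pI N(3) frM(3) I_def Fr_def by auto
    ultimately have I1: "dens I + \<kappa> + 1 \<le> dens (I + S)"
      using lb[OF frI] M(2)[of I] frI by (force simp: At_iff)
    have un: "dens ((M + S) \<union> (N + S)) + dens ((M + S) \<inter> (N + S)) = 2 * (dens M + \<kappa>)"
      using dens_Un_Int[of "M + S" "N + S"] frM frN dM dN by (simp add: periodic_plus)
    have le: "dens (I + S) \<le> dens ((M + S) \<inter> (N + S))" using IS dens_mono by blast
    have MN: "dens (M \<union> N) + dens I = 2 * dens M"
      using dens_Un_Int[of M N] frM frN N(2) by (simp add: I_def)
    have eq: "(M \<union> N) + S = (M + S) \<union> (N + S)" by (rule Un_set_plus)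
    have "(M \<union> N) + S \<noteq> UNIV"
    proof
      assume "(M \<union> N) + S = UNIV"
      then have "nat d = dens ((M + S) \<union> (N + S))" using eq dens_UNIV by simp
      then have "2 * dens M + \<kappa> \<le> dens ((M + S) \<union> (N + S))" using half by simp
      then show False using un le I1 by simp
    qed
    then have "Fr (M \<union> N)" using frM frN by (simp add: Fr_def periodic_Un)
    from lb[OF this] show False using eq un le I1 MN by simp
  qed
  obtain m0 where m0: "m0 \<in> M" using frM by blast
  define H where "H = {-m0} + M"
  have H: "At H" "dens H = dens M" unfolding H_def using trans M(1) by auto
  have H0: "0 \<in> H" using m0 by (force simp: H_def set_plus_def)
  \<comment> \<open>Moved back by \<open>m0\<close>, the translate \<open>{-x} + H\<close> meets
    \<open>M\<close> in \<open>m0\<close>, so it must coincide with \<open>M\<close>.\<close>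
  have shift: "{-x} + H = H" if "x \<in> H" for x
  proof -
    let ?N = "{m0} + ({-x} + H)"
    have "At ?N" "dens ?N = dens M" using trans H by auto
    moreover have "m0 \<in> M \<inter> ?N" using m0 that by (force simp: set_plus_def)
    ultimately have "?N = M" using inter by blast
    then have "{-m0} + ?N = H" by (simp add: H_def)
    moreover have "{-m0} + ?N = {-x} + H" by (rule translate_cancel)
    ultimately show ?thesis by simp
  qed
  show ?thesis
  proof (rule that[of H \<kappa>])
    show "periodic H" "H + S \<noteq> UNIV" "dens (H + S) = dens H + \<kappa>" using H(1) by (auto simp: At_iff Fr_def)
    show "0 \<in> H" by (rule H0)
    fix x y assume "x \<in> H" "y \<in> H"
    then have "- y + x \<in> {-y} + H" by (intro set_plus_intro) auto
    then show "x - y \<in> H" using shift[OF \<open>y \<in> H\<close>] by simp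
  next
    fix X assume "periodic X" "X \<noteq> {}" "X + S \<noteq> UNIV"
    then show "dens X + \<kappa> \<le> dens (X + S)" using lb by (simp add: Fr_def)
  qed
qed

end

section \<open>Iterated sumsets with the Cohen--Macaulay property\<close>

primrec nfold :: "nat \<Rightarrow> int set \<Rightarrow> int set" where
  "nfold 0 A = {0}"
| "nfold (Suc t) A = A + nfold t A"

lemma nfold_mono: "X \<subseteq> Y \<Longrightarrow> nfold t X \<subseteq> nfold t Y"
  by (induction t) (auto simp: set_plus_def)

lemma finite_nfold: "finite A \<Longrightarrow> finite (nfold t A)"
  by (induction t) (simp_all add: finite_set_plus)

lemma nfold_nonempty: "A \<noteq> {} \<Longrightarrow> nfold t A \<noteq> {}"
  by (induction t) (auto simp: set_plus_def)

lemma nfold_incr: "0 \<in> A \<Longrightarrow> x \<in> nfold t A \<Longrightarrow> x \<in> nfold (t + k) A"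
proof (induction k)
  case (Suc k)
  then have "0 + x \<in> A + nfold (t + k) A" by (intro set_plus_intro) auto
  then show ?case by simp
qed simp

lemma nfold_add_mult: "d \<in> A \<Longrightarrow> x \<in> nfold t A \<Longrightarrow> x + int k * d \<in> nfold (t + k) A"
proof (induction k)
  case (Suc k)
  then have "d + (x + int k * d) \<in> A + nfold (t + k) A" by (intro set_plus_intro) auto
  then show ?case by (simp add: algebra_simps)
qed simp

text \<open>The translates of \<open>Y\<close> by the minimum of \<open>X\<close> and of
  \<open>X\<close> by the maximum of \<open>Y\<close> share at most one point.\<close>

lemma card_sumset_ge:
  fixes X Y :: "int set"
  assumes "finite X" "X \<noteq> {}" "finite Y" "Y \<noteq> {}"
  shows "card X + card Y \<le> card (X + Y) + 1"
proof -
  let ?P = "Y + {Min X}" and ?Q = "X + {Max Y}"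
  have "?P \<inter> ?Q \<subseteq> {Min X + Max Y}"
  proof
    fix z assume "z \<in> ?P \<inter> ?Q"
    then obtain x y where "x \<in> X" "y \<in> Y" "z = y + Min X" "z = x + Max Y"
      by (auto simp: set_plus_def)
    moreover have "Min X \<le> x" "y \<le> Max Y" using calculation assms by auto
    ultimately show "z \<in> {Min X + Max Y}" by auto
  qed
  from card_mono[OF _ this] have "card (?P \<inter> ?Q) \<le> 1" by simp
  moreover have "?P \<subseteq> Y + X" "?Q \<subseteq> X + Y"
    using assms by (intro set_plus_mono2; simp)+
  then have "?P \<union> ?Q \<subseteq> X + Y" by (simp add: add.commute)
  then have "card (?P \<union> ?Q) \<le> card (X + Y)" by (intro card_mono) (simp_all add: assms finite_set_plus)
  moreover have "card ?P + card ?Q = card (?P \<union> ?Q) + card (?P \<inter> ?Q)"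
    by (intro card_Un_Int) (simp_all add: assms finite_set_plus)
  ultimately show ?thesis by (simp add: card_plus_sing)
qed

lemma card_nfold_ge:
  assumes "finite X" "X \<noteq> {}"
  shows "t * card X + 1 \<le> card (nfold t X) + t"
proof (induction t)
  case (Suc t)
  have "card X + card (nfold t X) \<le> card (nfold (Suc t) X) + 1"
    using card_sumset_ge[OF assms, of "nfold t X"] assms by (simp add: finite_nfold nfold_nonempty)
  then show ?case using Suc by simp
qed simp

locale cm_sumset = modulus +
  fixes A :: "int set"
  assumes A_range: "A \<subseteq> {0..d}" and zero_A: "0 \<in> A" and d_A: "d \<in> A" and Gcd_A: "Gcd A = 1"
    and cm: "\<And>t x. x \<in> nfold (Suc t) A \<Longrightarrow> x + d \<in> nfold (Suc t) A \<Longrightarrow> x \<in> nfold t A"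
begin

section \<open>Residue classes of iterated sumsets\<close>

definition sums_mod :: "nat \<Rightarrow> int set" where
  "sums_mod t = {x. \<exists>y\<in>nfold t A. x mod d = y mod d}"

abbreviation "S \<equiv> sums_mod (Suc 0)"

lemma finite_A: "finite A" using A_range finite_subset by blast

lemma periodic_sums_mod: "periodic (sums_mod t)"
  by (auto simp: periodic_def sums_mod_def)

lemma sums_mod_I: "x \<in> nfold t A \<Longrightarrow> x \<in> sums_mod t"
  by (auto simp: sums_mod_def)

lemma sums_mod_0: "x \<in> sums_mod 0 \<longleftrightarrow> d dvd x"
  by (auto simp: sums_mod_def)

lemma S_iff: "x \<in> S \<longleftrightarrow> (\<exists>a\<in>A. x mod d = a mod d)"
  by (simp add: sums_mod_def)

lemma A_S: "a \<in> A \<Longrightarrow> a \<in> S" by (auto simp: S_iff)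

lemma S_residue: "x \<in> S \<Longrightarrow> x mod d \<in> A"
proof -
  assume "x \<in> S"
  then obtain a where "a \<in> A" "x mod d = a mod d" by (auto simp: S_iff)
  moreover from this have "0 \<le> a" "a \<le> d" using A_range by auto
  then have "a = d \<or> a mod d = a" by (cases "a = d") auto
  ultimately show ?thesis using zero_A by auto
qed

lemma sums_mod_Suc: "sums_mod (Suc t) = S + sums_mod t"
proof (intro Set.set_eqI iffI)
  fix x assume "x \<in> sums_mod (Suc t)"
  then obtain a y where ay: "a \<in> A" "y \<in> nfold t A" "x mod d = (a + y) mod d"
    by (auto simp: sums_mod_def set_plus_def)
  have "(x - a) mod d = y mod d" using ay(3) by (metis add_diff_cancel_left' mod_diff_left_eq)
  then have "x - a \<in> sums_mod t" using ay by (auto simp: sums_mod_def)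
  then have "a + (x - a) \<in> S + sums_mod t" using A_S ay by blast
  then show "x \<in> S + sums_mod t" by simp
next
  fix x assume "x \<in> S + sums_mod t"
  then obtain s z a y where "x = s + z" "a \<in> A" "s mod d = a mod d" "y \<in> nfold t A" "z mod d = y mod d"
    by (auto simp: sums_mod_def set_plus_def)
  then have "x mod d = (a + y) mod d" "a + y \<in> nfold (Suc t) A" by (auto intro: mod_add_cong)
  then show "x \<in> sums_mod (Suc t)" by (auto simp: sums_mod_def)
qed

lemma sums_mod_mono: "x \<in> sums_mod t \<Longrightarrow> x \<in> sums_mod (t + k)"
  using nfold_incr[OF zero_A] by (fastforce simp: sums_mod_def)

lemma zero_sums_mod: "0 \<in> sums_mod t"
  using sums_mod_mono[of 0 0 t] by (simp add: sums_mod_0)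

text \<open>Padding with copies of 0 and \<open>d\<close> puts \<open>2 * q\<close> consecutive
  points \<open>y + i * d\<close> into degree \<open>u + q\<close>. Each use of \<open>cm\<close>
  lowers the degree by one at the price of the last point; after \<open>q\<close> uses, the first
  \<open>q\<close> points remain in degree \<open>u\<close>.\<close>

lemma interpolate:
  assumes "y \<in> nfold (Suc u) A" "y + int q * d \<in> nfold (Suc u) A" "j < q"
  shows "y + int j * d \<in> nfold u A"
proof -
  have top: "y + int i * d \<in> nfold (u + q) A" if "i < 2 * q" for i
  proof (cases "i < q")
    case True
    then have "y + int i * d \<in> nfold ((Suc u + i) + (q - 1 - i)) A"
      using nfold_add_mult[OF d_A assms(1), of i] nfold_incr[OF zero_A] by blast
    then show ?thesis using True by simp
  next
    case False
    define e where "e = i - q"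
    have e: "i = q + e" "e < q" using False that by (auto simp: e_def)
    have "(y + int q * d) + int e * d \<in> nfold ((Suc u + e) + (q - 1 - e)) A"
      using nfold_add_mult[OF d_A assms(2), of e] nfold_incr[OF zero_A] by blast
    then show ?thesis using e by (simp add: algebra_simps)
  qed
  have "\<forall>i < 2 * q - k. y + int i * d \<in> nfold (u + (q - k)) A" if "k \<le> q" for k
    using that
  proof (induction k)
    case 0 then show ?case using top by simp
  next
    case (Suc k)
    have e: "u + (q - k) = Suc (u + (q - Suc k))" using Suc.prems by simp
    show ?case
    proof (intro allI impI)
      fix i assume i: "i < 2 * q - Suc k"
      have "Suc i < 2 * q - k" "k \<le> q" using i Suc.prems by auto
      then have "y + int i * d \<in> nfold (u + (q - k)) A" "y + int (Suc i) * d \<in> nfold (u + (q - k)) A"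
        using Suc.IH by (auto simp del: of_nat_Suc)
      moreover have "y + int (Suc i) * d = (y + int i * d) + d" by (simp add: algebra_simps)
      ultimately show "y + int i * d \<in> nfold (u + (q - Suc k)) A"
        unfolding e using cm by metis
    qed
  qed
  from this[of q] show ?thesis using assms(3) by simp
qed

lemma mod_eq_cases:
  assumes "x mod d = y mod d"
  obtains "x = y" | q where "0 < q" "y = x + int q * d" | q where "0 < q" "x = y + int q * d"
proof -
  obtain k where k: "x = y + d * k" using assms by (metis mod_eqE)
  consider "k = 0" | "k > 0" | "k < 0" by linarith
  then show ?thesis
  proof cases
    case 1 then show ?thesis using k that(1) by simp
  next
    case 2 then show ?thesis using k that(3)[of "nat k"] by (simp add: mult.commute)
  next
    case 3 then show ?thesis using k that(2)[of "nat (- k)"] by (simp add: mult.commute)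
  qed
qed

text \<open>Of two representatives, interpolation would put the smaller one into
  \<open>nfold u A\<close>. In this form the Cohen-Macaulay property enters the counting inside
  cosets.\<close>

lemma unique_new:
  assumes "x \<in> nfold (Suc u) A" "y \<in> nfold (Suc u) A" "x mod d = y mod d" "x \<notin> sums_mod u"
  shows "x = y"
proof (rule mod_eq_cases[OF assms(3)])
  fix q :: nat assume "0 < q" "y = x + int q * d"
  then have "x \<in> nfold u A" using interpolate[of x u q 0] assms by simp
  then show ?thesis using assms(4) sums_mod_I by blast
next
  fix q :: nat assume "0 < q" "x = y + int q * d"
  then have "y \<in> nfold u A" using interpolate[of y u q 0] assms by simp
  then show ?thesis using assms(3,4) by (auto simp: sums_mod_def)
qed

text \<open>The dictionary between algebra and residues: dividing by the image of the first variable
  keeps \<open>x\<close>, dividing by that of the last one subtracts \<open>d\<close>. Hence a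
  monomial of degree \<open>u + 1\<close> that neither variable divides within the ring lies in a
  class missing from \<open>nfold u A\<close>.\<close>

lemma old_class:
  assumes "x \<in> nfold (Suc u) A" "x \<in> sums_mod u"
  shows "x \<in> nfold u A \<or> x - d \<in> nfold u A"
proof -
  obtain z where z: "z \<in> nfold u A" "x mod d = z mod d" using assms(2) by (auto simp: sums_mod_def)
  have z': "z \<in> nfold (Suc u) A" using nfold_incr[OF zero_A z(1), of 1] by simp
  show ?thesis
  proof (rule mod_eq_cases[OF z(2)])
    assume "x = z" then show ?thesis using z by simp
  next
    fix q :: nat assume "0 < q" "z = x + int q * d"
    then show ?thesis using interpolate[of x u q 0] assms z' by simp
  next
    fix q :: nat assume q: "0 < q" "x = z + int q * d"
    then have "z + int (q - 1) * d \<in> nfold u A" using interpolate[of z u q "q - 1"] assms z' by simp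
    moreover have "z + int (q - 1) * d = x - d" using q by (simp add: algebra_simps of_nat_diff)
    ultimately show ?thesis by simp
  qed
qed

text \<open>Each translate of \<open>W\<close> by an element of \<open>A\<close> lies in
  \<open>W\<close> and has the same size, so \<open>A\<close> stabilizes \<open>W\<close>. The
  stabilizer is a group of integers, generated by its least positive element, which divides the gcd
  of \<open>A\<close>.\<close>

lemma generates:
  assumes W: "periodic W" "W \<noteq> {}" and closed: "\<And>a w. a \<in> A \<Longrightarrow> w \<in> W \<Longrightarrow> a + w \<in> W"
  shows "W = UNIV"
proof -
  define U where "U = {z. {z} + W = W}"
  have AU: "a \<in> U" if "a \<in> A" for a
  proof -
    have "{a} + W \<subseteq> W" using closed that by (auto simp: set_plus_def)
    then show ?thesis
      using dens_eqD[of "{a} + W" W] W by (simp add: U_def periodic_plus_left)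
  qed
  have Uadd: "x + y \<in> U" if "x \<in> U" "y \<in> U" for x y
  proof -
    have "{x + y} + W = {x} + ({y} + W)" by (simp add: add.assoc [symmetric] set_plus_def [of "{x}" "{y}"])
    then show ?thesis using that by (simp add: U_def)
  qed
  have Uneg: "- x \<in> U" if "x \<in> U" for x
    using translate_cancel[of x W] that by (simp add: U_def)
  have Umult: "k * x \<in> U" if "x \<in> U" for k x
  proof (induction k rule: int_induct[where k = 0])
    case base show ?case by (simp add: U_def)
  next
    case (step1 i) then show ?case using Uadd[OF _ that] by (simp add: distrib_right)
  next
    case (step2 i) then show ?case using Uadd[OF _ Uneg[OF that], of "i * x"] by (simp add: left_diff_distrib)
  qed
  define P where "P k \<longleftrightarrow> 0 < k \<and> int k \<in> U" for k
  define g where "g = (LEAST k. P k)"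
  have "P (nat d)" using AU d_A d_pos by (simp add: P_def)
  then have Pg: "P g" unfolding g_def by (rule LeastI)
  have "int g dvd x" if "x \<in> U" for x
  proof (rule ccontr)
    assume ndvd: "\<not> int g dvd x"
    have "x + (- (x div int g)) * int g \<in> U" using Pg by (intro Uadd[OF that Umult]) (simp add: P_def)
    then have "x mod int g \<in> U" by (simp add: minus_div_mult_eq_mod)
    moreover have "0 \<le> x mod int g" "x mod int g < int g" using Pg by (simp_all add: P_def)
    moreover have "x mod int g \<noteq> 0" using ndvd by (simp add: dvd_eq_mod_eq_0)
    ultimately have "P (nat (x mod int g))" "nat (x mod int g) < g" by (auto simp: P_def)
    then show False using not_less_Least unfolding g_def by blast
  qed
  then have "int g dvd Gcd A" using AU by (simp add: Gcd_greatest)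
  then have "g = 1" using Gcd_A by simp
  then have all: "{z} + W = W" for z using Umult[of 1 z] Pg by (simp add: P_def U_def)
  obtain w where "w \<in> W" using W by blast
  have "z \<in> W" for z
  proof -
    have "(z - w) + w \<in> {z - w} + W" using \<open>w \<in> W\<close> by (intro set_plus_intro) auto
    then show ?thesis using all by simp
  qed
  then show ?thesis by blast
qed

end

context cm_sumset
begin

lemma periodic_coset: "periodic H \<Longrightarrow> periodic ({x} + H)"
  by (rule periodic_plus_left)

text \<open>The endpoints 0 and \<open>d\<close> of \<open>A\<close> have the same residue.\<close>

lemma dens_S: "dens S + 1 = card A"
proof -
  have "S \<inter> {0..<d} = A - {d}"
  proof (intro equalityI subsetI)
    fix x assume x: "x \<in> S \<inter> {0..<d}"
    then have "x mod d = x" by simp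
    then show "x \<in> A - {d}" using x S_residue[of x] by auto
  next
    fix x assume x: "x \<in> A - {d}"
    then have "0 \<le> x" "x \<le> d" "x \<noteq> d" using A_range by auto
    then show "x \<in> S \<inter> {0..<d}" using x A_S by auto
  qed
  then have "dens S = card (A - {d})" by (simp add: dens_periodic[OF periodic_sums_mod])
  then show ?thesis using finite_A d_A by (metis Suc_eq_plus1 card_Suc_Diff1)
qed

text \<open>The intermediate sums are contained in the last one, so none of them is everything and
  each step gains \<open>\<kappa>\<close>.\<close>

lemma dens_sums_mod_iterate:
  assumes "\<And>X. periodic X \<Longrightarrow> X \<noteq> {} \<Longrightarrow> X + S \<noteq> UNIV \<Longrightarrow> dens X + \<kappa> \<le> dens (X + S)"
    and "periodic H" "0 \<in> H" "H + sums_mod t \<noteq> UNIV"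
  shows "dens H + t * \<kappa> \<le> dens (H + sums_mod t)"
  using assms(4)
proof (induction t)
  case 0
  have "H \<subseteq> H + sums_mod 0" by (rule subset_plus) (rule zero_sums_mod)
  then show ?case using dens_mono by simp
next
  case (Suc t)
  have e: "H + sums_mod (Suc t) = (H + sums_mod t) + S"
    by (simp add: sums_mod_Suc[of t] ac_simps)
  have "H + sums_mod t \<subseteq> H + sums_mod (Suc t)"
    using sums_mod_mono[of _ t 1] by (intro set_plus_mono2) auto
  then have "H + sums_mod t \<noteq> UNIV" using Suc.prems by blast
  from Suc.IH[OF this] have "dens H + t * \<kappa> \<le> dens (H + sums_mod t)" .
  moreover have "H + sums_mod t \<noteq> {}" using assms(3) zero_sums_mod by (force simp: set_plus_def)
  then have "dens (H + sums_mod t) + \<kappa> \<le> dens (H + sums_mod (Suc t))"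
    unfolding e using Suc.prems assms(2) by (intro assms(1)) (simp_all add: e periodic_plus)
  ultimately show ?case by simp
qed

end

section \<open>A subgroup of Z/d in whose cosets \<open>S\<close> has few holes\<close>

locale cm_sumset_subgroup = cm_sumset +
  fixes H :: "int set" and \<kappa> :: nat
  assumes H: "periodic H" "0 \<in> H" "\<And>x y. x \<in> H \<Longrightarrow> y \<in> H \<Longrightarrow> x - y \<in> H"
    and HS: "H + S \<noteq> UNIV" and dens_HS: "dens (H + S) = dens H + \<kappa>"
    and \<kappa>: "\<kappa> + 2 \<le> dens S"
    and iso: "\<And>X. periodic X \<Longrightarrow> X \<noteq> {} \<Longrightarrow> X + S \<noteq> UNIV \<Longrightarrow> dens X + \<kappa> \<le> dens (X + S)"
begin

definition share :: "int \<Rightarrow> nat" where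
  "share x = dens (S \<inter> ({x} + H))"

lemma H_minus: "x \<in> H \<Longrightarrow> - x \<in> H" using H(3)[OF H(2)] by simp
lemma H_plus: "x \<in> H \<Longrightarrow> y \<in> H \<Longrightarrow> x + y \<in> H" using H(3)[OF _ H_minus] by fastforce

lemma mem_coset: "y \<in> {x} + X \<longleftrightarrow> y - x \<in> (X :: int set)"
  by (force simp: set_plus_def)

lemma mem_H_plus: "y \<in> H + X \<longleftrightarrow> (\<exists>x\<in>X. y - x \<in> H)"
  by (force simp: set_plus_def)

lemma mem_H_plus_cong:
  assumes "y - z \<in> H"
  shows "y \<in> H + X \<longleftrightarrow> z \<in> H + X"
proof -
  have "y - x \<in> H \<longleftrightarrow> z - x \<in> H" for x
    using H_plus[OF assms, of "z - x"] H(3)[OF _ assms, of "y - x"] by auto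
  then show ?thesis by (simp add: mem_H_plus)
qed

lemma coset_sub: "x \<in> S \<Longrightarrow> {x} + H \<subseteq> H + S"
  unfolding subset_iff mem_coset mem_H_plus by blast

lemma dens_coset: "dens ({x} + H) = share x + dens ({x} + H - S)"
proof -
  have "dens ({x} + H) = dens (S \<inter> ({x} + H)) + dens (({x} + H) - (S \<inter> ({x} + H)))"
    by (intro dens_Diff periodic_Int periodic_sums_mod periodic_coset H) auto
  moreover have "({x} + H) - (S \<inter> ({x} + H)) = {x} + H - S" by blast
  ultimately show ?thesis by (simp add: share_def)
qed

text \<open>Together with \<open>\<kappa> + 2 \<le> dens S\<close> this leaves at most
  \<open>dens H - 2\<close> holes in \<open>H + S\<close>. Charging all holes to one coset gives
  \<open>share_ge\<close>; distributing them over two cosets gives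
  \<open>share_pair_ge\<close>.\<close>

lemma dens_holes: "dens H + \<kappa> = dens S + dens (H + S - S)"
proof -
  have "dens (H + S) = dens S + dens (H + S - S)"
    by (intro dens_Diff periodic_plus periodic_sums_mod H)
      (use subset_plus[of H S] H(2) in \<open>simp add: add.commute\<close>)
  then show ?thesis by (simp add: dens_HS)
qed

lemma share_ge: "x \<in> S \<Longrightarrow> dens S \<le> share x + \<kappa>"
  using dens_holes dens_coset[of x] dens_mono[of "{x} + H - S" "H + S - S"] coset_sub[of x] by force

lemma share_pair_ge:
  assumes "x \<in> S" "y \<in> S" "x - y \<notin> H"
  shows "dens H + 2 \<le> share x + share y"
proof -
  have disj: "({x} + H) \<inter> ({y} + H) = {}"
  proof (rule ccontr)
    assume "({x} + H) \<inter> ({y} + H) \<noteq> {}"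
    then obtain z where "z - x \<in> H" "z - y \<in> H" by (auto simp: mem_coset)
    from H(3)[OF this(2,1)] show False using assms(3) by simp
  qed
  have "dens (({x} + H - S) \<union> ({y} + H - S)) = dens ({x} + H - S) + dens ({y} + H - S)"
    by (intro dens_Un_disjoint periodic_Diff periodic_coset periodic_sums_mod H) (use disj in blast)
  moreover have "dens (({x} + H - S) \<union> ({y} + H - S)) \<le> dens (H + S - S)"
    using coset_sub[OF assms(1)] coset_sub[OF assms(2)] by (intro dens_mono) blast
  ultimately show ?thesis using dens_coset[of x] dens_coset[of y] dens_holes \<kappa> by simp
qed

text \<open>The reflection \<open>z - (S \<inter> ({x} + H))\<close> and
  \<open>S \<inter> ({y} + H)\<close> both lie in \<open>{y} + H\<close> and are together too large
  to be disjoint.\<close>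

lemma pigeonhole_coset:
  assumes "x \<in> S" "y \<in> S" "dens H < share x + share y" "z - (x + y) \<in> H"
  shows "z \<in> S + S"
proof (rule ccontr)
  assume z: "z \<notin> S + S"
  let ?P = "{z} + uminus ` (S \<inter> ({x} + H))" and ?Q = "S \<inter> ({y} + H)"
  have "?P \<inter> ?Q = {}" using z by (force simp: set_plus_def)
  moreover have per: "periodic ?P" "periodic ?Q"
    by (intro periodic_plus_left periodic_uminus periodic_Int periodic_coset periodic_sums_mod H)+
  ultimately have "dens (?P \<union> ?Q) = share x + share y"
    using dens_Un_disjoint[of ?P ?Q] by (simp add: share_def)
  moreover have "?P \<union> ?Q \<subseteq> {y} + H"
  proof
    fix w assume "w \<in> ?P \<union> ?Q"
    then consider "w \<in> {y} + H" | "- (w - z) - x \<in> H"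
      unfolding Un_iff Int_iff mem_coset uminus_image_iff by blast
    then show "w \<in> {y} + H"
    proof cases
      case 2
      then have "(z - (x + y)) - (- (w - z) - x) \<in> H" using assms(4) H(3) by blast
      then show ?thesis by (simp add: mem_coset)
    qed
  qed
  then have "dens (?P \<union> ?Q) \<le> dens H" using dens_mono[of "?P \<union> ?Q" "{y} + H"] by simp
  ultimately show False using assms(3) by simp
qed

text \<open>All classes in a new coset are new, so by \<open>unique_new\<close> reduction modulo
  \<open>d\<close> is injective on \<open>X\<close>. This transfers lower bounds for integer sumsets
  to residues.\<close>

lemma new_coset_card:
  assumes "z \<notin> H + sums_mod u" and X: "X \<subseteq> nfold (Suc u) A" "X \<subseteq> {z} + H"
  shows "card X \<le> dens (sums_mod (Suc u) \<inter> ({z} + H))"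
proof -
  have "inj_on (\<lambda>x. x mod d) X"
  proof (rule inj_onI)
    fix x y assume xy: "x \<in> X" "y \<in> X" "x mod d = y mod d"
    have "x - z \<in> H" using xy X by (auto simp: mem_coset)
    then have "x \<notin> H + sums_mod u" using assms(1) mem_H_plus_cong by blast
    then have "x \<notin> sums_mod u" using H(2) mem_H_plus by force
    then show "x = y" using unique_new xy X by blast
  qed
  then have "card X = dens X" by (simp add: dens_def card_image)
  also have "\<dots> \<le> dens (sums_mod (Suc u) \<inter> ({z} + H))"
    using X sums_mod_I by (intro dens_mono) blast
  finally show ?thesis .
qed

text \<open>The integers behind \<open>share x\<close>, one for each residue; \<open>d\<close> is
  left out because 0 already represents its residue.\<close>

definition part :: "int \<Rightarrow> int set" where
  "part x = A \<inter> {0..<d} \<inter> ({x} + H)"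

lemma card_part: "card (part x) = share x"
proof -
  have "S \<inter> ({x} + H) \<inter> {0..<d} = part x"
    unfolding part_def using S_residue A_S by (auto simp del: atLeastLessThan_iff) (metis atLeastLessThan_iff mod_pos_pos_trivial)
  then show ?thesis
    by (simp add: share_def dens_periodic periodic_Int periodic_sums_mod periodic_coset H(1))
qed

lemma finite_part: "finite (part x)" using finite_A by (simp add: part_def)

lemma share_pos: "x \<in> S \<Longrightarrow> 0 < share x"
  unfolding share_def using H(2) by (intro dens_pos) (auto simp: mem_coset)

lemma part_nonempty: "x \<in> S \<Longrightarrow> part x \<noteq> {}"
  using card_part[of x] share_pos[of x] by auto

lemma nfold_part: "nfold t (part x) \<subseteq> {int t * x} + H"
proof (induction t)
  case 0 then show ?case by (simp add: mem_coset H(2))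
next
  case (Suc t)
  show ?case
  proof
    fix z assume "z \<in> nfold (Suc t) (part x)"
    then obtain p q where "p \<in> part x" "q \<in> nfold t (part x)" "z = p + q" by (auto simp: set_plus_def)
    then have "p - x \<in> H" "q - int t * x \<in> H" "z = p + q" using Suc by (auto simp: part_def mem_coset)
    then have "(p + q) - int (Suc t) * x \<in> H" using H_plus[of "p - x" "q - int t * x"] by (simp add: algebra_simps)
    then show "z \<in> {int (Suc t) * x} + H" using \<open>z = p + q\<close> by (simp add: mem_coset)
  qed
qed

lemma nfold_part_card:
  assumes "x \<in> S" "int (Suc u) * x \<notin> H + sums_mod u"
  shows "Suc u * share x + 1 \<le> dens (sums_mod (Suc u) \<inter> ({int (Suc u) * x} + H)) + Suc u"
proof -
  have "card (nfold (Suc u) (part x)) \<le> dens (sums_mod (Suc u) \<inter> ({int (Suc u) * x} + H))"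
    using assms(2) nfold_mono[of "part x" A "Suc u"] nfold_part[of "Suc u" x]
    by (intro new_coset_card) (auto simp: part_def)
  then show ?thesis
    using card_nfold_ge[OF finite_part part_nonempty[OF assms(1)], of "Suc u"] by (simp add: card_part)
qed

text \<open>If the coset of \<open>x + y\<close> were new, the integer inequality would put at least
  \<open>share x + share y - 1\<close> residues into it, more than the \<open>dens H\<close>
  available.\<close>

lemma distinct_closed:
  assumes "x \<in> S" "y \<in> S" "x - y \<notin> H"
  shows "x + y \<in> H + S"
proof (rule ccontr)
  assume new: "x + y \<notin> H + S"
  have "part x + part y \<subseteq> A + A" by (intro set_plus_mono2) (auto simp: part_def)
  then have "part x + part y \<subseteq> nfold (Suc (Suc 0)) A" by simp
  moreover have "part x + part y \<subseteq> {x + y} + H"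
  proof
    fix z assume "z \<in> part x + part y"
    then obtain p q where "p \<in> part x" "q \<in> part y" "z = p + q" by (auto simp: set_plus_def)
    then have "p - x \<in> H" "q - y \<in> H" by (auto simp: part_def mem_coset)
    then have "(p + q) - (x + y) \<in> H" using H_plus[of "p - x" "q - y"] by (simp add: algebra_simps)
    then show "z \<in> {x + y} + H" using \<open>z = p + q\<close> by (simp add: mem_coset)
  qed
  ultimately have "card (part x + part y) \<le> dens (sums_mod (Suc (Suc 0)) \<inter> ({x + y} + H))"
    by (intro new_coset_card new)
  also have "\<dots> \<le> dens ({x + y} + H)" by (intro dens_mono) auto
  finally have "card (part x + part y) \<le> dens H" by simp
  moreover have "share x + share y \<le> card (part x + part y) + 1"
    using card_sumset_ge[OF finite_part part_nonempty finite_part part_nonempty] assms by (simp add: card_part)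
  ultimately show False using share_pair_ge[OF assms] by simp
qed

text \<open>Sums of different cosets stay inside by \<open>distinct_closed\<close>. If doubles
  stayed inside too, \<open>H + S\<close> would be closed under \<open>A\<close> and hence
  everything.\<close>

lemma H_plus_S_not_closed: "\<exists>x\<in>S. x + x \<notin> H + S"
proof (rule ccontr)
  assume double: "\<not> ?thesis"
  have "H + S = UNIV"
  proof (rule generates)
    show "periodic (H + S)" "H + S \<noteq> {}" using H dens_HS periodic_plus zero_sums_mod[of 1]
      by (auto simp: set_plus_def)
    fix a w assume "a \<in> A" "w \<in> H + S"
    then obtain s where s: "s \<in> S" "w - s \<in> H" "a \<in> S" using A_S by (auto simp: mem_H_plus)
    have "a + s \<in> H + S"
    proof (cases "a - s \<in> H")
      case True
      then have "(a + s) - (s + s) \<in> H" by simp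
      then show ?thesis using mem_H_plus_cong double s(1) by blast
    qed (use distinct_closed s in blast)
    moreover have "(a + w) - (a + s) \<in> H" using s by simp
    ultimately show "a + w \<in> H + S" using mem_H_plus_cong by blast
  qed
  then show False using HS by simp
qed

lemma double_new:
  assumes "x \<in> S" "x + x \<notin> H + S"
  shows "2 * share x \<le> dens H + 1"
proof -
  have "Suc 1 * share x + 1 \<le> dens (sums_mod (Suc 1) \<inter> ({int (Suc 1) * x} + H)) + Suc 1"
    using assms by (intro nfold_part_card) (simp_all add: algebra_simps)
  also have "dens (sums_mod (Suc 1) \<inter> ({int (Suc 1) * x} + H)) \<le> dens ({int (Suc 1) * x} + H)"
    by (intro dens_mono) auto
  finally show ?thesis by simp
qed

text \<open>An \<open>x\<close> whose double is new lies outside \<open>H\<close> and fills at most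
  about half of its coset. By \<open>share_pair_ge\<close>, \<open>S\<close> then fills more than
  half of \<open>H\<close>, and the pigeonhole principle gives all of \<open>H\<close> in
  \<open>S + S\<close>.\<close>

lemma H_subset_sums_mod: "H \<subseteq> sums_mod (Suc (Suc u))"
proof
  fix h assume "h \<in> H"
  obtain x where x: "x \<in> S" "x + x \<notin> H + S" using H_plus_S_not_closed by blast
  have "x - 0 \<notin> H"
  proof
    assume "x - 0 \<in> H"
    then have "x + x \<in> H" using H_plus[of x x] by simp
    then show False using x(2) zero_sums_mod[of "Suc 0"] by (auto simp: mem_H_plus intro: bexI[of _ 0])
  qed
  then have "dens H + 2 \<le> share x + share 0" using share_pair_ge x(1) zero_sums_mod by blast
  then have "dens H < share 0 + share 0" using double_new[OF x] by simp
  then have "h \<in> S + S"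
    using pigeonhole_coset[of 0 0 h] zero_sums_mod \<open>h \<in> H\<close> by simp
  then have "h \<in> sums_mod (Suc (Suc 0))" by (simp add: sums_mod_Suc[of "Suc 0"])
  then show "h \<in> sums_mod (Suc (Suc u))" using sums_mod_mono[of h "Suc (Suc 0)" u] by simp
qed

text \<open>Two summands from different cosets of \<open>H\<close> already fill a coset by the pigeonhole principle,
  and they can be merged into one summand by \<open>distinct_closed\<close>.\<close>

lemma full_coset_or_multiple:
  assumes "a \<in> S" "p \<in> sums_mod s"
  shows "p - int s * a \<in> H \<or> (a + p \<in> H + sums_mod s \<and> {a + p} + H \<subseteq> sums_mod (Suc s))"
  using assms(2)
proof (induction s arbitrary: p)
  case 0
  then have "p \<in> sums_mod 0" by simp
  then have "p mod d = 0 mod d" by (simp add: sums_mod_0 dvd_eq_mod_eq_0)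
  then have "p \<in> H" using periodic_cong[OF H(1)] H(2) by blast
  then show ?case by simp
next
  case (Suc s)
  then obtain b q where b: "b \<in> S" "q \<in> sums_mod s" "p = b + q"
    by (auto simp: sums_mod_Suc[of s] set_plus_def)
  show ?case
  proof (cases "a - b \<in> H")
    case False
    have full: "{a + p} + H \<subseteq> sums_mod (Suc (Suc s))"
    proof
      fix z assume "z \<in> {a + p} + H"
      then have "z - (a + p) \<in> H" by (simp add: mem_coset)
      then have "(z - q) - (a + b) \<in> H" using b by (simp add: algebra_simps)
      then have "z - q \<in> S + S"
        using pigeonhole_coset share_pair_ge[OF assms(1) b(1) False] assms(1) b(1) by simp
      then have "(z - q) + q \<in> (S + S) + sums_mod s" using b by blast
      then show "z \<in> sums_mod (Suc (Suc s))" by (simp add: sums_mod_Suc[of s] sums_mod_Suc[of "Suc s"] add.assoc)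
    qed
    have "a + b \<in> H + S" by (rule distinct_closed[OF assms(1) b(1) False])
    then have "(a + b) + q \<in> (H + S) + sums_mod s" using b by blast
    then have "a + p \<in> H + sums_mod (Suc s)" using b by (simp add: sums_mod_Suc[of s] add.assoc)
    then show ?thesis using full by blast
  next
    case True
    from Suc.IH[OF b(2)] show ?thesis
    proof (elim disjE conjE)
      assume "q - int s * a \<in> H"
      then have "(q - int s * a) - (a - b) \<in> H" using H(3) True by blast
      then show ?thesis using b by (simp add: algebra_simps)
    next
      assume aq: "a + q \<in> H + sums_mod s" "{a + q} + H \<subseteq> sums_mod (Suc s)"
      have "b + (a + q) \<in> S + (H + sums_mod s)" using b aq by blast
      then have "a + p \<in> H + sums_mod (Suc s)" using b by (simp add: sums_mod_Suc[of s] ac_simps)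
      moreover have "{a + p} + H \<subseteq> sums_mod (Suc (Suc s))"
      proof
        fix z assume "z \<in> {a + p} + H"
        then have "z - (a + p) \<in> H" by (simp add: mem_coset)
        then have "z - b \<in> {a + q} + H" unfolding mem_coset using b by (simp add: algebra_simps)
        then have "b + (z - b) \<in> S + sums_mod (Suc s)" using aq b by blast
        then show "z \<in> sums_mod (Suc (Suc s))" by (simp add: sums_mod_Suc[of "Suc s"])
      qed
      ultimately show ?thesis by blast
    qed
  qed
qed

text \<open>This is \<open>full_coset_or_multiple\<close> for \<open>a = 0\<close>: outside
  \<open>H\<close> its second alternative holds. The coset \<open>H\<close> itself is full only from
  degree 2 on, whence \<open>1 \<le> u\<close>.\<close>

lemma full_old_coset:
  assumes "1 \<le> u" "z \<in> H + sums_mod u"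
  shows "z \<in> sums_mod (Suc u)"
proof -
  obtain p where p: "p \<in> sums_mod u" "z - p \<in> H" using assms by (auto simp: mem_H_plus)
  show ?thesis
  proof (cases "p \<in> H")
    case True
    then have "z \<in> H" using H_plus[OF p(2), of p] by simp
    moreover obtain v where "u = Suc v" using assms(1) by (cases u) auto
    ultimately show ?thesis using H_subset_sums_mod by auto
  next
    case False
    then have "{0 + p} + H \<subseteq> sums_mod (Suc u)"
      using full_coset_or_multiple[OF zero_sums_mod p(1)] by simp
    then show ?thesis using p by (auto simp: mem_coset)
  qed
qed

text \<open>By \<open>full_coset_or_multiple\<close>, adding \<open>a\<close> can leave
  \<open>H + sums_mod u\<close> only from the coset of \<open>u * a\<close>. If this never happened,
  \<open>H + sums_mod u\<close> would be everything, and one step later all its cosets would be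
  full.\<close>

lemma exists_new_multiple:
  assumes "1 \<le> u" "sums_mod (Suc u) \<noteq> UNIV"
  shows "\<exists>x\<in>S. int (Suc u) * x \<notin> H + sums_mod u"
proof (rule ccontr)
  assume old: "\<not> ?thesis"
  have "H + sums_mod u = UNIV"
  proof (rule generates)
    show "periodic (H + sums_mod u)" "H + sums_mod u \<noteq> {}"
      using H periodic_plus zero_sums_mod[of u] by (auto simp: set_plus_def)
    fix a w assume "a \<in> A" "w \<in> H + sums_mod u"
    then obtain p where p: "p \<in> sums_mod u" "w - p \<in> H" "a \<in> S" using A_S by (auto simp: mem_H_plus)
    have "a + p \<in> H + sums_mod u"
      using full_coset_or_multiple[OF p(3,1)]
    proof (elim disjE conjE)
      assume "p - int u * a \<in> H"
      then have "(a + p) - int (Suc u) * a \<in> H" by (simp add: algebra_simps)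
      then show ?thesis using mem_H_plus_cong old p(3) by blast
    qed
    moreover have "(a + w) - (a + p) \<in> H" using p by simp
    ultimately show "a + w \<in> H + sums_mod u" using mem_H_plus_cong by blast
  qed
  then show False using full_old_coset[OF assms(1)] assms(2) by blast
qed

text \<open>Two estimates are combined. Unions of cosets grow by \<open>\<kappa>\<close> in each
  step, which bounds \<open>d\<close> from below. The multiples of one part of \<open>A\<close>,
  which has at least \<open>dens S - \<kappa>\<close> elements, must fit into a new coset, which
  bounds \<open>dens S\<close> from above. The terms \<open>?s * \<kappa>\<close> cancel.\<close>

lemma dens_bound_of_subgroup:
  assumes "1 \<le> u" "sums_mod (Suc u) \<noteq> UNIV"
  shows "Suc u * dens S + 2 \<le> nat d + Suc u"
proof -
  let ?s = "Suc u"
  have iter: "dens H + t * \<kappa> \<le> dens (H + sums_mod t)" if "H + sums_mod t \<noteq> UNIV" for t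
    using dens_sums_mod_iterate[OF iso H(1,2) that] by blast
  have S_le: "?s * dens S \<le> ?s * share x + ?s * \<kappa>" if "x \<in> S" for x
    using mult_le_mono2[OF share_ge[OF that], of ?s] by (simp add: algebra_simps)
  have H2: "2 \<le> dens H" using dens_holes \<kappa> by simp
  obtain g where g: "g \<notin> sums_mod ?s" using assms by blast
  have g_new: "g \<notin> H + sums_mod u" using full_old_coset[OF assms(1)] g by blast
  show ?thesis
  proof (cases "g \<in> H + sums_mod ?s")
    case False
    \<comment> \<open>The coset of \<open>g\<close> is not reached at all, so it contributes a
      further \<open>dens H\<close> on top of the growth estimate.\<close>
    obtain x where x: "x \<in> S" "int ?s * x \<notin> H + sums_mod u" using exists_new_multiple[OF assms] by blast
    have "dens (sums_mod ?s \<inter> ({int ?s * x} + H)) \<le> dens ({int ?s * x} + H)" by (intro dens_mono) auto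
    then have "?s * share x + 1 \<le> dens H + ?s" using nfold_part_card[OF x] by simp
    moreover have "dens ((H + sums_mod ?s) \<union> ({g} + H)) = dens (H + sums_mod ?s) + dens ({g} + H)"
    proof (intro dens_Un_disjoint periodic_plus[OF H(1)] periodic_coset[OF H(1)])
      show "(H + sums_mod ?s) \<inter> ({g} + H) = {}" using False mem_H_plus_cong by (auto simp: mem_coset)
    qed
    then have "dens (H + sums_mod ?s) + dens H \<le> nat d" using dens_le[of "(H + sums_mod ?s) \<union> ({g} + H)"] by simp
    moreover have "dens H + ?s * \<kappa> \<le> dens (H + sums_mod ?s)" using iter False by blast
    ultimately show ?thesis using S_le[OF x(1)] H2 by linarith
  next
    case True
    then obtain y where y: "y \<in> sums_mod ?s" "g - y \<in> H" by (auto simp: mem_H_plus)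
    then obtain a p where a: "a \<in> S" "p \<in> sums_mod u" "y = a + p" by (auto simp: sums_mod_Suc[of u] set_plus_def)
    \<comment> \<open>The coset of \<open>g\<close> is reached but not full. This excludes the
      second alternative of \<open>full_coset_or_multiple\<close> for every way of writing
      \<open>g\<close> modulo \<open>H\<close> as a sum.\<close>
    have multiple: "g - int ?s * b \<in> H" if "b \<in> S" "q \<in> sums_mod u" "g - (b + q) \<in> H" for b q
      using full_coset_or_multiple[OF that(1,2)]
    proof (elim disjE conjE)
      assume "q - int u * b \<in> H"
      then have "(q - int u * b) + (g - (b + q)) \<in> H" using H_plus that(3) by blast
      then show ?thesis by (simp add: algebra_simps)
    next
      assume "{b + q} + H \<subseteq> sums_mod ?s"
      then show ?thesis using g that(3) by (auto simp: mem_coset)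
    qed
    \<comment> \<open>The missing element \<open>g\<close> lies in this coset, which improves the
      bound from \<open>nfold_part_card\<close> by one.\<close>
    have bound: "?s * share b + 2 \<le> dens H + ?s" if "b \<in> S" "g - int ?s * b \<in> H" for b
    proof -
      have new: "int ?s * b \<notin> H + sums_mod u" using g_new mem_H_plus_cong[OF that(2)] by blast
      let ?T = "sums_mod ?s \<inter> ({int ?s * b} + H)"
      have "g \<in> {int ?s * b} + H" unfolding mem_coset by (rule that(2))
      then have "?T \<noteq> {int ?s * b} + H" using g by blast
      then have "dens ?T < dens ({int ?s * b} + H)"
        using dens_eqD[of ?T "{int ?s * b} + H"] H(1)
        by (metis inf_le2 linorder_not_less periodic_Int periodic_coset periodic_sums_mod)
      then show ?thesis using nfold_part_card[OF that(1) new] by simp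
    qed
    have ga: "g - int ?s * a \<in> H" using multiple[OF a(1,2)] y a by simp
    \<comment> \<open>The common elements of \<open>?B\<close> and \<open>H + S\<close> correspond
      to representations of \<open>g\<close> modulo \<open>H\<close>. There is only one such coset,
      so inclusion-exclusion gives the growth of a sum with a uniquely represented element.\<close>
    let ?B = "{g} + uminus ` (H + sums_mod u)"
    have "?B \<inter> (H + S) \<subseteq> {a} + H"
    proof
      fix w assume "w \<in> ?B \<inter> (H + S)"
      then have "- (w - g) \<in> H + sums_mod u" "w \<in> H + S"
        unfolding Int_iff mem_coset uminus_image_iff by blast+
      then have "g - w \<in> H + sums_mod u" by simp
      then obtain b q where b: "b \<in> S" "w - b \<in> H" "q \<in> sums_mod u" "(g - w) - q \<in> H"
        using \<open>w \<in> H + S\<close> unfolding mem_H_plus by blast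
      have "g - (b + q) \<in> H" using H_plus[OF b(2,4)] by (simp add: algebra_simps)
      then have gb: "g - int ?s * b \<in> H" using multiple b by blast
      have "b - a \<in> H"
      proof (rule ccontr)
        assume "b - a \<notin> H"
        then have "dens H + 2 \<le> share b + share a" using share_pair_ge b a by blast
        then have "?s * (dens H + 2) \<le> ?s * share b + ?s * share a"
          by (metis add_mult_distrib2 mult_le_mono2)
        have arith: "k \<le> i + j \<Longrightarrow> i + 2 \<le> m \<Longrightarrow> j + 2 \<le> m \<Longrightarrow> k + 4 \<le> 2 * m" for i j k m :: nat
          by linarith
        from \<open>?s * (dens H + 2) \<le> ?s * share b + ?s * share a\<close> have "?s * (dens H + 2) + 4 \<le> 2 * (dens H + ?s)"
          using bound[OF b(1) gb] bound[OF a(1) ga] by (rule arith)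
        \<comment> \<open>For \<open>u \<ge> 1\<close> the left-hand side above is at least
          \<open>2 * (dens H + ?s) + 4\<close>, so two different cosets are impossible.\<close>
        moreover have "1 * dens H \<le> u * dens H" using assms(1) by (intro mult_le_mono1) simp
        ultimately show False by (simp add: algebra_simps)
      qed
      then show "w \<in> {a} + H" using H_plus[OF b(2)] by (force simp: mem_coset)
    qed
    then have "dens (?B \<inter> (H + S)) \<le> dens H" using dens_mono[of _ "{a} + H"] by simp
    moreover have "dens (?B \<union> (H + S)) + dens (?B \<inter> (H + S)) = dens (H + sums_mod u) + dens (H + S)"
      by (subst dens_Un_Int) (simp_all add: periodic_plus periodic_plus_left periodic_uminus H)
    moreover have "dens (?B \<union> (H + S)) \<le> nat d" by (rule dens_le)
    moreover have "dens H + u * \<kappa> \<le> dens (H + sums_mod u)" using iter g_new by blast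
    moreover note dens_HS S_le[OF a(1)] bound[OF a(1) ga]
    ultimately show ?thesis by simp
  qed
qed

end

section \<open>The bound for sumsets with the Cohen-Macaulay property\<close>

theorem (in cm_sumset) dens_bound:
  assumes "sums_mod s \<noteq> UNIV" "2 \<le> d" "2 \<le> dens S"
  shows "s * dens S + 2 \<le> nat d + s"
proof (cases "\<exists>X. periodic X \<and> X \<noteq> {} \<and> X + S \<noteq> UNIV \<and> dens (X + S) + 2 \<le> dens X + dens S")
  case False
  have "dens X + (dens S - 1) \<le> dens (X + S)" if "periodic X" "X \<noteq> {}" "X + S \<noteq> UNIV" for X
  proof -
    have "\<not> dens (X + S) + 2 \<le> dens X + dens S" using False that by blast
    then show ?thesis using assms(3) by arith
  qed
  moreover have "sums_mod 0 + sums_mod t = sums_mod t" for t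
  proof (induction t)
    case 0
    have "sums_mod 0 + sums_mod 0 \<subseteq> sums_mod 0" by (auto simp: sums_mod_0 set_plus_def)
    then show ?case using subset_plus[OF zero_sums_mod] by blast
  next
    case (Suc t)
    have "sums_mod 0 + (S + sums_mod t) = S + (sums_mod 0 + sums_mod t)" by (rule add.left_commute)
    then show ?case using Suc by (simp add: sums_mod_Suc[of t])
  qed
  \<comment> \<open>\<open>sums_mod 0\<close> consists of the multiples of \<open>d\<close>, a
    single class, from which every step gains at least \<open>dens S - 1\<close>. The strict
    inequality for \<open>sums_mod s\<close> supplies the second unit of the constant 2.\<close>
  ultimately have "dens (sums_mod 0) + s * (dens S - 1) \<le> dens (sums_mod s)"
    using dens_sums_mod_iterate[of "dens S - 1" "sums_mod 0" s] assms(1) periodic_sums_mod zero_sums_mod by simp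
  moreover have "dens (sums_mod s) < nat d"
    using dens_UNIV_D[of "sums_mod s"] assms(1) periodic_sums_mod by (meson linorder_not_less)
  moreover have "0 < dens (sums_mod 0)" using zero_sums_mod by (intro dens_pos) blast
  ultimately show ?thesis using assms(3) by (simp add: algebra_simps diff_mult_distrib2)
next
  case True
  then obtain X where X: "periodic X" "X \<noteq> {}" "X + S \<noteq> UNIV" "dens (X + S) + 2 \<le> dens X + dens S" by blast
  obtain H \<kappa> where H: "periodic H" "0 \<in> H" "\<And>x y. x \<in> H \<Longrightarrow> y \<in> H \<Longrightarrow> x - y \<in> H"
    "H + S \<noteq> UNIV" "dens (H + S) = dens H + \<kappa>"
    "\<And>X. periodic X \<Longrightarrow> X \<noteq> {} \<Longrightarrow> X + S \<noteq> UNIV \<Longrightarrow> dens X + \<kappa> \<le> dens (X + S)"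
    using atom_subgroup[OF periodic_sums_mod zero_sums_mod X(1-3)] by metis
  have "\<kappa> + 2 \<le> dens S" using H(6)[OF X(1-3)] X(4) by simp
  then interpret cm_sumset_subgroup d A H \<kappa> using H by unfold_locales auto
  show ?thesis
  proof (cases s)
    case 0
    then show ?thesis using assms by simp
  next
    case s: (Suc u)
    show ?thesis
    proof (cases "u = 0")
      case True
      then have "dens S < nat d"
        using dens_UNIV_D[of S] assms(1) periodic_sums_mod s by (metis linorder_not_less)
      then show ?thesis using s True by simp
    next
      case False
      then show ?thesis using dens_bound_of_subgroup[of u] assms(1) s by simp
    qed
  qed
qed

theorem (in cm_sumset) cm_sumset_bound:
  assumes "x \<in> nfold (Suc s) A" "x \<notin> nfold s A" "x - d \<notin> nfold s A" "3 \<le> card A" "2 \<le> d"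
  shows "s * (card A - 2) + 2 \<le> nat d"
proof -
  have "sums_mod s \<noteq> UNIV" using old_class[OF assms(1)] assms(2,3) by blast
  moreover have e: "dens S + 1 = card A" by (rule dens_S)
  moreover have "card A - 2 = dens S - 1" using e by simp
  ultimately show ?thesis using dens_bound[of s] assms(4,5) by (simp add: diff_mult_distrib2)
qed

section \<open>Polynomials and ideals of variables\<close>

abbreviation "keys \<equiv> Poly_Mapping.keys"
abbreviation "lookup \<equiv> Poly_Mapping.lookup"
abbreviation "single \<equiv> Poly_Mapping.single"

abbreviation polys :: "nat \<Rightarrow> 'k::field mpoly set" where
  "polys n \<equiv> carrier (mpoly_ring n)"

lemma polys_iff: "p \<in> polys n \<longleftrightarrow> (\<forall>m\<in>keys p. keys m \<subseteq> {1..n})"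
  by (simp add: mpoly_ring_def)

lemma mpoly_ring_simps [simp]:
  "mult (mpoly_ring n) = (*)" "one (mpoly_ring n) = 1" "zero (mpoly_ring n) = 0" "add (mpoly_ring n) = (+)"
  by (simp_all add: mpoly_ring_def)

lemma mdeg_add: "mdeg (m + m') = mdeg m + mdeg m'"
proof -
  have ext: "mdeg k = (\<Sum>i\<in>A. lookup k i)" if "finite A" "keys k \<subseteq> A" for k A
    unfolding mdeg_def using that by (intro sum.mono_neutral_left) (auto simp: in_keys_iff)
  have "mdeg (m + m') = (\<Sum>i\<in>keys m \<union> keys m'. lookup (m + m') i)"
    by (rule ext) (auto intro!: subset_trans[OF keys_add])
  then show ?thesis by (simp add: lookup_add sum.distrib ext[of "keys m \<union> keys m'"])
qed

lemma keys_add_nat: "keys (m + m') = keys m \<union> keys (m' :: nat \<Rightarrow>\<^sub>0 nat)"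
  by (auto simp: in_keys_iff lookup_add)

lemma keys_mult_E:
  assumes "m \<in> keys (p * q)"
  obtains a b where "a \<in> keys p" "b \<in> keys q" "m = a + b"
  using assms keys_mult[of p q] by blast

lemma
  shows polys_0: "0 \<in> polys n"
    and polys_1: "1 \<in> polys n"
    and polys_add: "p \<in> polys n \<Longrightarrow> q \<in> polys n \<Longrightarrow> p + q \<in> polys n"
    and polys_diff: "p \<in> polys n \<Longrightarrow> q \<in> polys n \<Longrightarrow> p - q \<in> polys n"
    and polys_uminus: "p \<in> polys n \<Longrightarrow> - p \<in> polys n"
    and polys_mult: "p \<in> polys n \<Longrightarrow> q \<in> polys n \<Longrightarrow> p * q \<in> polys n"
    and polys_const: "single 0 c \<in> polys n"
proof -
  show "0 \<in> polys n" "1 \<in> polys n" "single 0 c \<in> polys n"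
    by (auto simp: polys_iff in_keys_iff lookup_one lookup_single split: if_splits)
  show "p + q \<in> polys n" if "p \<in> polys n" "q \<in> polys n"
    using that keys_add[of p q] unfolding polys_iff by blast
  show "p - q \<in> polys n" if "p \<in> polys n" "q \<in> polys n"
    using that keys_diff[of p q] unfolding polys_iff by blast
  show "- p \<in> polys n" if "p \<in> polys n"
    using that unfolding polys_iff by simp
  show "p * q \<in> polys n" if "p \<in> polys n" "q \<in> polys n"
    unfolding polys_iff
  proof
    fix m assume "m \<in> keys (p * q)"
    then obtain a b where "a \<in> keys p" "b \<in> keys q" "m = a + b" by (rule keys_mult_E)
    then show "keys m \<subseteq> {1..n}" using that unfolding polys_iff by (simp add: keys_add_nat)
  qed
qed

lemma polys_sum: "(\<And>x. x \<in> A \<Longrightarrow> f x \<in> polys n) \<Longrightarrow> sum f A \<in> polys n"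
  by (induction A rule: infinite_finite_induct) (auto simp: polys_0 polys_add)

lemma polys_single: "keys m \<subseteq> {1..n} \<Longrightarrow> single m c \<in> polys n"
  by (auto simp: polys_iff split: if_splits)

lemma polys_var: "i \<in> {1..n} \<Longrightarrow> var i \<in> polys n"
  by (simp add: var_def polys_single)

lemma homog_iff: "p \<in> homog n j \<longleftrightarrow> p \<in> polys n \<and> (\<forall>m\<in>keys p. int (mdeg m) = j)"
  by (simp add: homog_def)

lemma
  shows homog_0: "0 \<in> homog n j"
    and homog_add: "p \<in> homog n j \<Longrightarrow> q \<in> homog n j \<Longrightarrow> p + q \<in> homog n j"
    and homog_diff: "p \<in> homog n j \<Longrightarrow> q \<in> homog n j \<Longrightarrow> p - q \<in> homog n j"
    and homog_mult: "p \<in> homog n i \<Longrightarrow> q \<in> homog n j \<Longrightarrow> p * q \<in> homog n (i + j)"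
    and homog_const: "single 0 c \<in> homog n 0"
proof -
  show "0 \<in> homog n j" by (simp add: homog_iff polys_0)
  show "p + q \<in> homog n j" if "p \<in> homog n j" "q \<in> homog n j"
    using that keys_add[of p q] unfolding homog_iff by (blast intro: polys_add)
  show "p - q \<in> homog n j" if "p \<in> homog n j" "q \<in> homog n j"
    using that keys_diff[of p q] unfolding homog_iff by (blast intro: polys_diff)
  show "single 0 c \<in> homog n 0" by (simp add: homog_iff polys_const mdeg_def)
  show "p * q \<in> homog n (i + j)" if "p \<in> homog n i" "q \<in> homog n j"
    unfolding homog_iff
  proof (intro conjI ballI polys_mult)
    fix m assume "m \<in> keys (p * q)"
    then obtain a b where "a \<in> keys p" "b \<in> keys q" "m = a + b" by (rule keys_mult_E)
    then show "int (mdeg m) = i + j" using that by (simp add: homog_iff mdeg_add)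
  qed (use that in \<open>auto simp: homog_iff\<close>)
qed

lemma homog_sum: "(\<And>x. x \<in> A \<Longrightarrow> f x \<in> homog n j) \<Longrightarrow> sum f A \<in> homog n j"
  by (induction A rule: infinite_finite_induct) (auto simp: homog_0 homog_add)

definition poly_filter :: "((nat \<Rightarrow>\<^sub>0 nat) \<Rightarrow> bool) \<Rightarrow> 'k::field mpoly \<Rightarrow> 'k mpoly" where
  "poly_filter P p = Poly_Mapping.mapp (\<lambda>m c. c when P m) p"

lemma lookup_poly_filter: "lookup (poly_filter P p) m = (lookup p m when P m)"
  by (auto simp: poly_filter_def lookup_mapp when_def in_keys_iff)

lemma keys_poly_filter: "keys (poly_filter P p) = {m \<in> keys p. P m}"
  by (auto simp: in_keys_iff lookup_poly_filter)

definition hpart :: "int \<Rightarrow> 'k::field mpoly \<Rightarrow> 'k mpoly" where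
  "hpart t = poly_filter (\<lambda>m. int (mdeg m) = t)"

lemma lookup_hpart: "lookup (hpart t p) m = (lookup p m when int (mdeg m) = t)"
  by (simp add: hpart_def lookup_poly_filter)

lemma keys_hpart: "keys (hpart t p) = {m \<in> keys p. int (mdeg m) = t}"
  by (auto simp: in_keys_iff lookup_hpart)

lemma hpart_0 [simp]: "hpart t 0 = 0" by (simp add: poly_mapping_eqI lookup_hpart)

lemma hpart_add: "hpart t (p + q) = hpart t p + hpart t q"
  by (rule poly_mapping_eqI) (simp add: lookup_hpart lookup_add when_add_distrib)

lemma hpart_sum: "hpart t (sum f A) = (\<Sum>x\<in>A. hpart t (f x))"
  by (induction A rule: infinite_finite_induct) (simp_all add: hpart_add)

lemma hpart_homog: "p \<in> polys n \<Longrightarrow> hpart t p \<in> homog n t"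
  by (auto simp: homog_iff polys_iff keys_hpart)

lemma hpart_mult:
  assumes "q \<in> homog n s"
  shows "hpart t (p * q) = hpart (t - s) p * q"
proof -
  define r where "r = p - hpart (t - s) p"
  have "hpart t (r * q) = 0"
  proof (rule poly_mapping_eqI)
    fix m
    have "m \<notin> keys (r * q)" if "int (mdeg m) = t"
    proof
      assume "m \<in> keys (r * q)"
      then obtain a b where ab: "a \<in> keys r" "b \<in> keys q" "m = a + b" by (rule keys_mult_E)
      then have "int (mdeg a) \<noteq> t - s"
        by (auto simp: r_def in_keys_iff lookup_minus lookup_hpart)
      then show False using ab assms that by (auto simp: homog_iff mdeg_add)
    qed
    then show "lookup (hpart t (r * q)) m = lookup 0 m" by (auto simp: lookup_hpart when_def in_keys_iff)
  qed
  moreover have "hpart t (hpart (t - s) p * q) = hpart (t - s) p * q"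
  proof (rule poly_mapping_eqI)
    fix m
    have "int (mdeg m) = t" if "m \<in> keys (hpart (t - s) p * q)"
    proof -
      from that obtain a b where "a \<in> keys (hpart (t - s) p)" "b \<in> keys q" "m = a + b" by (rule keys_mult_E)
      then show ?thesis using assms by (auto simp: homog_iff mdeg_add keys_hpart)
    qed
    then show "lookup (hpart t (hpart (t - s) p * q)) m = lookup (hpart (t - s) p * q) m"
      by (auto simp: lookup_hpart when_def in_keys_iff)
  qed
  moreover have "p * q = hpart (t - s) p * q + r * q" by (simp add: r_def algebra_simps)
  ultimately show ?thesis by (simp add: hpart_add)
qed

text \<open>The ideal generated by the variables in \<open>V\<close>, described by supports. It
  lives in the whole polynomial type, and \<open>V = {}\<close> gives the zero ideal, from which the
  inductions over \<open>V\<close> can start.\<close>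

definition var_ideal :: "nat set \<Rightarrow> 'k::field mpoly set" where
  "var_ideal V = {p. \<forall>m\<in>keys p. keys m \<inter> V \<noteq> {}}"

lemma var_ideal_empty: "p \<in> var_ideal {} \<longleftrightarrow> p = 0"
  by (auto simp: var_ideal_def)

lemma var_ideal_mono: "V \<subseteq> W \<Longrightarrow> var_ideal V \<subseteq> var_ideal W"
  by (auto simp: var_ideal_def)

lemma var_ideal_0 [simp]: "0 \<in> var_ideal V"
  by (simp add: var_ideal_def)

lemma var_ideal_add: "p \<in> var_ideal V \<Longrightarrow> q \<in> var_ideal V \<Longrightarrow> p + q \<in> var_ideal V"
  using keys_add[of p q] by (auto simp: var_ideal_def)

lemma var_ideal_diff: "p \<in> var_ideal V \<Longrightarrow> q \<in> var_ideal V \<Longrightarrow> p - q \<in> var_ideal V"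
  using keys_diff[of p q] by (auto simp: var_ideal_def)

lemma var_ideal_mult: "p \<in> var_ideal V \<Longrightarrow> p * q \<in> var_ideal V"
  unfolding var_ideal_def
proof (intro CollectI ballI)
  fix m assume p: "p \<in> {p. \<forall>m\<in>keys p. keys m \<inter> V \<noteq> {}}" and "m \<in> keys (p * q)"
  from this(2) obtain a b where ab: "a \<in> keys p" "m = a + b" by (rule keys_mult_E)
  then have "keys a \<inter> V \<noteq> {}" using p by blast
  then show "keys m \<inter> V \<noteq> {}" using ab by (auto simp: keys_add_nat)
qed

lemma var_ideal_sum: "(\<And>x. x \<in> A \<Longrightarrow> f x \<in> var_ideal V) \<Longrightarrow> sum f A \<in> var_ideal V"
  by (induction A rule: infinite_finite_induct) (auto simp: var_ideal_add)

lemma lookup_single_mult: "lookup (single e 1 * q) (e + k) = lookup q (k :: nat \<Rightarrow>\<^sub>0 nat)"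
  for q :: "'k::field mpoly"
  by (simp add: lookup_mult lookup_single when_mult)

lemma keys_single_mult: "m \<in> keys (single e 1 * q) \<longleftrightarrow> (\<exists>k\<in>keys q. m = e + k)"
  for q :: "'k::field mpoly"
proof
  assume "m \<in> keys (single e 1 * q)"
  then show "\<exists>k\<in>keys q. m = e + k" by (elim keys_mult_E) (auto split: if_splits)
qed (auto simp: in_keys_iff lookup_single_mult)

text \<open>Division by the monomial with exponent \<open>e\<close>, in which the terms not
  divisible by it are dropped.\<close>

definition div_mon :: "(nat \<Rightarrow>\<^sub>0 nat) \<Rightarrow> 'k::field mpoly \<Rightarrow> 'k mpoly" where
  "div_mon e p = Poly_Mapping.map_key ((+) e) p"

lemma lookup_div_mon: "lookup (div_mon e p) m = lookup p (e + m)"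
  by (simp add: div_mon_def Poly_Mapping.map_key.rep_eq)

lemma div_mon_0 [simp]: "div_mon e 0 = 0"
  by (rule poly_mapping_eqI) (simp add: lookup_div_mon)

lemma lookup_mult_div_mon:
  "lookup (single e 1 * div_mon e p) m = (if \<exists>k. m = e + k then lookup p m else 0)"
proof (cases "\<exists>k. m = e + k")
  case True
  then show ?thesis by (auto simp: lookup_single_mult lookup_div_mon)
next
  case False
  then have "m \<notin> keys (single e 1 * div_mon e p)" by (auto simp: keys_single_mult)
  then show ?thesis using False by (simp add: in_keys_iff)
qed

lemma div_mon_exact: "(\<And>m. m \<in> keys p \<Longrightarrow> \<exists>k. m = e + k) \<Longrightarrow> single e 1 * div_mon e p = p"
  by (rule poly_mapping_eqI) (auto simp: lookup_mult_div_mon in_keys_iff)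

lemma var_mult_in_var_ideal:
  assumes "var x * q \<in> var_ideal V" "x \<notin> V"
  shows "q \<in> var_ideal V"
  unfolding var_ideal_def
proof (intro CollectI ballI)
  fix k assume "k \<in> keys q"
  then have "single x 1 + k \<in> keys (var x * q)" unfolding var_def keys_single_mult by blast
  then have "keys (single x 1 + k) \<inter> V \<noteq> {}" using assms(1) by (auto simp: var_ideal_def)
  then show "keys k \<inter> V \<noteq> {}" using assms(2) by (auto simp: keys_add_nat)
qed

abbreviation div_var :: "nat \<Rightarrow> 'k::field mpoly \<Rightarrow> 'k mpoly" where
  "div_var x \<equiv> div_mon (single x 1)"

lemma dvd_single_iff: "(\<exists>k. m = single x 1 + k) \<longleftrightarrow> x \<in> keys (m :: nat \<Rightarrow>\<^sub>0 nat)"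
proof
  assume x: "x \<in> keys m"
  have "m = single x 1 + (m - single x 1)"
    by (rule poly_mapping_eqI) (use x in \<open>auto simp: lookup_add lookup_minus lookup_single in_keys_iff when_def\<close>)
  then show "\<exists>k. m = single x 1 + k" by blast
qed (auto simp: in_keys_iff lookup_add)

lemma div_var_rest:
  assumes "p \<in> var_ideal (insert x V)"
  shows "p - var x * div_var x p \<in> var_ideal V"
  unfolding var_ideal_def
proof (intro CollectI ballI)
  fix m assume "m \<in> keys (p - var x * div_var x p)"
  then have "lookup p m - (if x \<in> keys m then lookup p m else 0) \<noteq> 0"
    by (simp add: in_keys_iff lookup_minus var_def lookup_mult_div_mon dvd_single_iff[unfolded in_keys_iff]
        del: One_nat_def)
  then have "x \<notin> keys m" "m \<in> keys p" by (auto split: if_splits simp: in_keys_iff)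
  then show "keys m \<inter> V \<noteq> {}" using assms by (auto simp: var_ideal_def)
qed

lemma polys_div_mon: "p \<in> polys n \<Longrightarrow> div_mon e p \<in> polys n"
  unfolding polys_iff
proof
  fix m assume p: "\<forall>m\<in>keys p. keys m \<subseteq> {1..n}" and "m \<in> keys (div_mon e p)"
  then have "keys (e + m) \<subseteq> {1..n}" by (simp add: in_keys_iff lookup_div_mon)
  then show "keys m \<subseteq> {1..n}" by (simp add: keys_add_nat)
qed

lemma homog_div_var: "p \<in> homog n j \<Longrightarrow> div_var x p \<in> homog n (j - 1)"
  unfolding homog_iff
proof (elim conjE, intro conjI ballI polys_div_mon)
  fix m assume "\<forall>m\<in>keys p. int (mdeg m) = j" "m \<in> keys (div_var x p)"
  then have "int (mdeg (single x 1 + m)) = j" by (auto simp: in_keys_iff lookup_div_mon)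
  then show "int (mdeg m) = j - 1" by (simp add: mdeg_add) (simp add: mdeg_def)
qed

lemma homog_var: "x \<in> {1..n} \<Longrightarrow> var x \<in> homog n 1"
  by (auto simp: homog_iff polys_var) (simp add: var_def mdeg_def)

lemma lookup_mult_0: "lookup (p * q) 0 = lookup p 0 * lookup q (0 :: nat \<Rightarrow>\<^sub>0 nat)" for p q :: "'k::field mpoly"
proof -
  define p' where "p' = p - single 0 (lookup p 0)"
  have "0 \<notin> keys (p' * q)"
  proof
    assume "0 \<in> keys (p' * q)"
    then obtain a b where ab: "a \<in> keys p'" "0 = a + b" by (rule keys_mult_E)
    then have "keys a = {}" using keys_add_nat[of a b] by simp
    then show False using ab(1) by (simp add: p'_def in_keys_iff lookup_minus)
  qed
  moreover have "p * q = single 0 (lookup p 0) * q + p' * q" by (simp add: p'_def algebra_simps)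
  ultimately show ?thesis
    by (simp add: lookup_add in_keys_iff mult_map_scale_conv_mult[symmetric] Poly_Mapping.map.rep_eq when_def)
qed

lemma var_ideal_all_iff:
  assumes "p \<in> polys n"
  shows "p \<in> var_ideal {1..n} \<longleftrightarrow> lookup p 0 = 0"
proof -
  have "keys m \<inter> {1..n} = {} \<longleftrightarrow> m = 0" if "m \<in> keys p" for m
  proof -
    have "keys m \<subseteq> {1..n}" using assms that by (auto simp: polys_iff)
    then have "keys m \<inter> {1..n} = {} \<longleftrightarrow> keys m = {}" by blast
    then show ?thesis by simp
  qed
  then show ?thesis unfolding var_ideal_def by (auto simp: in_keys_iff)
qed

section \<open>Free modules\<close>

lemma lookup_scale: "lookup (scale c v) b = c * lookup v b"
  by (simp add: scale_def Poly_Mapping.map.rep_eq when_def)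

lemma keys_map_subset: "keys (Poly_Mapping.map f v) \<subseteq> keys v"
  by (auto simp: in_keys_iff Poly_Mapping.map.rep_eq when_def split: if_splits)

lemma lookup_map: "f 0 = 0 \<Longrightarrow> lookup (Poly_Mapping.map f v) b = f (lookup v b)"
  by (simp add: Poly_Mapping.map.rep_eq when_def)

text \<open>Allowing a superset of the support puts vectors with different supports over one index
  set.\<close>

lemma lookup_lin_ext:
  assumes "finite B" "keys v \<subseteq> B"
  shows "lookup (lin_ext w v) c = (\<Sum>b\<in>B. lookup v b * lookup (w b) c)"
proof -
  have "lookup (lin_ext w v) c = (\<Sum>b\<in>keys v. lookup v b * lookup (w b) c)"
    by (simp add: lin_ext_def lookup_sum lookup_scale)
  also have "\<dots> = (\<Sum>b\<in>B. lookup v b * lookup (w b) c)"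
    using assms by (intro sum.mono_neutral_left) (auto simp: in_keys_iff)
  finally show ?thesis .
qed

lemma lin_ext_add: "lin_ext w (u + v) = lin_ext w u + lin_ext w v"
proof (rule poly_mapping_eqI)
  fix c
  let ?B = "keys u \<union> keys v"
  have "keys (u + v) \<subseteq> ?B" by (rule keys_add)
  then show "lookup (lin_ext w (u + v)) c = lookup (lin_ext w u + lin_ext w v) c"
    by (simp add: lookup_lin_ext[of ?B] lookup_add distrib_right sum.distrib)
qed

lemma lin_ext_0 [simp]: "lin_ext w 0 = 0" by (simp add: lin_ext_def)

lemma lin_ext_scale: "lin_ext w (scale c v) = scale (c :: 'a::comm_semiring_0) (lin_ext w v)"
proof (rule poly_mapping_eqI)
  fix b
  have "keys (scale c v) \<subseteq> keys v" unfolding scale_def by (rule keys_map_subset)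
  then show "lookup (lin_ext w (scale c v)) b = lookup (scale c (lin_ext w v)) b"
    by (simp add: lookup_lin_ext[of "keys v"] lookup_scale sum_distrib_left mult.assoc)
qed

lemma lin_ext_diff: "lin_ext w (u - v) = lin_ext w u - lin_ext w (v :: nat \<Rightarrow>\<^sub>0 'c::ring)"
  using lin_ext_add[of w "u - v" v] by (simp add: algebra_simps)

lemma lin_ext_single: "lin_ext w (single b c) = scale c (w b)"
  by (rule poly_mapping_eqI) (simp add: lookup_lin_ext[of "{b}"] lookup_scale)

lemma free_mod_iff: "f \<in> free_mod n B \<longleftrightarrow> keys f \<subseteq> B \<and> (\<forall>b. lookup f b \<in> polys n)"
  by (simp add: free_mod_def)

lemma
  shows free_mod_0: "0 \<in> free_mod n B"
    and free_mod_add: "f \<in> free_mod n B \<Longrightarrow> g \<in> free_mod n B \<Longrightarrow> f + g \<in> free_mod n B"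
    and free_mod_diff: "f \<in> free_mod n B \<Longrightarrow> g \<in> free_mod n B \<Longrightarrow> f - g \<in> free_mod n B"
    and free_mod_scale: "p \<in> polys n \<Longrightarrow> f \<in> free_mod n B \<Longrightarrow> scale p f \<in> free_mod n B"
proof -
  show "0 \<in> free_mod n B" by (simp add: free_mod_iff polys_0)
  show "f + g \<in> free_mod n B" if "f \<in> free_mod n B" "g \<in> free_mod n B"
    using that keys_add[of f g] by (auto simp: free_mod_iff lookup_add polys_add)
  show "f - g \<in> free_mod n B" if "f \<in> free_mod n B" "g \<in> free_mod n B"
    using that keys_diff[of f g] by (auto simp: free_mod_iff lookup_minus polys_diff)
  show "scale p f \<in> free_mod n B" if "p \<in> polys n" "f \<in> free_mod n B"
    using that keys_map_subset[of _ f] by (auto simp: free_mod_iff lookup_scale polys_mult) (auto simp: scale_def)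
qed

lemma lin_ext_in_free_mod:
  fixes f :: "'k::field pvec"
  assumes "f \<in> free_mod n B" "\<And>b. b \<in> B \<Longrightarrow> w b \<in> free_mod n C"
  shows "lin_ext w f \<in> free_mod n C"
proof -
  have sum_closed: "sum g A \<in> free_mod n C" if "\<And>b. b \<in> A \<Longrightarrow> g b \<in> free_mod n C" for g :: "nat \<Rightarrow> 'k pvec" and A
    using that by (induction A rule: infinite_finite_induct) (auto simp: free_mod_0 free_mod_add)
  show ?thesis unfolding lin_ext_def
  proof (rule sum_closed)
    fix b assume "b \<in> keys f"
    then have "w b \<in> free_mod n C" using assms by (auto simp: free_mod_iff[of f])
    then show "scale (lookup f b) (w b) \<in> free_mod n C"
      using assms(1) by (intro free_mod_scale) (simp add: free_mod_iff[of f])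
  qed
qed

section \<open>Homogeneous vectors and vectors with entries in an ideal of variables\<close>

definition vec_homog :: "nat \<Rightarrow> nat set \<Rightarrow> (nat \<Rightarrow> int) \<Rightarrow> int \<Rightarrow> 'k::field pvec set" where
  "vec_homog n B \<delta> j = {f \<in> free_mod n B. \<forall>b. lookup f b \<in> homog n (j - \<delta> b)}"

definition vec_part :: "(nat \<Rightarrow> int) \<Rightarrow> int \<Rightarrow> 'k::field pvec \<Rightarrow> 'k pvec" where
  "vec_part \<delta> j f = Poly_Mapping.mapp (\<lambda>b p. hpart (j - \<delta> b) p) f"

definition vec_var_ideal :: "nat set \<Rightarrow> 'k::field pvec set" where
  "vec_var_ideal V = {f. \<forall>b. lookup f b \<in> var_ideal V}"

lemma lookup_vec_part: "lookup (vec_part \<delta> j f) b = hpart (j - \<delta> b) (lookup f b)"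
  by (auto simp: vec_part_def lookup_mapp when_def in_keys_iff)

lemma keys_vec_part: "keys (vec_part \<delta> j f) \<subseteq> keys f"
  unfolding vec_part_def by (rule keys_mapp_subset)

lemma vec_part_homog: "f \<in> free_mod n B \<Longrightarrow> vec_part \<delta> j f \<in> vec_homog n B \<delta> j"
  using keys_vec_part[of \<delta> j f] hpart_homog
  by (fastforce simp: vec_homog_def free_mod_iff lookup_vec_part homog_iff)

lemma vec_part_add: "vec_part \<delta> j (f + g) = vec_part \<delta> j f + vec_part \<delta> j g"
  by (rule poly_mapping_eqI) (simp add: lookup_vec_part lookup_add hpart_add)

lemma hpart_id: "p \<in> homog n t \<Longrightarrow> hpart t p = p"
  by (rule poly_mapping_eqI) (auto simp: lookup_hpart when_def homog_iff in_keys_iff)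

lemma vec_part_id: "f \<in> vec_homog n B \<delta> j \<Longrightarrow> vec_part \<delta> j f = f"
  by (rule poly_mapping_eqI) (auto simp: vec_homog_def lookup_vec_part intro: hpart_id)

lemma vec_homog_diff: "f \<in> vec_homog n B \<delta> j \<Longrightarrow> g \<in> vec_homog n B \<delta> j \<Longrightarrow> f - g \<in> vec_homog n B \<delta> j"
  by (auto simp: vec_homog_def free_mod_diff lookup_minus homog_diff)

lemma vec_part_lin_ext:
  assumes f: "f \<in> free_mod n B"
    and w: "\<And>b. b \<in> B \<Longrightarrow> w b \<in> free_mod n C"
      "\<And>b c. b \<in> B \<Longrightarrow> c \<in> C \<Longrightarrow> lookup (w b) c \<in> homog n (\<delta>' b - \<delta> c)"
  shows "vec_part \<delta> j (lin_ext w f) = lin_ext w (vec_part \<delta>' j f)"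
proof (rule poly_mapping_eqI)
  fix c
  have "hpart (j - \<delta> c) (lookup f b * lookup (w b) c) = hpart (j - \<delta>' b) (lookup f b) * lookup (w b) c"
    if "b \<in> keys f" for b
  proof -
    have "b \<in> B" using that f by (auto simp: free_mod_iff)
    then have "keys (w b) \<subseteq> C" using w(1) by (simp add: free_mod_iff)
    then have "c \<notin> C \<Longrightarrow> lookup (w b) c = 0" by (auto simp: in_keys_iff)
    then have "lookup (w b) c \<in> homog n (\<delta>' b - \<delta> c)"
      using w(2)[OF \<open>b \<in> B\<close>] homog_0 by (cases "c \<in> C") auto
    from hpart_mult[OF this, of "j - \<delta> c" "lookup f b"] show ?thesis by (simp add: algebra_simps)
  qed
  then show "lookup (vec_part \<delta> j (lin_ext w f)) c = lookup (lin_ext w (vec_part \<delta>' j f)) c"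
    using keys_vec_part[of \<delta>' j f]
    by (simp add: lookup_vec_part lookup_lin_ext[of "keys f"] hpart_sum)
qed

lemma vec_homog_lin_ext:
  assumes f: "f \<in> vec_homog n B \<delta>' j"
    and w: "\<And>b. b \<in> B \<Longrightarrow> w b \<in> free_mod n C"
      "\<And>b c. b \<in> B \<Longrightarrow> c \<in> C \<Longrightarrow> lookup (w b) c \<in> homog n (\<delta>' b - \<delta> c)"
  shows "lin_ext w f \<in> vec_homog n C \<delta> j"
proof -
  have f': "f \<in> free_mod n B" using f by (simp add: vec_homog_def)
  have "vec_part \<delta> j (lin_ext w f) = lin_ext w (vec_part \<delta>' j f)"
    by (rule vec_part_lin_ext[OF f' w])
  then have "vec_part \<delta> j (lin_ext w f) = lin_ext w f" by (simp add: vec_part_id[OF f])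
  moreover have "vec_part \<delta> j (lin_ext w f) \<in> vec_homog n C \<delta> j"
    by (rule vec_part_homog[OF lin_ext_in_free_mod[OF f' w(1)]])
  ultimately show ?thesis by simp
qed

lemma vec_var_ideal_empty: "f \<in> vec_var_ideal {} \<longleftrightarrow> f = 0"
  by (auto simp: vec_var_ideal_def var_ideal_empty intro: poly_mapping_eqI)

lemma vec_var_ideal_mono: "V \<subseteq> W \<Longrightarrow> vec_var_ideal V \<subseteq> vec_var_ideal W"
  using var_ideal_mono[of V W] by (auto simp: vec_var_ideal_def)

lemma
  fixes f g :: "'k::field pvec"
  shows vec_var_ideal_0: "0 \<in> vec_var_ideal V"
    and vec_var_ideal_add: "f \<in> vec_var_ideal V \<Longrightarrow> g \<in> vec_var_ideal V \<Longrightarrow> f + g \<in> vec_var_ideal V"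
    and vec_var_ideal_diff: "f \<in> vec_var_ideal V \<Longrightarrow> g \<in> vec_var_ideal V \<Longrightarrow> f - g \<in> vec_var_ideal V"
    and vec_var_ideal_scale: "f \<in> vec_var_ideal V \<Longrightarrow> scale p f \<in> vec_var_ideal V"
    and vec_var_ideal_scale_var: "x \<in> V \<Longrightarrow> scale (var x) f \<in> vec_var_ideal V"
    and vec_var_ideal_lin_ext: "f \<in> vec_var_ideal V \<Longrightarrow> lin_ext w f \<in> vec_var_ideal V"
proof -
  have "var x * p \<in> var_ideal V" if "x \<in> V" for p :: "'k mpoly"
    using that by (intro var_ideal_mult) (auto simp: var_def var_ideal_def)
  then show "scale (var x) f \<in> vec_var_ideal V" if "x \<in> V"
    using that by (simp add: vec_var_ideal_def lookup_scale)
  show "f \<in> vec_var_ideal V \<Longrightarrow> scale p f \<in> vec_var_ideal V"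
    using var_ideal_mult by (fastforce simp: vec_var_ideal_def lookup_scale mult.commute[of p])
  show "f \<in> vec_var_ideal V \<Longrightarrow> lin_ext w f \<in> vec_var_ideal V"
    by (auto simp: vec_var_ideal_def lookup_lin_ext[of "keys f"] intro!: var_ideal_sum var_ideal_mult)
qed (auto simp: vec_var_ideal_def lookup_add lookup_minus var_ideal_add var_ideal_diff)

definition vec_div_var :: "nat \<Rightarrow> 'k::field pvec \<Rightarrow> 'k pvec" where
  "vec_div_var x f = Poly_Mapping.map (div_var x) f"

lemma lookup_vec_div_var: "lookup (vec_div_var x f) b = div_var x (lookup f b)"
  by (simp add: vec_div_var_def lookup_map)

lemma vec_div_var_free_mod: "f \<in> free_mod n B \<Longrightarrow> vec_div_var x f \<in> free_mod n B"
  using keys_map_subset[of "div_var x" f]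
  by (auto simp: free_mod_iff lookup_vec_div_var polys_div_mon) (auto simp: vec_div_var_def)

lemma vec_div_var_homog: "f \<in> vec_homog n B \<delta> j \<Longrightarrow> vec_div_var x f \<in> vec_homog n B \<delta> (j - 1)"
proof -
  assume f: "f \<in> vec_homog n B \<delta> j"
  have "div_var x (lookup f b) \<in> homog n (j - 1 - \<delta> b)" for b
    using f homog_div_var[of "lookup f b" n "j - \<delta> b" x] by (simp add: vec_homog_def algebra_simps)
  then show ?thesis using f by (simp add: vec_homog_def vec_div_var_free_mod lookup_vec_div_var)
qed

lemma scale_var_homog:
  assumes "x \<in> {1..n}" "f \<in> vec_homog n B \<delta> (j - 1)"
  shows "scale (var x) f \<in> vec_homog n B \<delta> j"
proof -
  have "var x * lookup f b \<in> homog n (j - \<delta> b)" for b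
    using assms homog_mult[OF homog_var[OF assms(1)], of "lookup f b" "j - 1 - \<delta> b"] by (simp add: vec_homog_def)
  then show ?thesis using assms by (simp add: vec_homog_def free_mod_scale polys_var lookup_scale)
qed

lemma vec_div_var_rest:
  assumes "f \<in> vec_var_ideal (insert x V)"
  shows "f - scale (var x) (vec_div_var x f) \<in> vec_var_ideal V"
  using assms div_var_rest by (fastforce simp: vec_var_ideal_def lookup_minus lookup_scale lookup_vec_div_var)

lemma scale_var_in_vec_var_ideal:
  "scale (var x) f \<in> vec_var_ideal V \<Longrightarrow> x \<notin> V \<Longrightarrow> f \<in> vec_var_ideal V"
  unfolding vec_var_ideal_def using var_mult_in_var_ideal by (auto simp: lookup_scale)

section \<open>Vanishing of Tor\<close>

text \<open>A graded complex of free modules, exact in positive degrees, whose zeroth homology embeds via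
  \<open>\<epsilon>\<close> into a domain on which \<open>S\<close> acts through \<open>\<psi>\<close>. The variables \<open>x\<close>, \<open>y\<close> form a regular
  sequence on the image, and together they generate it in degrees above \<open>r\<close>.\<close>

locale regular_resolution =
  fixes n :: nat and F :: "('k::field, 'm) free_complex"
    and \<epsilon> :: "'k pvec \<Rightarrow> 'e::idom" and \<psi> :: "'k mpoly \<Rightarrow> 'e" and x y :: nat and r :: int
  assumes bdiff: "b \<in> basis F (Suc i) \<Longrightarrow> bdiff F i b \<in> free_mod n (basis F i)"
    and bdiff_homog: "b \<in> basis F (Suc i) \<Longrightarrow> c \<in> basis F i \<Longrightarrow>
       lookup (bdiff F i b) c \<in> homog n (bdeg F (Suc i) b - bdeg F i c)"
    and exact: "{f \<in> free_mod n (basis F (Suc i)). differential F i f = 0} =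
        differential F (Suc i) ` free_mod n (basis F (Suc (Suc i)))"
    and exact_0: "{f \<in> free_mod n (basis F 0). \<epsilon> f = 0} = differential F 0 ` free_mod n (basis F 1)"
    and \<epsilon>_add: "f \<in> free_mod n (basis F 0) \<Longrightarrow> g \<in> free_mod n (basis F 0) \<Longrightarrow> \<epsilon> (f + g) = \<epsilon> f + \<epsilon> g"
    and \<epsilon>_scale: "p \<in> polys n \<Longrightarrow> f \<in> free_mod n (basis F 0) \<Longrightarrow> \<epsilon> (scale p f) = \<psi> p * \<epsilon> f"
    and x: "x \<in> {1..n}" and y: "y \<in> {1..n}" and xy: "x \<noteq> y"
    and regular_x: "\<psi> (var x) \<noteq> 0"
    and regular_y: "f \<in> free_mod n (basis F 0) \<Longrightarrow> g \<in> free_mod n (basis F 0) \<Longrightarrow>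
       \<psi> (var y) * \<epsilon> f = \<psi> (var x) * \<epsilon> g \<Longrightarrow> \<exists>h\<in>free_mod n (basis F 0). \<epsilon> f = \<psi> (var x) * \<epsilon> h"
    and high_degree: "f \<in> vec_homog n (basis F 0) (bdeg F 0) j \<Longrightarrow> r < j \<Longrightarrow>
       \<exists>g\<in>free_mod n (basis F 0). \<exists>h\<in>free_mod n (basis F 0). \<epsilon> f = \<psi> (var x) * \<epsilon> g + \<psi> (var y) * \<epsilon> h"
begin

abbreviation "FM i \<equiv> free_mod n (basis F i)"
abbreviation "FH i j \<equiv> vec_homog n (basis F i) (bdeg F i) j"
abbreviation "d i \<equiv> differential F i"

lemma d_simps: "d i (f + g) = d i f + d i g" "d i (f - g) = d i f - d i g" "d i (scale p f) = scale p (d i f)"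
  by (simp_all add: differential_def lin_ext_add lin_ext_diff lin_ext_scale)

lemma d_FM: "f \<in> FM (Suc i) \<Longrightarrow> d i f \<in> FM i"
  unfolding differential_def by (rule lin_ext_in_free_mod[OF _ bdiff])

lemma d_FH: "f \<in> FH (Suc i) j \<Longrightarrow> d i f \<in> FH i j"
  unfolding differential_def by (rule vec_homog_lin_ext[OF _ bdiff bdiff_homog])

lemma FH_FM: "f \<in> FH i j \<Longrightarrow> f \<in> FM i"
  by (simp add: vec_homog_def)

lemma FM_var: "z \<in> {1..n} \<Longrightarrow> f \<in> FM i \<Longrightarrow> scale (var z) f \<in> FM i"
  by (simp add: free_mod_scale polys_var)

lemma \<epsilon>_diff: "f \<in> FM 0 \<Longrightarrow> g \<in> FM 0 \<Longrightarrow> \<epsilon> (f - g) = \<epsilon> f - \<epsilon> g"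
  using \<epsilon>_add[of "f - g" g] by (simp add: free_mod_diff algebra_simps)

lemma d_d: "f \<in> FM (Suc (Suc i)) \<Longrightarrow> d i (d (Suc i) f) = 0"
  using exact[of i] by blast

lemma \<epsilon>_d: "f \<in> FM 1 \<Longrightarrow> \<epsilon> (d 0 f) = 0"
  using exact_0 by blast

text \<open>Representatives of cycles in the reduction of \<open>F\<close> modulo the variables in
  \<open>V\<close>; \<open>boundary\<close> is the matching condition for being a boundary there.
  Working with representatives avoids quotient modules. In position 0 every vector is a
  cycle.\<close>

definition cycle :: "nat set \<Rightarrow> nat \<Rightarrow> 'k pvec \<Rightarrow> bool" where
  "cycle V i f \<longleftrightarrow> f \<in> FM i \<and> (\<forall>l. i = Suc l \<longrightarrow> d l f \<in> vec_var_ideal V)"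

definition boundary :: "nat set \<Rightarrow> nat \<Rightarrow> 'k pvec \<Rightarrow> bool" where
  "boundary V i f \<longleftrightarrow> (\<exists>g\<in>FM (Suc i). \<exists>h\<in>FM i. h \<in> vec_var_ideal V \<and> f = d i g + h)"

lemma boundary_I: "g \<in> FM (Suc i) \<Longrightarrow> h \<in> FM i \<Longrightarrow> h \<in> vec_var_ideal V \<Longrightarrow> f = d i g + h \<Longrightarrow> boundary V i f"
  by (auto simp: boundary_def)

lemma boundary_mono: "boundary V i f \<Longrightarrow> V \<subseteq> W \<Longrightarrow> boundary W i f"
  unfolding boundary_def using vec_var_ideal_mono by blast

text \<open>The differential preserves degrees, so it is enough to take the parts of degree
  \<open>j\<close> of \<open>g\<close> and \<open>h\<close>.\<close>

lemma boundary_homog: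
  assumes "boundary V i f" "f \<in> FH i j"
  obtains g h where "g \<in> FH (Suc i) j" "h \<in> FM i" "h \<in> vec_var_ideal V" "f = d i g + h"
proof -
  obtain g h where gh: "g \<in> FM (Suc i)" "h \<in> FM i" "h \<in> vec_var_ideal V" "f = d i g + h"
    using assms(1) by (auto simp: boundary_def)
  let ?g = "vec_part (bdeg F (Suc i)) j g" and ?h = "vec_part (bdeg F i) j h"
  have "f = vec_part (bdeg F i) j (d i g) + ?h"
    using vec_part_id[OF assms(2)] gh(4) by (simp add: vec_part_add)
  also have "vec_part (bdeg F i) j (d i g) = d i ?g"
    unfolding differential_def by (rule vec_part_lin_ext[OF gh(1) bdiff bdiff_homog])
  finally have "f = d i ?g + ?h" .
  moreover have "?g \<in> FH (Suc i) j" "?h \<in> FH i j" using gh vec_part_homog by blast+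
  moreover have "?h \<in> vec_var_ideal V"
    using gh(3) by (auto simp: vec_var_ideal_def var_ideal_def lookup_vec_part keys_hpart)
  ultimately show ?thesis using that FH_FM by blast
qed

text \<open>The chase behind the long exact sequence of multiplication by the variable \<open>z\<close>.\<close>

lemma boundary_insert:
  assumes z: "z \<in> {1..n}" and f: "f \<in> FM (Suc i)"
    and df: "d i f = scale (var z) g + h" and h: "h \<in> vec_var_ideal V"
    and g: "g = d i g' + h'" "g' \<in> FM (Suc i)" "h' \<in> vec_var_ideal V"
    and lower: "cycle V (Suc i) (f - scale (var z) g') \<Longrightarrow> boundary V (Suc i) (f - scale (var z) g')"
  shows "boundary (insert z V) (Suc i) f"
proof -
  have "d i (f - scale (var z) g') = h + scale (var z) h'"
  proof -
    have "scale (var z) g = scale (var z) (d i g') + scale (var z) h'"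
      by (rule poly_mapping_eqI) (simp add: g(1) lookup_scale lookup_add distrib_left)
    then show ?thesis by (simp add: d_simps df)
  qed
  then have "d i (f - scale (var z) g') \<in> vec_var_ideal V"
    using h g(3) by (simp add: vec_var_ideal_add vec_var_ideal_scale)
  then have "cycle V (Suc i) (f - scale (var z) g')"
    using f g(2) z by (simp add: cycle_def free_mod_diff FM_var)
  from lower[OF this] obtain u v where uv: "u \<in> FM (Suc (Suc i))" "v \<in> FM (Suc i)" "v \<in> vec_var_ideal V"
    "f - scale (var z) g' = d (Suc i) u + v" by (auto simp: boundary_def)
  show ?thesis
  proof (rule boundary_I[OF uv(1), of "v + scale (var z) g'"])
    show "v + scale (var z) g' \<in> FM (Suc i)" using uv g z by (simp add: free_mod_add FM_var)
    have "v \<in> vec_var_ideal (insert z V)" using uv(3) vec_var_ideal_mono[of V "insert z V"] by blast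
    then show "v + scale (var z) g' \<in> vec_var_ideal (insert z V)"
      by (intro vec_var_ideal_add vec_var_ideal_scale_var) auto
    show "f = d (Suc i) u + (v + scale (var z) g')" using uv(4) by (simp add: algebra_simps)
  qed
qed

text \<open>The connecting map of multiplication by \<open>z\<close>, on representatives. That
  \<open>g\<close> is a cycle follows from \<open>d (d f) = 0\<close>: multiplied by
  \<open>z\<close> its differential lies in the ideal of \<open>V\<close>, and \<open>z\<close> is a
  nonzerodivisor modulo the other variables.\<close>

lemma division:
  assumes z: "z \<in> {1..n}" and f: "f \<in> FM (Suc i)" "d i f \<in> vec_var_ideal (insert z V)"
  obtains g h where "g \<in> FM i" "h \<in> FM i" "h \<in> vec_var_ideal V" "d i f = scale (var z) g + h"
    "\<And>j. f \<in> FH (Suc i) j \<Longrightarrow> g \<in> FH i (j - 1)" "z \<notin> V \<Longrightarrow> cycle V i g"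
proof -
  let ?g = "vec_div_var z (d i f)" let ?h = "d i f - scale (var z) ?g"
  have gFM: "?g \<in> FM i" and hFM: "?h \<in> FM i"
    using d_FM[OF f(1)] z by (simp_all add: vec_div_var_free_mod free_mod_diff FM_var)
  have hV: "?h \<in> vec_var_ideal V" by (rule vec_div_var_rest[OF f(2)])
  show ?thesis
  proof (rule that[of ?g ?h])
    show "d i f = scale (var z) ?g + ?h" by simp
    show "?g \<in> FH i (j - 1)" if "f \<in> FH (Suc i) j" for j using vec_div_var_homog[OF d_FH[OF that]] .
    assume zV: "z \<notin> V"
    show "cycle V i ?g" unfolding cycle_def
    proof (intro conjI allI impI gFM)
      fix l assume l: "i = Suc l"
      have "d l (d i f) = 0" using d_d f(1) l by blast
      then have "scale (var z) (d l ?g) = - d l ?h" by (simp add: d_simps)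
      also have "- d l ?h = 0 - d l ?h" by simp
      also have "\<dots> \<in> vec_var_ideal V"
      proof (rule vec_var_ideal_diff[OF vec_var_ideal_0])
        show "d l ?h \<in> vec_var_ideal V"
          unfolding differential_def[of F l] by (rule vec_var_ideal_lin_ext[OF hV])
      qed
      finally show "d l ?g \<in> vec_var_ideal V" using scale_var_in_vec_var_ideal zV by blast
    qed
  qed (use gFM hFM hV in auto)
qed

lemma exact_empty: "cycle {} (Suc i) f \<Longrightarrow> boundary {} (Suc i) f"
  using exact[of i] by (force simp: cycle_def boundary_def vec_var_ideal_empty intro: free_mod_0)

text \<open>In positive positions the connecting map lands in a vanishing homology. In position 0 it
  lands in the elements killed by \<open>x\<close>, and there are none because
  \<open>\<epsilon>\<close> takes values in a domain.\<close>

lemma exact_x: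
  assumes "cycle {x} (Suc i) f"
  shows "boundary {x} (Suc i) f"
proof -
  have f: "f \<in> FM (Suc i)" "d i f \<in> vec_var_ideal (insert x {})" using assms by (auto simp: cycle_def)
  obtain g h where gh: "g \<in> FM i" "h \<in> vec_var_ideal {}" "d i f = scale (var x) g + h"
    "cycle {} i g" using division[OF x f] by (metis empty_iff)
  have "boundary {} i g"
  proof (cases i)
    case (Suc l) then show ?thesis using exact_empty gh by blast
  next
    case 0
    have "h = 0" using gh vec_var_ideal_empty by blast
    then have "d 0 f = scale (var x) g" using gh(3) 0 by simp
    moreover have "\<epsilon> (d 0 f) = 0" by (rule \<epsilon>_d) (use f(1) 0 in simp)
    ultimately have "\<epsilon> (scale (var x) g) = 0" by simp
    then have "\<epsilon> g = 0" using \<epsilon>_scale[of "var x" g] regular_x polys_var[OF x] gh(1) 0 by simp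
    then show ?thesis
      using exact_0 gh(1) 0 by (force simp: boundary_def vec_var_ideal_empty intro: free_mod_0)
  qed
  then obtain g' h' where "g' \<in> FM (Suc i)" "h' \<in> vec_var_ideal {}" "g = d i g' + h'" by (auto simp: boundary_def)
  then show ?thesis
    using boundary_insert[OF x f(1) gh(3,2)] exact_empty by blast
qed

text \<open>The same chase once more; in position 0 the obstruction consists of the elements killed
  by \<open>y\<close> modulo \<open>x\<close>, which \<open>regular_y\<close> excludes.\<close>

lemma exact_xy:
  assumes "cycle {y, x} (Suc i) f"
  shows "boundary {y, x} (Suc i) f"
proof -
  have f: "f \<in> FM (Suc i)" "d i f \<in> vec_var_ideal (insert y {x})" using assms by (auto simp: cycle_def)
  obtain g h where gh: "g \<in> FM i" "h \<in> vec_var_ideal {x}" "d i f = scale (var y) g + h"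
    "cycle {x} i g" "h \<in> FM i" using division[OF y f] xy by (metis singletonD)
  have "boundary {x} i g"
  proof (cases i)
    case (Suc l) then show ?thesis using exact_x gh by blast
  next
    case 0
    let ?h = "vec_div_var x h"
    have "h - scale (var x) ?h \<in> vec_var_ideal {}" by (rule vec_div_var_rest) (use gh in simp)
    then have h: "h = scale (var x) ?h" by (simp add: vec_var_ideal_empty)
    have hFM: "?h \<in> FM 0" using gh(5) 0 vec_div_var_free_mod by blast
    have gFM: "g \<in> FM 0" using gh 0 by simp
    have "0 = \<epsilon> (d 0 f)" by (rule \<epsilon>_d[symmetric]) (use f(1) 0 in simp)
    also have "d 0 f = scale (var y) g + scale (var x) ?h" using gh(3) 0 h by metis
    also have "\<epsilon> (scale (var y) g + scale (var x) ?h) = \<psi> (var y) * \<epsilon> g + \<psi> (var x) * \<epsilon> ?h"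
      using gFM hFM x y by (simp add: \<epsilon>_add \<epsilon>_scale FM_var polys_var)
    finally have "\<psi> (var y) * \<epsilon> g = - (\<psi> (var x) * \<epsilon> ?h)" by (simp add: eq_neg_iff_add_eq_0)
    also have "\<dots> = \<psi> (var x) * \<epsilon> (0 - ?h)"
    proof -
      have "\<epsilon> 0 + \<epsilon> 0 = \<epsilon> 0 + 0" using \<epsilon>_add[OF free_mod_0 free_mod_0] by simp
      then have "\<epsilon> 0 = 0" by (rule add_left_imp_eq)
      then show ?thesis using \<epsilon>_diff[OF free_mod_0 hFM] by simp
    qed
    finally obtain k where k: "k \<in> FM 0" "\<epsilon> g = \<psi> (var x) * \<epsilon> k"
      using regular_y[OF gFM, of "0 - ?h"] hFM free_mod_diff free_mod_0 by blast
    then have "\<epsilon> (g - scale (var x) k) = 0" "g - scale (var x) k \<in> FM 0"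
      using gFM x by (simp_all add: \<epsilon>_diff \<epsilon>_scale FM_var polys_var free_mod_diff)
    then obtain g' where "g' \<in> FM 1" "g - scale (var x) k = d 0 g'" using exact_0 by blast
    moreover have "scale (var x) k \<in> FM 0" "scale (var x) k \<in> vec_var_ideal {x}"
      using k x by (auto simp: FM_var vec_var_ideal_scale_var)
    moreover have "g = d 0 g' + scale (var x) k" using calculation by (simp add: algebra_simps)
    ultimately show ?thesis using 0 boundary_I[of g' 0] by simp
  qed
  then obtain g' h' where "g' \<in> FM (Suc i)" "h' \<in> vec_var_ideal {x}" "g = d i g' + h'" by (auto simp: boundary_def)
  then show ?thesis
    using boundary_insert[OF y f(1) gh(3,2)] exact_x by blast
qed

section \<open>Vanishing above the line j = r + i, one variable at a time\<close>

definition vanishing :: "nat set \<Rightarrow> bool" where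
  "vanishing V \<longleftrightarrow> (\<forall>i j f. f \<in> FH i j \<longrightarrow> cycle V i f \<longrightarrow> r + int i < j \<longrightarrow> boundary V i f)"

lemma vanishing_xy: "vanishing {y, x}"
  unfolding vanishing_def
proof (intro allI impI)
  fix i j f assume f: "f \<in> FH i j" "cycle {y, x} i f" "r + int i < j"
  show "boundary {y, x} i f"
  proof (cases i)
    case (Suc l) then show ?thesis using exact_xy f by blast
  next
    case 0
    obtain g h where gh: "g \<in> FM 0" "h \<in> FM 0" "\<epsilon> f = \<psi> (var x) * \<epsilon> g + \<psi> (var y) * \<epsilon> h"
      using high_degree[of f j] f 0 by auto
    let ?k = "scale (var x) g + scale (var y) h"
    have k: "?k \<in> FM 0" using gh x y by (simp add: free_mod_add FM_var)
    have "\<epsilon> (f - ?k) = 0"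
      using gh k f(1) x y 0 by (simp add: \<epsilon>_diff \<epsilon>_add \<epsilon>_scale FM_var FH_FM polys_var)
    moreover have "f - ?k \<in> FM 0" using f(1) k 0 FH_FM free_mod_diff by blast
    ultimately obtain g' where g': "g' \<in> FM 1" "f - ?k = d 0 g'" using exact_0 by blast
    have "?k \<in> vec_var_ideal {y, x}" by (intro vec_var_ideal_add vec_var_ideal_scale_var) auto
    moreover have "f = d 0 g' + ?k" using g'(2) by (simp add: algebra_simps)
    ultimately show ?thesis using 0 g' k boundary_I[of g' 0 ?k] by simp
  qed
qed

text \<open>The connecting map lowers both the position and the degree by one, so the condition
  \<open>r + i < j\<close> is preserved and both neighbours in the long exact sequence
  vanish.\<close>

lemma vanishing_insert:
  assumes V: "vanishing V" and z: "z \<in> {1..n}" "z \<notin> V"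
  shows "vanishing (insert z V)"
  unfolding vanishing_def
proof (intro allI impI)
  fix i j f assume f: "f \<in> FH i j" "cycle (insert z V) i f" "r + int i < j"
  show "boundary (insert z V) i f"
  proof (cases i)
    case 0
    then have "cycle V i f" using f by (simp add: cycle_def)
    then show ?thesis using V f boundary_mono unfolding vanishing_def by blast
  next
    case (Suc l)
    have f': "f \<in> FM (Suc l)" "d l f \<in> vec_var_ideal (insert z V)" using f Suc by (auto simp: cycle_def)
    obtain g h where gh: "h \<in> vec_var_ideal V" "d l f = scale (var z) g + h"
      "g \<in> FH l (j - 1)" "cycle V l g" using division[OF z(1) f'] f(1) z(2) Suc by metis
    have "boundary V l g" using V gh f(3) Suc unfolding vanishing_def by force
    then obtain g' h' where g': "g' \<in> FH (Suc l) (j - 1)" "h' \<in> vec_var_ideal V" "g = d l g' + h'"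
      using boundary_homog gh(3) by blast
    have "f - scale (var z) g' \<in> FH (Suc l) j"
      using f(1) Suc scale_var_homog[OF z(1) g'(1)] vec_homog_diff by blast
    then show ?thesis
      using boundary_insert[OF z(1) f'(1) gh(2,1) g'(3) FH_FM[OF g'(1)] g'(2)] V f(3) Suc
      unfolding vanishing_def by blast
  qed
qed

lemma vanishing_all: "vanishing {1..n}"
proof -
  have "vanishing (W \<union> {y, x})" if "finite W" "W \<subseteq> {1..n}" for W
    using that
  proof (induction W rule: finite_induct)
    case (insert z W)
    have e: "insert z W \<union> {y, x} = insert z (W \<union> {y, x})" by auto
    have IH: "vanishing (W \<union> {y, x})" "z \<in> {1..n}" using insert by auto
    show ?case unfolding e
      using vanishing_insert[OF IH] IH(1) by (cases "z \<in> W \<union> {y, x}") (metis insert_absorb)+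
  qed (simp add: vanishing_xy)
  from this[of "{1..n}"] have "vanishing ({1..n} \<union> {y, x})" by simp
  moreover have "{1..n} \<union> {y, x} = {1..n}" using x y by blast
  ultimately show ?thesis by simp
qed

text \<open>Modulo all variables only the constant terms of vectors and matrices survive, so cycles
  and boundaries for \<open>{1..n}\<close> are those of the complex that computes
  \<open>Tor\<close>.\<close>

theorem tensor_homology_singleton:
  assumes "r < j - int i"
  shows "is_singleton (tensor_homology F i j)"
proof -
  define ct :: "'k pvec \<Rightarrow> (nat \<Rightarrow>\<^sub>0 'k)" where "ct = Poly_Mapping.map (\<lambda>p. lookup p 0)"
  have lookup_ct: "lookup (ct f) b = lookup (lookup f b) 0" for f b by (simp add: ct_def lookup_map)
  have ct_d: "ct (d l f) = tensor_diff F l (ct f)" for l f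
  proof (rule poly_mapping_eqI)
    fix c
    have "keys (ct f) \<subseteq> keys f" unfolding ct_def by (rule keys_map_subset)
    then show "lookup (ct (d l f)) c = lookup (tensor_diff F l (ct f)) c"
      unfolding tensor_diff_def differential_def
      by (simp add: lookup_ct lookup_lin_ext[of "keys f"] lookup_sum lookup_mult_0 lookup_map)
  qed
  have sub: "v \<in> tensor_boundaries F i j" if v: "v \<in> tensor_cycles F i j" for v
  proof -
    \<comment> \<open>A vector over the field is lifted by constant polynomials. These have degree
      0, so the lift is homogeneous of the same internal degree.\<close>
    define f :: "'k pvec" where "f = Poly_Mapping.map (single 0) v"
    have lookup_f: "lookup f b = single 0 (lookup v b)" for b by (simp add: f_def lookup_map)
    have keys_f: "keys f \<subseteq> keys v" unfolding f_def by (rule keys_map_subset)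
    have keys_v: "keys v \<subseteq> {b \<in> basis F i. bdeg F i b = j}"
      using v by (simp add: tensor_cycles_def tensor_space_def)
    have ct_f: "ct f = v" by (rule poly_mapping_eqI) (simp add: lookup_ct lookup_f)
    have fFH: "f \<in> FH i j" unfolding vec_homog_def
    proof (intro CollectI conjI allI)
      show "f \<in> FM i" using keys_f keys_v by (auto simp: free_mod_iff lookup_f polys_const)
      fix b
      show "lookup f b \<in> homog n (j - bdeg F i b)"
      proof (cases "b \<in> keys v")
        case True
        then have "bdeg F i b = j" using keys_v by blast
        then show ?thesis by (simp add: lookup_f homog_const)
      next
        case False then show ?thesis by (simp add: lookup_f in_keys_iff homog_0)
      qed
    qed
    have "cycle {1..n} i f" unfolding cycle_def
    proof (intro conjI allI impI FH_FM[OF fFH])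
      fix l assume l: "i = Suc l"
      have "tensor_diff F l v = 0" using v l by (simp add: tensor_cycles_def)
      then have "ct (d l f) = 0" by (simp add: ct_d ct_f)
      then have "lookup (lookup (d l f) b) 0 = 0" for b by (metis lookup_ct lookup_zero)
      moreover have "lookup (d l f) b \<in> polys n" for b
        using d_FM[of f l] FH_FM[OF fFH] l by (simp add: free_mod_iff)
      ultimately show "d l f \<in> vec_var_ideal {1..n}" by (simp add: vec_var_ideal_def var_ideal_all_iff del: One_nat_def)
    qed
    then have "boundary {1..n} i f" using vanishing_all fFH assms unfolding vanishing_def by auto
    then obtain g h where gh: "g \<in> FH (Suc i) j" "h \<in> FM i" "h \<in> vec_var_ideal {1..n}" "f = d i g + h"
      using boundary_homog fFH by blast
    have "lookup (lookup h b) 0 = 0" for b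
      using gh(2,3) var_ideal_all_iff[of "lookup h b" n] by (simp add: vec_var_ideal_def free_mod_iff)
    then have "ct f = ct (d i g)" unfolding gh(4) by (intro poly_mapping_eqI) (simp add: lookup_ct lookup_add)
    then have "v = tensor_diff F i (ct g)" by (simp add: ct_f ct_d)
    moreover have "ct g \<in> tensor_space F (Suc i) j" unfolding tensor_space_def
    proof (intro CollectI subsetI conjI)
      fix b assume b: "b \<in> keys (ct g)"
      then have "b \<in> keys g" using keys_map_subset[of "\<lambda>p. lookup p 0" g] by (auto simp: ct_def)
      then show "b \<in> basis F (Suc i)" using FH_FM[OF gh(1)] by (auto simp: free_mod_iff)
      have "0 \<in> keys (lookup g b)" using b by (simp add: in_keys_iff lookup_ct)
      then have "int (mdeg 0) = j - bdeg F (Suc i) b" using gh(1) by (auto simp: vec_homog_def homog_iff)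
      then show "bdeg F (Suc i) b = j" by (simp add: mdeg_def)
    qed
    ultimately show ?thesis by (auto simp: tensor_boundaries_def)
  qed
  let ?Z = "tensor_cycles F i j"
  have diff: "v - w \<in> ?Z" if "v \<in> ?Z" "w \<in> ?Z" for v w
  proof -
    have "keys (v - w) \<subseteq> keys v \<union> keys w" by (rule keys_diff)
    then show ?thesis using that
      by (auto simp: tensor_cycles_def tensor_space_def tensor_diff_def lin_ext_diff split: nat.splits)
  qed
  have zero: "0 \<in> ?Z" by (auto simp: tensor_cycles_def tensor_space_def tensor_diff_def split: nat.splits)
  have "{(v, w). v \<in> ?Z \<and> w \<in> ?Z \<and> v - w \<in> tensor_boundaries F i j} = ?Z \<times> ?Z"
    using sub diff by auto
  then have "tensor_homology F i j = {?Z}"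
    unfolding tensor_homology_def quotient_def using zero by auto
  then show ?thesis by (simp add: is_singleton_def)
qed

end

section \<open>Existence of graded free resolutions\<close>

definition graded_submodule :: "nat \<Rightarrow> nat set \<Rightarrow> (nat \<Rightarrow> int) \<Rightarrow> 'k::field pvec set \<Rightarrow> bool" where
  "graded_submodule n B \<delta> K \<longleftrightarrow> K \<subseteq> free_mod n B \<and> 0 \<in> K \<and> (\<forall>f\<in>K. \<forall>g\<in>K. f + g \<in> K) \<and>
     (\<forall>p\<in>polys n. \<forall>f\<in>K. scale p f \<in> K) \<and> (\<forall>f\<in>K. \<forall>j. vec_part \<delta> j f \<in> K)"

lemma vec_part_0 [simp]: "vec_part \<delta> j 0 = 0"
  by (simp add: vec_part_def poly_mapping_eqI lookup_mapp)

lemma scale_0 [simp]: "scale p 0 = 0"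
  by (simp add: poly_mapping_eqI lookup_scale)

lemma graded_submodule_lin_ext:
  fixes K :: "'k::field pvec set"
  assumes K: "graded_submodule n B \<delta> K" and f: "f \<in> free_mod n B'" and w: "\<And>b. b \<in> B' \<Longrightarrow> w b \<in> K"
  shows "lin_ext w f \<in> K"
proof -
  have sum_closed: "sum g A \<in> K" if "\<And>b. b \<in> A \<Longrightarrow> g b \<in> K" for g and A :: "nat set"
    using that K by (induction A rule: infinite_finite_induct) (auto simp: graded_submodule_def)
  show ?thesis unfolding lin_ext_def
  proof (rule sum_closed)
    fix b assume "b \<in> keys f"
    then have "w b \<in> K" "lookup f b \<in> polys n" using f w by (auto simp: free_mod_iff)
    then show "scale (lookup f b) (w b) \<in> K" using K by (auto simp: graded_submodule_def)
  qed
qed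

lemma graded_submodule_kernel:
  assumes w: "\<And>b. b \<in> B' \<Longrightarrow> w b \<in> vec_homog n B \<delta> (\<delta>' b)"
  shows "graded_submodule n B' \<delta>' {g \<in> free_mod n B'. lin_ext w g = 0}"
proof -
  have w': "w b \<in> free_mod n B" "lookup (w b) c \<in> homog n (\<delta>' b - \<delta> c)" if "b \<in> B'" for b c
    using w[OF that] by (auto simp: vec_homog_def)
  have "lin_ext w (vec_part \<delta>' j f) = 0" if "f \<in> free_mod n B'" "lin_ext w f = 0" for f j
  proof -
    have "vec_part \<delta> j (lin_ext w f) = lin_ext w (vec_part \<delta>' j f)"
      by (rule vec_part_lin_ext[OF that(1) w'])
    then show ?thesis using that by simp
  qed
  moreover have "vec_part \<delta>' j f \<in> free_mod n B'" if "f \<in> free_mod n B'" for f j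
    using vec_part_homog[OF that] by (simp add: vec_homog_def)
  ultimately show ?thesis
    by (auto simp: graded_submodule_def free_mod_0 free_mod_add free_mod_scale lin_ext_add lin_ext_scale)
qed

text \<open>Positions 0 to \<open>n\<close> hold all exponents of a monomial in
  \<open>polys n\<close>. An arbitrary injective code is enough as an order on terms, since elements
  will be reduced by constant multiples only.\<close>

definition term_index :: "nat \<Rightarrow> (nat \<Rightarrow>\<^sub>0 nat) \<times> nat \<Rightarrow> nat" where
  "term_index n t = to_nat (map (lookup (fst t)) [0..<Suc n], snd t)"

lemma term_index_inj:
  assumes "keys m \<subseteq> {1..n}" "keys m' \<subseteq> {1..n}" "term_index n (m, b) = term_index n (m', b')"
  shows "m = m' \<and> b = b'"
proof -
  have eq: "map (lookup m) [0..<Suc n] = map (lookup m') [0..<Suc n]" "b = b'"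
    using assms(3) by (simp_all add: term_index_def)
  have "lookup m i = lookup m' i" for i
  proof (cases "i \<le> n")
    case True
    then have "i \<in> set [0..<Suc n]" by (simp del: upt_Suc)
    then show ?thesis using eq(1) unfolding map_eq_conv by blast
  next
    case False
    then have "i \<notin> keys m" "i \<notin> keys m'" using assms by auto
    then show ?thesis by (simp add: in_keys_iff)
  qed
  then show ?thesis using eq by (auto intro: poly_mapping_eqI)
qed

definition terms :: "'k::field pvec \<Rightarrow> ((nat \<Rightarrow>\<^sub>0 nat) \<times> nat) set" where
  "terms f = {(m, b). m \<in> keys (lookup f b)}"

lemma mem_terms: "(m, b) \<in> terms f \<longleftrightarrow> lookup (lookup f b) m \<noteq> 0"
  by (simp add: terms_def in_keys_iff)

lemma finite_terms: "finite (terms f)"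
proof (rule finite_subset)
  show "terms f \<subseteq> (\<Union>b\<in>keys f. (\<lambda>m. (m, b)) ` keys (lookup f b))"
  proof
    fix t assume "t \<in> terms f"
    then obtain m b where t: "t = (m, b)" "m \<in> keys (lookup f b)" by (auto simp: terms_def)
    then have "b \<in> keys f" by (auto simp: in_keys_iff)
    then show "t \<in> (\<Union>b\<in>keys f. (\<lambda>m. (m, b)) ` keys (lookup f b))" using t by blast
  qed
qed auto

lemma terms_nonempty: "f \<noteq> 0 \<Longrightarrow> terms f \<noteq> {}"
proof
  assume "f \<noteq> 0" "terms f = {}"
  then have "lookup (lookup f b) m = 0" for b m using mem_terms by blast
  then have "f = 0" by (simp add: poly_mapping_eqI)
  then show False using \<open>f \<noteq> 0\<close> by simp
qed

definition lead :: "nat \<Rightarrow> 'k::field pvec \<Rightarrow> nat" where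
  "lead n f = Max (term_index n ` terms f)"

lemma lead_term:
  assumes "f \<noteq> 0"
  obtains m b where "(m, b) \<in> terms f" "lead n f = term_index n (m, b)"
proof -
  have "lead n f \<in> term_index n ` terms f"
    unfolding lead_def using assms by (intro Max_in) (simp_all add: finite_terms terms_nonempty)
  then show ?thesis using that by auto
qed

lemma lead_ge: "t \<in> terms f \<Longrightarrow> term_index n t \<le> lead n f"
  unfolding lead_def by (intro Max_ge) (simp_all add: finite_terms)

lemma terms_polys: "f \<in> free_mod n B \<Longrightarrow> (m, b) \<in> terms f \<Longrightarrow> keys m \<subseteq> {1..n}"
  by (auto simp: terms_def free_mod_iff polys_iff)

text \<open>Leading terms can be encoded as natural numbers, and choosing one homogeneous element for each
  leading term gives a generating set.\<close>

lemma graded_submodule_generators: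
  fixes K :: "'k::field pvec set"
  assumes K: "graded_submodule n B \<delta> K"
  obtains B' \<delta>' w where "\<And>b. b \<in> B' \<Longrightarrow> w b \<in> K \<and> w b \<in> vec_homog n B \<delta> (\<delta>' b)"
    "lin_ext w ` free_mod n B' = K"
proof -
  have KB: "f \<in> K \<Longrightarrow> f \<in> free_mod n B" for f using K by (auto simp: graded_submodule_def)
  define P where "P c g j \<longleftrightarrow> g \<in> K \<and> g \<noteq> 0 \<and> g \<in> vec_homog n B \<delta> j \<and> lead n g = c" for c g j
  define B' where "B' = {c. \<exists>g j. P c g j}"
  have "\<forall>c\<in>B'. \<exists>g j. P c g j" by (auto simp: B'_def)
  then obtain w where "\<forall>c\<in>B'. \<exists>j. P c (w c) j" by metis
  then obtain \<delta>' where w: "P c (w c) (\<delta>' c)" if "c \<in> B'" for c by metis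
  have in_B': "lead n f \<in> B'" if f: "f \<in> K" "f \<noteq> 0" for f
  proof -
    obtain m b where mb: "(m, b) \<in> terms f" "lead n f = term_index n (m, b)" using lead_term f(2) by blast
    \<comment> \<open>The homogeneous component containing the leading term has the same leading
      term, so each leading term of \<open>K\<close> is attained by a homogeneous element.\<close>
    define j where "j = int (mdeg m) + \<delta> b"
    let ?g = "vec_part \<delta> j f"
    have sub: "terms ?g \<subseteq> terms f" by (auto simp: terms_def lookup_vec_part keys_hpart)
    have mem: "(m, b) \<in> terms ?g" using mb by (simp add: terms_def lookup_vec_part keys_hpart j_def)
    have ne: "?g \<noteq> 0" using mem by (auto simp: terms_def)
    obtain t where t: "t \<in> terms ?g" "lead n ?g = term_index n t" using lead_term[OF ne] by metis
    then have "t \<in> terms f" using sub by blast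
    then have "lead n ?g \<le> lead n f" using lead_ge t(2) by metis
    moreover have "lead n f \<le> lead n ?g" using lead_ge[OF mem] mb(2) by simp
    ultimately have "lead n ?g = lead n f" by simp
    moreover have "?g \<in> K" using K f by (simp add: graded_submodule_def)
    ultimately have "P (lead n f) ?g j" using ne vec_part_homog[OF KB[OF f(1)]] by (simp add: P_def)
    then show ?thesis by (auto simp: B'_def)
  qed
  have gen: "f \<in> lin_ext w ` free_mod n B'" if "f \<in> K" for f
    using that
  proof (induction "lead n f" arbitrary: f rule: less_induct)
    case less
    show ?case
    proof (cases "f = 0")
      case True
      then have "f = lin_ext w 0" by simp
      then show ?thesis using free_mod_0 by blast
    next
      case False
      define c where "c = lead n f"
      have c: "c \<in> B'" using in_B' less.prems False by (simp add: c_def)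
      have wc: "w c \<in> K" "w c \<noteq> 0" "lead n (w c) = c" using w[OF c] by (auto simp: P_def)
      obtain m b where mb: "(m, b) \<in> terms f" "c = term_index n (m, b)" using lead_term[OF False] c_def by metis
      obtain m' b' where mb': "(m', b') \<in> terms (w c)" "c = term_index n (m', b')"
        using lead_term[OF wc(2), of n] wc(3) by metis
      have "m' = m" "b' = b"
        using term_index_inj[OF terms_polys[OF KB[OF wc(1)] mb'(1)] terms_polys[OF KB[OF less.prems] mb(1)]] mb mb'
        by auto
      then have \<alpha>: "lookup (lookup (w c) b) m \<noteq> 0" using mb' mem_terms by blast
      \<comment> \<open>The leading term cancels without multiplication by a monomial; the chosen
        elements even span \<open>K\<close> over the field.\<close>
      define \<gamma> where "\<gamma> = lookup (lookup f b) m / lookup (lookup (w c) b) m"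
      define s where "s = scale (single 0 \<gamma>) (w c)"
      have sK: "s \<in> K" "scale (single 0 (- \<gamma>)) (w c) \<in> K"
        using K wc(1) polys_const unfolding s_def graded_submodule_def by blast+
      have ls: "lookup (lookup s b1) m1 = \<gamma> * lookup (lookup (w c) b1) m1" for b1 m1
        by (simp add: s_def lookup_scale mult_map_scale_conv_mult[symmetric] lookup_map)
      have "f - s = f + scale (single 0 (- \<gamma>)) (w c)"
        by (rule poly_mapping_eqI)
          (simp add: s_def lookup_add lookup_minus lookup_scale single_uminus)
      then have fK: "f - s \<in> K" using K less.prems sK(2) unfolding graded_submodule_def by metis
      have "f - s \<in> lin_ext w ` free_mod n B'"
      proof (cases "f - s = 0")
        case True
        then have "f - s = lin_ext w 0" by simp
        then show ?thesis using free_mod_0 by blast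
      next
        case ne: False
        obtain m1 b1 where mb1: "(m1, b1) \<in> terms (f - s)" "lead n (f - s) = term_index n (m1, b1)"
          using lead_term[OF ne] by metis
        have "(m1, b1) \<in> terms f \<union> terms (w c)"
          using mb1(1) by (auto simp: mem_terms lookup_minus ls)
        then have "term_index n (m1, b1) \<le> c" using lead_ge[of _ f n] lead_ge[of _ "w c" n] wc(3) c_def by auto
        moreover have "term_index n (m1, b1) \<noteq> c"
        proof
          assume "term_index n (m1, b1) = c"
          then have "m1 = m" "b1 = b"
            using term_index_inj[OF terms_polys[OF KB[OF fK] mb1(1)] terms_polys[OF KB[OF less.prems] mb(1)]] mb
            by auto
          then show False using mb1(1) \<alpha> by (simp add: mem_terms lookup_minus ls \<gamma>_def)
        qed
        ultimately show ?thesis using less.hyps[OF _ fK] mb1(2) c_def by simp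
      qed
      then obtain g where g: "g \<in> free_mod n B'" "f - s = lin_ext w g" by blast
      have "single c (single 0 \<gamma>) \<in> free_mod n B'"
        using c by (auto simp: free_mod_iff lookup_single when_def polys_const polys_0)
      then have "g + single c (single 0 \<gamma>) \<in> free_mod n B'" using g(1) free_mod_add by blast
      moreover have "f = lin_ext w (g + single c (single 0 \<gamma>))"
        using g(2) by (simp add: lin_ext_add lin_ext_single s_def[symmetric] algebra_simps)
      ultimately show ?thesis by blast
    qed
  qed
  show ?thesis
  proof (rule that[of B' w \<delta>'])
    show w': "w b \<in> K \<and> w b \<in> vec_homog n B \<delta> (\<delta>' b)" if "b \<in> B'" for b using w[OF that] by (simp add: P_def)
    show "lin_ext w ` free_mod n B' = K" using gen graded_submodule_lin_ext[OF K] w' by auto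
  qed
qed

lemma graded_syzygies:
  fixes K :: "'k::field pvec set"
  assumes K: "graded_submodule n B \<delta> K"
  obtains Bs \<delta>s ws where "Bs 0 = B" "\<delta>s 0 = \<delta>"
    "\<And>i b. b \<in> Bs (Suc i) \<Longrightarrow> ws i b \<in> vec_homog n (Bs i) (\<delta>s i) (\<delta>s (Suc i) b)"
    "lin_ext (ws 0) ` free_mod n (Bs 1) = K"
    "\<And>i. {f \<in> free_mod n (Bs (Suc i)). lin_ext (ws i) f = 0} = lin_ext (ws (Suc i)) ` free_mod n (Bs (Suc (Suc i)))"
proof -
  \<comment> \<open>A state consists of a free module with its degrees, the submodule to be covered
    next, and the map by which this stage was reached. The clause for \<open>k = 0\<close> only
    fixes the start.\<close>
  define P where "P k = (\<lambda>(B1, \<delta>1, K1, w1 :: nat \<Rightarrow> 'k pvec). graded_submodule n B1 \<delta>1 K1 \<and>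
    (k = 0 \<longrightarrow> B1 = B \<and> \<delta>1 = \<delta> \<and> K1 = K))" for k :: nat
  define Q where "Q (k :: nat) = (\<lambda>(B1, \<delta>1, K1, w1 :: nat \<Rightarrow> 'k pvec) (B2, \<delta>2, K2, w2 :: nat \<Rightarrow> 'k pvec).
    (\<forall>b\<in>B2. w2 b \<in> vec_homog n B1 \<delta>1 (\<delta>2 b)) \<and> lin_ext w2 ` free_mod n B2 = K1 \<and>
    K2 = {g \<in> free_mod n B2. lin_ext w2 g = 0})" for k
  have "\<exists>s. P 0 s" using K by (auto simp: P_def)
  moreover have "\<exists>s'. P (Suc k) s' \<and> Q k s s'" if s: "P k s" for k s
  proof -
    obtain B1 \<delta>1 K1 w1 where eq: "s = (B1, \<delta>1, K1, w1)" by (cases s) auto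
    then have "graded_submodule n B1 \<delta>1 K1" using s by (simp add: P_def)
    then obtain B2 \<delta>2 w2 where w2: "\<And>b. b \<in> B2 \<Longrightarrow> w2 b \<in> K1 \<and> w2 b \<in> vec_homog n B1 \<delta>1 (\<delta>2 b)"
      "lin_ext w2 ` free_mod n B2 = K1" by (rule graded_submodule_generators) blast
    let ?s = "(B2, \<delta>2, {g \<in> free_mod n B2. lin_ext w2 g = 0}, w2)"
    have "graded_submodule n B2 \<delta>2 {g \<in> free_mod n B2. lin_ext w2 g = 0}"
      by (rule graded_submodule_kernel[of B2 w2 n B1 \<delta>1]) (use w2(1) in blast)
    then have "P (Suc k) ?s" by (simp add: P_def)
    moreover have "Q k s ?s" using w2 by (simp add: Q_def eq)
    ultimately show ?thesis by blast
  qed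
  ultimately obtain st where st: "\<And>k. P k (st k)" "\<And>k. Q k (st k) (st (Suc k))"
    using dependent_nat_choice[of P Q] by blast
  define Bs where "Bs k = fst (st k)" for k
  define \<delta>s where "\<delta>s k = fst (snd (st k))" for k
  define Ks where "Ks k = fst (snd (snd (st k)))" for k
  \<comment> \<open>The map from stage \<open>k + 1\<close> to stage \<open>k\<close> is stored with
    its source; the map in the initial state is arbitrary and never read.\<close>
  define ws where "ws k = snd (snd (snd (st (Suc k))))" for k
  have 0: "Bs 0 = B" "\<delta>s 0 = \<delta>" "Ks 0 = K"
    using st(1)[of 0] by (auto simp: P_def Bs_def \<delta>s_def Ks_def split: prod.splits)
  have q: "(\<forall>b\<in>Bs (Suc k). ws k b \<in> vec_homog n (Bs k) (\<delta>s k) (\<delta>s (Suc k) b))"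
    "lin_ext (ws k) ` free_mod n (Bs (Suc k)) = Ks k"
    "Ks (Suc k) = {g \<in> free_mod n (Bs (Suc k)). lin_ext (ws k) g = 0}" for k
    using st(2)[of k] by (auto simp: Q_def Bs_def \<delta>s_def Ks_def ws_def split: prod.splits)
  show ?thesis
    by (rule that[of Bs \<delta>s ws]) (use 0 q in \<open>auto simp del: One_nat_def simp add: One_nat_def\<close>)
qed

section \<open>The semigroup of the curve\<close>

text \<open>The linear map that a map \<open>e\<close> of exponents induces on polynomials, a ring
  homomorphism when \<open>e\<close> is additive. The parametrization of the curve has this form, so
  questions about it reduce to exponents.\<close>

definition mon_map :: "((nat \<Rightarrow>\<^sub>0 nat) \<Rightarrow> (nat \<Rightarrow>\<^sub>0 nat)) \<Rightarrow> 'k::field mpoly \<Rightarrow> 'k mpoly" where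
  "mon_map e p = (\<Sum>m\<in>keys p. single (e m) (lookup p m))"

lemma mon_map_superset:
  assumes "finite B" "keys p \<subseteq> B"
  shows "mon_map e p = (\<Sum>m\<in>B. single (e m) (lookup p m))"
  unfolding mon_map_def using assms by (intro sum.mono_neutral_left) (auto simp: in_keys_iff)

lemma mon_map_add: "mon_map e (p + q) = mon_map e p + mon_map e q"
proof -
  have "keys (p + q) \<subseteq> keys p \<union> keys q" by (rule keys_add)
  then show ?thesis
    by (simp add: mon_map_superset[of "keys p \<union> keys q"] lookup_add single_add sum.distrib)
qed

lemma mon_map_single: "mon_map e (single m c) = single (e m) c"
  by (cases "c = 0") (simp_all add: mon_map_def)

lemma mon_map_0 [simp]: "mon_map e 0 = 0"
  by (simp add: mon_map_def)

lemma mon_map_sum: "mon_map e (sum f B) = (\<Sum>x\<in>B. mon_map e (f x))"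
  by (induction B rule: infinite_finite_induct) (simp_all add: mon_map_add)

lemma sum_singles: "(\<Sum>m\<in>keys p. single m (lookup p m)) = p"
proof (rule poly_mapping_eqI)
  fix k
  have "lookup (\<Sum>m\<in>keys p. single m (lookup p m)) k = (\<Sum>m\<in>keys p. lookup p m when m = k)"
    by (simp add: lookup_sum lookup_single)
  also have "\<dots> = (\<Sum>m\<in>keys p. if k = m then lookup p m else 0)"
    by (intro sum.cong) (auto simp: when_def)
  also have "\<dots> = lookup p k" by (simp add: in_keys_iff)
  finally show "lookup (\<Sum>m\<in>keys p. single m (lookup p m)) k = lookup p k" .
qed

lemma mon_map_mult:
  assumes "\<And>m m'. e (m + m') = e m + e m'"
  shows "mon_map e (p * q) = mon_map e p * mon_map e q"
proof -
  have "p * q = (\<Sum>m\<in>keys p. \<Sum>m'\<in>keys q. single (m + m') (lookup p m * lookup q m'))"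
  proof -
    have "p * q = (\<Sum>m\<in>keys p. single m (lookup p m)) * (\<Sum>m\<in>keys q. single m (lookup q m))"
      by (simp only: sum_singles)
    then show ?thesis by (simp only: sum_product mult_single)
  qed
  then have "mon_map e (p * q) = (\<Sum>m\<in>keys p. \<Sum>m'\<in>keys q. single (e m + e m') (lookup p m * lookup q m'))"
    by (simp add: mon_map_sum mon_map_single assms)
  also have "\<dots> = mon_map e p * mon_map e q"
    by (simp add: mon_map_def sum_product mult_single)
  finally show ?thesis .
qed

lemma keys_mon_map: "keys (mon_map e p) \<subseteq> e ` keys p"
  unfolding mon_map_def using keys_sum[of "\<lambda>m. single (e m) (lookup p m)" "keys p"] by (auto split: if_splits)

lemma prod_single: "finite B \<Longrightarrow> (\<Prod>i\<in>B. single (f i) (1 :: 'k::field)) = single (\<Sum>i\<in>B. f i) 1"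
  for f :: "nat \<Rightarrow> (nat \<Rightarrow>\<^sub>0 nat)"
  by (induction B rule: finite_induct) (simp_all add: mult_single)

lemma power_single: "single m (1 :: 'k::field) ^ t = single (of_nat t * m) 1" for m :: "nat \<Rightarrow>\<^sub>0 nat"
  by (induction t) (simp_all add: mult_single distrib_right)

lemma of_nat_mult_single: "of_nat t * single i k = single i (t * k)" for i k t :: nat
  by (induction t) (simp_all add: distrib_right single_add[symmetric])

text \<open>The exponent vector of \<open>u\<^bsup>td-x\<^esup> v\<^bsup>x\<^esup>\<close>.\<close>

definition point :: "nat \<Rightarrow> nat \<Rightarrow> nat \<Rightarrow> (nat \<Rightarrow>\<^sub>0 nat)" where
  "point d t x = single 1 (t * d - x) + single 2 x"

lemma lookup_point: "lookup (point d t x) 1 = t * d - x" "lookup (point d t x) 2 = x"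
  by (simp_all add: point_def lookup_add lookup_single)

lemma point_inj:
  assumes "point d t x = point d t' x'" "x \<le> t * d" "x' \<le> t' * d" "0 < d"
  shows "t = t' \<and> x = x'"
proof -
  have "x = x'" "t * d - x = t' * d - x'" using lookup_point assms(1) by metis+
  then have "t * d = t' * d" using assms by linarith
  then show ?thesis using \<open>x = x'\<close> assms(4) by simp
qed

lemma point_add: "x \<le> t * d \<Longrightarrow> x' \<le> t' * d \<Longrightarrow> point d t x + point d t' x' = point d (t + t') (x + x')"
proof -
  assume "x \<le> t * d" "x' \<le> t' * d"
  then have "(t + t') * d - (x + x') = (t * d - x) + (t' * d - x')" by (simp add: distrib_right)
  then show ?thesis by (simp only: point_def single_add ac_simps)
qed

lemma nfold_add: "x \<in> nfold s A \<Longrightarrow> y \<in> nfold t A \<Longrightarrow> x + y \<in> nfold (s + t) A"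
proof (induction s arbitrary: x)
  case (Suc s)
  then obtain b z where "b \<in> A" "z \<in> nfold s A" "x = b + z" by (auto simp: set_plus_def)
  then show ?case using Suc by (auto simp: add.assoc)
qed simp

section \<open>The curve and its semigroup\<close>

locale curve =
  fixes n :: nat and a :: "nat \<Rightarrow> nat"
  assumes n_ge: "3 \<le> n" and a_1: "a 1 = 0" and a_mono: "strict_mono_on {1..n} a"
    and Gcd_a: "Gcd (a ` {2..n}) = 1"
begin

abbreviation "D \<equiv> a n"

definition A :: "int set" where "A = int ` a ` {1..n}"

lemma a_le: "i \<in> {1..n} \<Longrightarrow> a i \<le> D"
  using strict_mono_on_leD[OF a_mono, of i n] by simp

lemma deg_ge: "2 \<le> D"
proof -
  have "a 1 < a 2" "a 2 < a 3" using n_ge by (auto intro!: strict_mono_onD[OF a_mono])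
  then show ?thesis using a_le[of 3] n_ge by simp
qed

lemma A_subset: "A \<subseteq> {0..int D}"
  using a_le by (auto simp: A_def)

lemma zero_in_A: "0 \<in> A"
proof -
  have "int (a 1) \<in> A" unfolding A_def using n_ge by (intro imageI) simp
  then show ?thesis by (simp only: a_1 of_nat_0)
qed

lemma deg_in_A: "int D \<in> A"
  unfolding A_def using n_ge by (intro imageI) simp

lemma card_A: "card A = n"
proof -
  have "inj_on a {1..n}" using a_mono by (rule strict_mono_on_imp_inj_on)
  then have "card (a ` {1..n}) = n" by (simp add: card_image)
  moreover have "card A = card (a ` {1..n})" unfolding A_def by (rule card_image) simp
  ultimately show ?thesis by simp
qed

lemma Gcd_A_1: "Gcd A = 1"
proof -
  have "a ` {1..n} = insert 0 (a ` {2..n})"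
  proof -
    have "{1..n} = insert 1 {2..n}" using n_ge by auto
    then show ?thesis using a_1 by (metis image_insert)
  qed
  then show ?thesis using Gcd_a by (simp add: A_def del: image_insert)
qed

definition val :: "(nat \<Rightarrow>\<^sub>0 nat) \<Rightarrow> nat" where "val m = (\<Sum>i\<in>keys m. lookup m i * a i)"

definition expo :: "(nat \<Rightarrow>\<^sub>0 nat) \<Rightarrow> (nat \<Rightarrow>\<^sub>0 nat)" where
  "expo m = (\<Sum>i\<in>keys m. of_nat (lookup m i) * (single 1 (D - a i) + single 2 (a i)))"

lemma curve_map_eq: "curve_map n a p = mon_map expo p" for p :: "'k::field mpoly"
proof -
  have "(\<Prod>i\<in>keys m. (var 1 ^ (D - a i) * var 2 ^ a i) ^ lookup m i) = single (expo m) (1::'k)" for m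
    unfolding expo_def
    by (simp add: var_def power_single mult_single prod_single of_nat_mult_single del: One_nat_def)
  then show ?thesis
    by (simp add: curve_map_def subst_mpoly_def mon_map_def mult_single)
qed

lemma expo_add: "expo (m + m') = expo m + expo m'"
proof -
  have ext: "expo k = (\<Sum>i\<in>B. of_nat (lookup k i) * (single 1 (D - a i) + single 2 (a i)))"
    if "finite B" "keys k \<subseteq> B" for k B
    unfolding expo_def using that by (intro sum.mono_neutral_left) (auto simp: in_keys_iff)
  have "expo (m + m') = (\<Sum>i\<in>keys m \<union> keys m'. of_nat (lookup (m + m') i) * (single 1 (D - a i) + single 2 (a i)))"
    by (rule ext) (auto simp: keys_add_nat)
  then show ?thesis by (simp add: lookup_add distrib_right sum.distrib ext[of "keys m \<union> keys m'"] del: One_nat_def)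
qed

lemma val_add: "val (m + m') = val m + val m'"
proof -
  have ext: "val k = (\<Sum>i\<in>B. lookup k i * a i)" if "finite B" "keys k \<subseteq> B" for k B
    unfolding val_def using that by (intro sum.mono_neutral_left) (auto simp: in_keys_iff)
  have "val (m + m') = (\<Sum>i\<in>keys m \<union> keys m'. lookup (m + m') i * a i)"
    by (rule ext) (auto simp: keys_add_nat)
  then show ?thesis by (simp add: lookup_add distrib_right sum.distrib ext[of "keys m \<union> keys m'"])
qed

lemma val_single: "val (single i k) = k * a i" by (simp add: val_def)
lemma mdeg_single: "mdeg (single i k) = k" by (simp add: mdeg_def)
lemma expo_single: "expo (single i 1) = single 1 (D - a i) + single 2 (a i)"
  by (simp add: expo_def del: One_nat_def)

lemma split_monomial:
  fixes m :: "nat \<Rightarrow>\<^sub>0 nat"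
  assumes "k \<le> lookup m i"
  shows "m = single i k + (m - single i k)"
  by (rule poly_mapping_eqI) (use assms in \<open>auto simp: lookup_add lookup_minus lookup_single when_def\<close>)

lemma mdeg_0_iff: "mdeg m = 0 \<longleftrightarrow> m = 0"
proof
  assume "mdeg m = 0"
  then have "\<forall>i\<in>keys m. lookup m i = 0" by (simp add: mdeg_def)
  then show "m = 0" by (metis keys_eq_empty in_keys_iff ex_in_conv)
qed (simp add: mdeg_def)

lemma monomial_cases:
  assumes "m \<noteq> 0"
  obtains i m' where "m = single i 1 + m'" "i \<in> keys m" "mdeg m = Suc (mdeg m')"
proof -
  have "keys m \<noteq> {}" using assms by simp
  then obtain i where i: "i \<in> keys m" by blast
  then have "m = single i 1 + (m - single i 1)" by (intro split_monomial) (simp add: in_keys_iff)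
  moreover from this have "mdeg m = mdeg (single i 1) + mdeg (m - single i 1)" by (metis mdeg_add)
  ultimately show ?thesis using i by (intro that) (simp_all add: mdeg_single)
qed

lemma val_le: "keys m \<subseteq> {1..n} \<Longrightarrow> val m \<le> mdeg m * D"
  unfolding val_def mdeg_def sum_distrib_right using a_le by (intro sum_mono mult_le_mono2) blast

lemma expo_eq: "keys m \<subseteq> {1..n} \<Longrightarrow> expo m = point D (mdeg m) (val m)"
proof (induction "mdeg m" arbitrary: m)
  case 0
  then have "m = 0" by (simp add: mdeg_0_iff)
  then show ?case by (simp add: expo_def point_def mdeg_def val_def)
next
  case (Suc t)
  then have "m \<noteq> 0" by (auto simp: mdeg_def)
  then obtain i m' where m: "m = single i 1 + m'" "i \<in> keys m" "mdeg m = Suc (mdeg m')" by (rule monomial_cases)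
  have k: "keys m' \<subseteq> {1..n}" "i \<in> {1..n}" using m Suc.prems by (auto simp: keys_add_nat)
  have "expo (single i 1) = point D 1 (a i)" by (simp add: expo_single point_def del: One_nat_def)
  moreover have "expo m' = point D (mdeg m') (val m')" using Suc.hyps(1)[of m'] m k Suc.hyps(2) by simp
  ultimately have "expo m = point D (1 + mdeg m') (a i + val m')"
    using m(1) a_le[OF k(2)] val_le[OF k(1)] by (simp add: expo_add point_add)
  moreover have "mdeg m = 1 + mdeg m'" using m(3) by simp
  moreover have "val m = a i + val m'" using m(1) by (simp add: val_add val_single)
  ultimately show ?case by simp
qed

lemma val_in_nfold: "keys m \<subseteq> {1..n} \<Longrightarrow> int (val m) \<in> nfold (mdeg m) A"
proof (induction "mdeg m" arbitrary: m)
  case 0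
  then have "m = 0" by (simp add: mdeg_0_iff)
  then show ?case by (simp add: mdeg_def val_def)
next
  case (Suc t)
  then have "m \<noteq> 0" by (auto simp: mdeg_def)
  then obtain i m' where m: "m = single i 1 + m'" "i \<in> keys m" "mdeg m = Suc (mdeg m')" by (rule monomial_cases)
  have k: "keys m' \<subseteq> {1..n}" "i \<in> {1..n}" using m Suc.prems by (auto simp: keys_add_nat)
  have "int (val m') \<in> nfold (mdeg m') A" using Suc.hyps(1)[of m'] m k Suc.hyps(2) by simp
  moreover have "int (a i) \<in> A" using k by (auto simp: A_def)
  ultimately have "int (a i) + int (val m') \<in> nfold (Suc (mdeg m')) A" by auto
  moreover have "val m = a i + val m'" unfolding m(1) by (simp add: val_add val_single)
  ultimately show ?case using m(3) by simp
qed

lemma nfold_val: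
  assumes "x \<in> nfold t A"
  obtains m where "keys m \<subseteq> {1..n}" "mdeg m = t" "int (val m) = x"
proof -
  have "\<exists>m. keys m \<subseteq> {1..n} \<and> mdeg m = t \<and> int (val m) = x" using assms
  proof (induction t arbitrary: x)
    case 0
    then show ?case by (intro exI[of _ 0]) (simp add: mdeg_def val_def)
  next
    case (Suc t)
    then obtain i z where "i \<in> {1..n}" "z \<in> nfold t A" "x = int (a i) + z" by (auto simp: A_def set_plus_def)
    moreover from this Suc.IH obtain m where "keys m \<subseteq> {1..n}" "mdeg m = t" "int (val m) = z" by blast
    ultimately show ?case
      by (intro exI[of _ "single i 1 + m"]) (simp add: keys_add_nat mdeg_add mdeg_single val_add val_single)
  qed
  then show ?thesis using that by blast
qed

definition semigroup_part :: "nat \<Rightarrow> (nat \<Rightarrow>\<^sub>0 nat) set" where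
  "semigroup_part t = {point D t x |x. int x \<in> nfold t A}"

definition semigroup :: "(nat \<Rightarrow>\<^sub>0 nat) set" where
  "semigroup = (\<Union>t. semigroup_part t)"

lemma nfold_le: "int x \<in> nfold t A \<Longrightarrow> x \<le> t * D"
  using nfold_val[of "int x" t] val_le by (metis of_nat_eq_iff)

lemma semigroup_part_eq: "semigroup_part t = expo ` {m. keys m \<subseteq> {1..n} \<and> mdeg m = t}"
proof (intro Set.set_eqI iffI)
  fix s assume "s \<in> semigroup_part t"
  then obtain x where x: "s = point D t x" "int x \<in> nfold t A" by (auto simp: semigroup_part_def)
  obtain m where "keys m \<subseteq> {1..n}" "mdeg m = t" "int (val m) = int x" using nfold_val[OF x(2)] .
  then show "s \<in> expo ` {m. keys m \<subseteq> {1..n} \<and> mdeg m = t}"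
    using x expo_eq[of m] by (intro image_eqI[of _ _ m]) auto
next
  fix s assume "s \<in> expo ` {m. keys m \<subseteq> {1..n} \<and> mdeg m = t}"
  then show "s \<in> semigroup_part t" using expo_eq val_in_nfold by (auto simp: semigroup_part_def)
qed

lemma semigroup_eq: "semigroup = expo ` {m. keys m \<subseteq> {1..n}}"
  by (auto simp: semigroup_def semigroup_part_eq)

text \<open>The coordinate ring as a subring of the polynomial ring in \<open>u\<close> and
  \<open>v\<close>, namely the algebra of the semigroup.\<close>

definition curve_image :: "'k::field mpoly set" where
  "curve_image = {p. keys p \<subseteq> semigroup}"

lemma curve_map_add: "curve_map n a (p + q) = curve_map n a p + curve_map n a (q :: 'k::field mpoly)"
  and curve_map_mult: "curve_map n a (p * q) = curve_map n a p * curve_map n a (q :: 'k::field mpoly)"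
  and curve_map_1: "curve_map n a (1 :: 'k mpoly) = 1"
  and curve_map_0: "curve_map n a (0 :: 'k mpoly) = 0"
proof -
  show "curve_map n a (1 :: 'k mpoly) = 1"
    using mon_map_single[of expo 0 "1 :: 'k"] by (simp add: curve_map_eq expo_def)
qed (simp_all add: curve_map_eq mon_map_add mon_map_mult expo_add)

lemma curve_map_diff: "curve_map n a (p - q) = curve_map n a p - curve_map n a (q :: 'k::field mpoly)"
  using curve_map_add[of "p - q" q] by (simp add: algebra_simps)

lemma curve_map_homog:
  assumes "p \<in> homog n (int t)"
  shows "keys (curve_map n a p) \<subseteq> semigroup_part t"
  using assms keys_mon_map[of expo p] unfolding semigroup_part_eq
  by (force simp: curve_map_eq homog_iff polys_iff)

lemma curve_map_image: "curve_map n a ` polys n = (curve_image :: 'k::field mpoly set)"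
proof (intro Set.set_eqI iffI)
  fix q :: "'k mpoly" assume "q \<in> curve_map n a ` polys n"
  then show "q \<in> curve_image" unfolding curve_image_def semigroup_eq
    using keys_mon_map[of expo] by (force simp: curve_map_eq polys_iff)
next
  fix q :: "'k mpoly" assume q: "q \<in> curve_image"
  then have "\<forall>s\<in>keys q. \<exists>m. keys m \<subseteq> {1..n} \<and> expo m = s" by (auto simp: curve_image_def semigroup_eq)
  then obtain f where f: "\<And>s. s \<in> keys q \<Longrightarrow> keys (f s) \<subseteq> {1..n} \<and> expo (f s) = s" by metis
  let ?p = "\<Sum>s\<in>keys q. single (f s) (lookup q s)"
  have p: "?p \<in> polys n" using f by (intro polys_sum polys_single) blast
  have "curve_map n a ?p = (\<Sum>s\<in>keys q. single s (lookup q s))"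
    using f by (simp add: curve_map_eq mon_map_sum mon_map_single)
  then have "q = curve_map n a ?p" by (simp only: sum_singles)
  then show "q \<in> curve_map n a ` polys n" using p by (rule image_eqI)
qed

lemma curve_map_var:
  assumes "i \<in> {1..n}"
  shows "curve_map n a (var i :: 'k::field mpoly) = single (single 1 (D - a i) + single 2 (a i)) 1"
  unfolding curve_map_eq var_def mon_map_single expo_single ..

lemma curve_map_var_1: "curve_map n a (var 1 :: 'k::field mpoly) = single (single 1 D) 1"
  using curve_map_var[of 1] n_ge a_1 by (simp del: One_nat_def)

lemma curve_map_var_n: "curve_map n a (var n :: 'k::field mpoly) = single (single 2 D) 1"
  using curve_map_var[of n] n_ge by simp

lemma semigroup_0: "0 \<in> semigroup"
proof -
  have "point D 0 0 \<in> semigroup_part 0" by (auto simp: semigroup_part_def intro!: exI[of _ 0])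
  then show ?thesis by (auto simp: semigroup_def point_def)
qed

lemma semigroup_part_add: "s \<in> semigroup_part t \<Longrightarrow> s' \<in> semigroup_part t' \<Longrightarrow> s + s' \<in> semigroup_part (t + t')"
proof -
  assume "s \<in> semigroup_part t" "s' \<in> semigroup_part t'"
  then obtain x x' where x: "s = point D t x" "int x \<in> nfold t A" "s' = point D t' x'" "int x' \<in> nfold t' A"
    by (auto simp: semigroup_part_def)
  have "s + s' = point D (t + t') (x + x')" using x nfold_le by (simp add: point_add)
  moreover have "int (x + x') \<in> nfold (t + t') A" using nfold_add[OF x(2,4)] by simp
  ultimately show ?thesis by (auto simp: semigroup_part_def)
qed

lemma semigroup_add: "s \<in> semigroup \<Longrightarrow> s' \<in> semigroup \<Longrightarrow> s + s' \<in> semigroup"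
  unfolding semigroup_def using semigroup_part_add by blast

lemma
  fixes p q :: "'k::field mpoly"
  shows curve_image_1: "1 \<in> (curve_image :: 'k mpoly set)"
    and curve_image_mult: "p \<in> curve_image \<Longrightarrow> q \<in> curve_image \<Longrightarrow> p * q \<in> curve_image"
proof -
  show "1 \<in> (curve_image :: 'k mpoly set)" using semigroup_0 by (auto simp: curve_image_def)
  show "p * q \<in> curve_image" if "p \<in> curve_image" "q \<in> curve_image"
    unfolding curve_image_def
  proof (intro CollectI subsetI)
    fix m assume "m \<in> keys (p * q)"
    then obtain s s' where "s \<in> keys p" "s' \<in> keys q" "m = s + s'" by (rule keys_mult_E)
    then show "m \<in> semigroup" using that semigroup_add by (auto simp: curve_image_def)
  qed
qed

lemma curve_image_power: "p \<in> curve_image \<Longrightarrow> p ^ k \<in> (curve_image :: 'k::field mpoly set)"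
  by (induction k) (simp_all add: curve_image_1 curve_image_mult)

end

context curve
begin

lemma point_in_semigroup: "int x \<in> nfold t A \<Longrightarrow> point D t x \<in> semigroup"
  by (auto simp: semigroup_def semigroup_part_def)

text \<open>Comparison of the exponents of \<open>u\<close> and of \<open>v\<close>. The last
  conclusion holds because the exponent of \<open>u\<close> is at least \<open>D\<close>.\<close>

lemma cancel_point:
  assumes "single 2 D + point D t x = single 1 D + point D t' x'" "x \<le> t * D" "x' \<le> t' * D"
  shows "t' = t" "x' = x + D" "\<exists>u. t = Suc u \<and> x \<le> u * D"
proof -
  have l: "lookup (single 2 D + point D t x) i = lookup (single 1 D + point D t' x') i" for i
    using assms(1) by simp
  have 1: "t * D - x = D + (t' * D - x')" and 2: "D + x = x'"
    using l[of 1] l[of 2] by (simp_all add: point_def lookup_add lookup_single del: One_nat_def)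
  have "t * D = t' * D" using 1 2 assms by linarith
  then show "t' = t" using deg_ge by simp
  show "x' = x + D" using 2 by simp
  show "\<exists>u. t = Suc u \<and> x \<le> u * D" using 1 assms deg_ge by (cases t) auto
qed

lemma point_Suc: "x \<le> u * D \<Longrightarrow> point D (Suc u) x = single 1 D + point D u x"
proof -
  assume "x \<le> u * D"
  then have "Suc u * D - x = D + (u * D - x)" by simp
  then show ?thesis by (simp only: point_def single_add ac_simps)
qed

lemma point_Suc_add: "x \<le> u * D \<Longrightarrow> point D (Suc u) (x + D) = single 2 D + point D u x"
proof -
  assume "x \<le> u * D"
  then have "Suc u * D - (x + D) = u * D - x" by simp
  then show ?thesis by (simp only: point_def single_add ac_simps)
qed

section \<open>The sumset criterion and its consequences for the ring\<close>

lemma repeated_generator: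
  assumes "y \<in> nfold j A" "n * D \<le> j"
  obtains i z where "i \<in> {1..n}" "y = int (D * a i) + z" "z \<in> nfold (j - D) A"
proof -
  obtain m where m: "keys m \<subseteq> {1..n}" "mdeg m = j" "int (val m) = y" using nfold_val[OF assms(1)] .
  have "\<exists>i\<in>{1..n}. D \<le> lookup m i"
  proof (rule ccontr)
    assume small: "\<not> ?thesis"
    have "mdeg m = (\<Sum>i=1..n. lookup m i)"
      unfolding mdeg_def using m(1) by (intro sum.mono_neutral_left) (auto simp: in_keys_iff)
    also have "\<dots> < (\<Sum>i=1..n. D)"
      using small n_ge by (intro sum_strict_mono) (auto simp: not_le)
    finally show False using m(2) assms(2) by simp
  qed
  then obtain i where i: "i \<in> {1..n}" "D \<le> lookup m i" by blast
  define m' where "m' = m - single i D"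
  have m': "m = single i D + m'" unfolding m'_def using i by (intro split_monomial)
  have "keys m' \<subseteq> {1..n}" using m(1) unfolding m' by (simp add: keys_add_nat)
  then have "int (val m') \<in> nfold (mdeg m') A" by (rule val_in_nfold)
  moreover have "mdeg m' = j - D" using m(2) unfolding m' by (simp add: mdeg_add mdeg_single)
  moreover have "y = int (D * a i) + int (val m')" using m(3) unfolding m' by (simp add: val_add val_single)
  ultimately show ?thesis using i that by simp
qed

text \<open>By pigeonhole \<open>y\<close> contains some \<open>a i\<close> repeated
  \<open>D\<close> times, and this equals \<open>a i\<close> copies of \<open>D\<close> and
  \<open>D - a i\<close> copies of 0. One of these \<open>D\<close> generators is already contained
  in the given representation of \<open>x + D\<close> or, if \<open>a i = 0\<close>, of
  \<open>x\<close>. This saves one degree.\<close>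

lemma high_degree_absorbs:
  assumes x: "x \<in> nfold (Suc t) A" "x + int D \<in> nfold (Suc t) A"
    and y: "y \<in> nfold j A" "n * D \<le> j"
  shows "x + y \<in> nfold (t + j) A"
proof -
  obtain i z where i: "i \<in> {1..n}" "y = int (D * a i) + z" "z \<in> nfold (j - D) A"
    using repeated_generator[OF y] .
  have jD: "D \<le> j" using y(2) n_ge by (metis le_trans mult_le_mono1 mult_1 one_le_numeral order_trans)
  have "x + int (D * a i) \<in> nfold (t + D) A"
  proof (cases "a i = 0")
    case True
    have "x \<in> nfold (Suc t + (D - 1)) A" by (rule nfold_incr[OF zero_in_A x(1)])
    then show ?thesis using True deg_ge by simp
  next
    case False
    have "(x + int D) + int (a i - 1) * int D \<in> nfold (Suc t + (a i - 1)) A"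
      by (rule nfold_add_mult[OF deg_in_A x(2)])
    then have "(x + int D) + int (a i - 1) * int D \<in> nfold ((Suc t + (a i - 1)) + (D - a i)) A"
      by (rule nfold_incr[OF zero_in_A])
    moreover have e1: "(x + int D) + int (a i - 1) * int D = x + int (D * a i)"
      using False by (simp add: of_nat_diff algebra_simps)
    moreover have e2: "(Suc t + (a i - 1)) + (D - a i) = t + D" using False a_le[OF i(1)] by simp
    ultimately show ?thesis by (simp only: e1 e2)
  qed
  from nfold_add[OF this i(3)] show ?thesis using i(2) jD by (simp add: algebra_simps)
qed

definition cm_sums :: bool where
  "cm_sums \<longleftrightarrow> (\<forall>t x. x \<in> nfold (Suc t) A \<longrightarrow> x + int D \<in> nfold (Suc t) A \<longrightarrow> x \<in> nfold t A)"

text \<open>If the semigroup fails the criterion, no two elements without constant term form a regular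
  sequence: a monomial witnessing the failure can be moved by powers of both elements to a
  polynomial outside the ring that each of the two elements multiplies into the ring.\<close>

lemma not_cm_sums_witness:
  fixes f g :: "'k::field mpoly"
  assumes not_cm: "\<not> cm_sums"
    and f: "f \<in> curve_image" "lookup f 0 = 0" and g: "g \<in> curve_image" "lookup g 0 = 0"
  obtains q where "q \<notin> curve_image" "f * q \<in> curve_image" "g * q \<in> curve_image"
proof -
  obtain t x where tx: "x \<in> nfold (Suc t) A" "x + int D \<in> nfold (Suc t) A" "x \<notin> nfold t A"
    using not_cm by (auto simp: cm_sums_def)
  obtain k where k: "x = int k" "k \<le> Suc t * D" "k + D \<le> Suc t * D"
  proof -
    obtain m where "int (val m) = x" using nfold_val[OF tx(1)] .
    then show ?thesis using that[of "val m"] nfold_le[of "val m" "Suc t"] nfold_le[of "val m + D" "Suc t"] tx by simp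
  qed
  have kt: "k \<le> t * D" using k by simp
  \<comment> \<open>The monomial in question is outside the ring, yet by
    \<open>high_degree_absorbs\<close> every semigroup monomial of degree at least
    \<open>n * D\<close> multiplies it into the ring.\<close>
  define q0 :: "'k mpoly" where "q0 = single (point D t k) 1"
  have q0: "q0 \<notin> curve_image"
  proof
    assume "q0 \<in> curve_image"
    then have "point D t k \<in> semigroup" by (simp add: q0_def curve_image_def)
    then obtain t' x' where t': "point D t k = point D t' x'" "int x' \<in> nfold t' A"
      by (auto simp: semigroup_def semigroup_part_def)
    then have "t = t' \<and> k = x'" using point_inj[OF t'(1) kt nfold_le[OF t'(2)]] deg_ge by simp
    then show False using t' tx k by simp
  qed
  have power: "keys (p ^ N) \<subseteq> (\<Union>j\<in>{N..}. semigroup_part j)"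
    if p: "p \<in> curve_image" "lookup p 0 = 0" for p :: "'k mpoly" and N
  proof (induction N)
    case 0
    then show ?case using semigroup_0 by (auto simp: semigroup_def)
  next
    case (Suc N)
    show ?case
    proof
      fix m assume "m \<in> keys (p ^ Suc N)"
      then obtain s s' where s: "s \<in> keys p" "s' \<in> keys (p ^ N)" "m = s + s'"
        unfolding power_Suc by (rule keys_mult_E)
      obtain i where i: "s \<in> semigroup_part i" using p s by (auto simp: curve_image_def semigroup_def)
      have "s \<noteq> 0" using s p by (auto simp: in_keys_iff)
      then have "i \<noteq> 0" using i by (cases i) (auto simp: semigroup_part_def point_def)
      moreover obtain j where "N \<le> j" "s' \<in> semigroup_part j" using s Suc by auto
      ultimately show "m \<in> (\<Union>j\<in>{Suc N..}. semigroup_part j)"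
        using semigroup_part_add[OF i] s(3) by (intro UN_I[of "i + j"]) auto
    qed
  qed
  have absorb: "p ^ (n * D) * q0 \<in> curve_image" if p: "p \<in> curve_image" "lookup p 0 = 0" for p :: "'k mpoly"
    unfolding curve_image_def
  proof (intro CollectI subsetI)
    fix m assume "m \<in> keys (p ^ (n * D) * q0)"
    then obtain s where s: "s \<in> keys (p ^ (n * D))" "m = s + point D t k"
      by (elim keys_mult_E) (auto simp: q0_def split: if_splits)
    obtain j y where j: "n * D \<le> j" "s = point D j y" "int y \<in> nfold j A"
      using power[OF p, of "n * D"] s(1) by (auto simp: semigroup_part_def)
    have "int (k + y) \<in> nfold (t + j) A" using high_degree_absorbs[OF tx(1,2) j(3,1)] k by simp
    moreover have "m = point D (t + j) (k + y)"
      using s j nfold_le[OF j(3)] kt by (simp add: point_add add.commute)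
    ultimately show "m \<in> semigroup" using point_in_semigroup by simp
  qed
  \<comment> \<open>Stop at the last power of \<open>p\<close> for which the product is still
    outside the ring.\<close>
  have last: "\<exists>e. p ^ e * q \<notin> curve_image \<and> p * (p ^ e * q) \<in> curve_image"
    if q: "q \<notin> curve_image" and N: "p ^ N * q \<in> curve_image" for p q :: "'k mpoly" and N
  proof -
    define e where "e = (LEAST e. p ^ e * q \<in> curve_image)"
    have e: "p ^ e * q \<in> curve_image" unfolding e_def using N by (rule LeastI)
    then obtain e' where e': "e = Suc e'" using q e by (cases e) auto
    have "p ^ e' * q \<notin> curve_image" using not_less_Least[of e' "\<lambda>e. p ^ e * q \<in> curve_image"] e' e_def by auto
    then show ?thesis using e e' by (auto simp: mult.assoc)
  qed
  obtain e where e: "f ^ e * q0 \<notin> curve_image" "f * (f ^ e * q0) \<in> curve_image"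
    using last[OF q0 absorb[OF f]] by blast
  have "g ^ (n * D) * (f ^ e * q0) = f ^ e * (g ^ (n * D) * q0)" by (simp add: ac_simps)
  also have "\<dots> \<in> curve_image" by (intro curve_image_mult curve_image_power f absorb g)
  finally obtain e' where e': "g ^ e' * (f ^ e * q0) \<notin> curve_image" "g * (g ^ e' * (f ^ e * q0)) \<in> curve_image"
    using last[OF e(1)] by blast
  \<comment> \<open>The second move does not spoil the first: multiplication by a power of
    \<open>g\<close> keeps \<open>f * (f ^ e * q0)\<close> in the ring.\<close>
  have "f * (g ^ e' * (f ^ e * q0)) = g ^ e' * (f * (f ^ e * q0))" by (simp add: ac_simps)
  also have "\<dots> \<in> curve_image" by (intro curve_image_mult curve_image_power g e)
  finally show ?thesis using e' that by blast
qed

text \<open>Everything is graded by monomials. A term of \<open>p\<close> equals \<open>u^D\<close>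
  times a monomial, and the criterion \<open>cm_sums\<close> is exactly what puts that monomial into
  the semigroup.\<close>

lemma cm_divides:
  fixes p q :: "'k::field mpoly"
  assumes cm: cm_sums and pq: "p \<in> curve_image" "q \<in> curve_image"
    and eq: "curve_map n a (var n) * p = curve_map n a (var 1) * q"
  shows "\<exists>r\<in>curve_image. p = curve_map n a (var 1) * r"
proof (intro bexI)
  have key: "\<exists>s'\<in>semigroup. s = single 1 D + s'" if s: "s \<in> keys p" for s
  proof -
    have "single 2 D + s \<in> keys (curve_map n a (var n) * p)"
      using s unfolding curve_map_var_n keys_single_mult by blast
    then obtain s1 where s1: "s1 \<in> keys q" "single 2 D + s = single 1 D + s1"
      unfolding eq curve_map_var_1 keys_single_mult by blast
    obtain t x where t: "s = point D t x" "int x \<in> nfold t A"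
      using s pq by (auto simp: curve_image_def semigroup_def semigroup_part_def)
    obtain t' x' where t': "s1 = point D t' x'" "int x' \<in> nfold t' A"
      using s1 pq by (auto simp: curve_image_def semigroup_def semigroup_part_def)
    note c = cancel_point[OF s1(2)[unfolded t t'] nfold_le[OF t(2)] nfold_le[OF t'(2)]]
    obtain u where u: "t = Suc u" "x \<le> u * D" using c(3) by blast
    have "int x \<in> nfold u A" using cm t t' c u unfolding cm_sums_def by auto
    then have "point D u x \<in> semigroup" by (auto simp: semigroup_def semigroup_part_def)
    moreover have "s = single 1 D + point D u x" using t u point_Suc by simp
    ultimately show ?thesis by blast
  qed
  then show "p = curve_map n a (var 1) * div_mon (single 1 D) p"
    unfolding curve_map_var_1 by (intro div_mon_exact[symmetric]) blast
  show "div_mon (single 1 D) p \<in> curve_image"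
    unfolding curve_image_def
  proof (intro CollectI subsetI)
    fix m assume "m \<in> keys (div_mon (single 1 D) p)"
    then have "single 1 D + m \<in> keys p" by (simp add: in_keys_iff lookup_div_mon)
    then obtain s' where "s' \<in> semigroup" "single 1 D + m = single 1 D + s'" using key by metis
    then show "m \<in> semigroup" by simp
  qed
qed

lemma cm_sumset_A: "cm_sums \<Longrightarrow> cm_sumset (int D) A"
proof
  show "0 < int D" using deg_ge by simp
qed (use A_subset zero_in_A deg_in_A Gcd_A_1 in \<open>auto simp: cm_sums_def\<close>)

definition reg_bound :: int where
  "reg_bound = \<lceil>(real D - 1) / (real n - 2)\<rceil>"

text \<open>A term divisible by neither \<open>u^D\<close> nor \<open>v^D\<close> within the
  semigroup would be new in degree \<open>u + 1\<close>. The sumset bound then gives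
  \<open>u * (n - 2) < D - 1\<close>, hence \<open>u + 1 \<le> reg_bound\<close>.\<close>

lemma cm_high_degree:
  assumes cm: cm_sums and p: "keys p \<subseteq> semigroup_part t" and t: "reg_bound < int t"
  shows "\<exists>q\<in>curve_image. \<exists>r\<in>curve_image. p = curve_map n a (var 1) * q + curve_map n a (var n) * (r :: 'k::field mpoly)"
proof -
  interpret cm_sumset "int D" A using cm_sumset_A[OF cm] .
  have n2: "0 < real n - 2" using n_ge by simp
  have "0 \<le> (real D - 1) / (real n - 2)" using n2 deg_ge by simp
  then have "0 \<le> reg_bound" unfolding reg_bound_def by linarith
  then obtain u where u: "t = Suc u" using t by (cases t) auto
  have split: "(\<exists>s'\<in>semigroup. s = single 1 D + s') \<or> (\<exists>s'\<in>semigroup. s = single 2 D + s')"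
    if s: "s \<in> keys p" for s
  proof -
    obtain x where x: "s = point D (Suc u) x" "int x \<in> nfold (Suc u) A"
      using p s u by (auto simp: semigroup_part_def)
    have "int x \<in> nfold u A \<or> int x - int D \<in> nfold u A"
    proof (rule ccontr)
      assume new: "\<not> ?thesis"
      have "u * (card A - 2) + 2 \<le> nat (int D)"
        using new x n_ge deg_ge by (intro cm_sumset_bound[of "int x"]) (simp_all add: card_A)
      then have "real (u * (n - 2) + 2) \<le> real D" by (simp only: card_A nat_int of_nat_le_iff)
      then have "real u * (real n - 2) < real D - 1" using n_ge by (simp add: of_nat_diff)
      then have "real u < (real D - 1) / (real n - 2)" using n2 by (simp add: pos_less_divide_eq)
      then have "int u < reg_bound" unfolding reg_bound_def by linarith
      then show False using t u by simp
    qed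
    then show ?thesis
    proof
      assume h: "int x \<in> nfold u A"
      then have "s = single 1 D + point D u x" "point D u x \<in> semigroup"
        using x point_Suc nfold_le by (auto simp: semigroup_def semigroup_part_def)
      then show ?thesis by blast
    next
      assume h: "int x - int D \<in> nfold u A"
      then obtain m where "int (val m) = int x - int D" using nfold_val by metis
      then have y: "x = val m + D" "int (val m) \<in> nfold u A" using h by simp_all
      then have "s = single 2 D + point D u (val m)" "point D u (val m) \<in> semigroup"
        using x point_Suc_add nfold_le by (auto simp: semigroup_def semigroup_part_def)
      then show ?thesis by blast
    qed
  qed
  \<comment> \<open>\<open>q\<close> collects all terms whose quotient by \<open>u^D\<close> stays
    in the semigroup; by \<open>split\<close> the remaining terms can be divided by
    \<open>v^D\<close> there.\<close>
  define q where "q = poly_filter (\<lambda>m. m \<in> semigroup) (div_mon (single 1 D) p)"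
  define p' where "p' = p - single (single 1 D) 1 * q"
  have p': "\<exists>s'\<in>semigroup. m = single 2 D + s'" if m: "m \<in> keys p'" for m
  proof (cases "\<exists>s'\<in>semigroup. m = single 1 D + s'")
    case True
    then obtain s' where s': "s' \<in> semigroup" "m = single 1 D + s'" by blast
    have "lookup (single (single 1 D) 1 * q) (single 1 D + s') = lookup q s'" by (rule lookup_single_mult)
    then have "lookup p' m = 0"
      using s' by (simp add: p'_def lookup_minus q_def lookup_poly_filter lookup_div_mon)
    then show ?thesis using m by (simp add: in_keys_iff)
  next
    case False
    have "m \<notin> keys (single (single 1 D) 1 * q)"
      using False unfolding keys_single_mult by (auto simp: q_def keys_poly_filter)
    then have "m \<in> keys p" using m keys_diff[of p "single (single 1 D) 1 * q"] p'_def by blast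
    then show ?thesis using split False by blast
  qed
  define r where "r = div_mon (single 2 D) p'"
  have "single (single 2 D) 1 * r = p'" unfolding r_def using p' by (intro div_mon_exact) blast
  then have "p = curve_map n a (var 1) * q + curve_map n a (var n) * r"
    by (simp add: curve_map_var_1 curve_map_var_n p'_def del: One_nat_def)
  moreover have "q \<in> curve_image" by (auto simp: curve_image_def q_def keys_poly_filter)
  moreover have "r \<in> curve_image" unfolding curve_image_def
  proof (intro CollectI subsetI)
    fix m assume "m \<in> keys r"
    then have "single 2 D + m \<in> keys p'" by (simp add: r_def in_keys_iff lookup_div_mon)
    then obtain s' where "s' \<in> semigroup" "single 2 D + m = single 2 D + s'" using p' by metis
    then show "m \<in> semigroup" by simp
  qed
  ultimately show ?thesis by blast
qed

end

section \<open>Depth and height of the irrelevant ideal\<close>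

lemma mpoly_ring_cring: "cring (mpoly_ring n :: 'k::field mpoly ring)"
proof (rule cringI)
  show "abelian_group (mpoly_ring n :: 'k mpoly ring)"
  proof (rule abelian_groupI)
    fix p :: "'k mpoly" assume "p \<in> polys n"
    then show "\<exists>q\<in>polys n. q \<oplus>\<^bsub>mpoly_ring n\<^esub> p = \<zero>\<^bsub>mpoly_ring n\<^esub>"
      by (intro bexI[of _ "- p"] polys_uminus) simp_all
  qed (auto intro: polys_add polys_0 simp: ac_simps)
  show "comm_monoid (mpoly_ring n :: 'k mpoly ring)"
    by (rule comm_monoidI) (auto intro: polys_mult polys_1 simp: ac_simps)
qed (simp add: distrib_right)

text \<open>Only terms free of the variables in \<open>V\<close> matter modulo the ideal. The
  product of two nonzero polynomials consisting of such terms is nonzero and again consists of such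
  terms.\<close>

lemma var_ideal_prime:
  fixes p q :: "'k::field mpoly"
  assumes "p * q \<in> var_ideal V"
  shows "p \<in> var_ideal V \<or> q \<in> var_ideal V"
proof (rule ccontr)
  assume not: "\<not> ?thesis"
  let ?P = "\<lambda>m :: nat \<Rightarrow>\<^sub>0 nat. keys m \<inter> V = {}"
  have split: "poly_filter ?P r \<noteq> 0 \<and> r - poly_filter ?P r \<in> var_ideal V" if r: "r \<notin> var_ideal V" for r :: "'k mpoly"
  proof
    obtain m where "m \<in> keys r" "keys m \<inter> V = {}" using r by (auto simp: var_ideal_def)
    then have "m \<in> keys (poly_filter ?P r)" by (simp add: keys_poly_filter)
    then show "poly_filter ?P r \<noteq> 0" by auto
    show "r - poly_filter ?P r \<in> var_ideal V"
      by (auto simp: var_ideal_def in_keys_iff lookup_minus lookup_poly_filter when_def split: if_splits)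
  qed
  let ?p = "poly_filter ?P p" and ?q = "poly_filter ?P q"
  have p: "?p \<noteq> 0" "p - ?p \<in> var_ideal V" and q: "?q \<noteq> 0" "q - ?q \<in> var_ideal V"
    using split not by blast+
  have "?p * ?q = p * q - ((p - ?p) * q + (q - ?q) * ?p)" by (simp add: algebra_simps)
  also have "\<dots> \<in> var_ideal V"
    by (rule var_ideal_diff[OF assms var_ideal_add[OF var_ideal_mult[OF p(2)] var_ideal_mult[OF q(2)]]])
  finally have mem: "?p * ?q \<in> var_ideal V" .
  have "?p * ?q \<noteq> 0" using p(1) q(1) by simp
  then obtain m where m: "m \<in> keys (?p * ?q)" by (metis all_not_in_conv keys_eq_empty)
  then obtain b c where "b \<in> keys ?p" "c \<in> keys ?q" "m = b + c" by (rule keys_mult_E)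
  then have "keys m \<inter> V = {}" by (auto simp: keys_poly_filter keys_add_nat)
  moreover have "keys m \<inter> V \<noteq> {}" using mem m unfolding var_ideal_def by blast
  ultimately show False by blast
qed

context curve
begin

lemma curve_map_ring_hom: "ring_hom_ring (mpoly_ring n) (mpoly_ring 2) (curve_map n a :: 'k::field mpoly \<Rightarrow> _)"
proof (rule ring_hom_ringI2)
  show "ring (mpoly_ring n :: 'k mpoly ring)" "ring (mpoly_ring 2 :: 'k mpoly ring)"
    using mpoly_ring_cring cring.axioms(1) by blast+
  show "(curve_map n a :: 'k mpoly \<Rightarrow> _) \<in> ring_hom (mpoly_ring n) (mpoly_ring 2)"
  proof (rule ring_hom_memI)
    fix p :: "'k mpoly" assume "p \<in> polys n"
    then have "curve_map n a p \<in> curve_image" using curve_map_image by blast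
    moreover have "keys (point D t x) \<subseteq> {1..2}" for t x by (auto simp: point_def keys_add_nat split: if_splits)
    ultimately show "curve_map n a p \<in> carrier (mpoly_ring 2)"
      unfolding polys_iff curve_image_def semigroup_def semigroup_part_def by blast
  qed (simp_all add: curve_map_add curve_map_mult curve_map_1)
qed

abbreviation coset :: "'k::field mpoly \<Rightarrow> 'k mpoly set" where
  "coset p \<equiv> curve_ideal n a +>\<^bsub>mpoly_ring n\<^esub> p"

lemma curve_ideal_ideal: "ideal (curve_ideal n a) (mpoly_ring n :: 'k::field mpoly ring)"
proof -
  interpret ring_hom_ring "mpoly_ring n" "mpoly_ring 2" "curve_map n a :: 'k mpoly \<Rightarrow> _"
    by (rule curve_map_ring_hom)
  show ?thesis unfolding curve_ideal_def by (rule kernel_is_ideal)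
qed

lemma mem_curve_ideal: "p \<in> curve_ideal n a \<longleftrightarrow> p \<in> polys n \<and> curve_map n a p = 0"
  by (simp add: curve_ideal_def a_kernel_def')

lemma mem_coset:
  assumes "p \<in> polys n"
  shows "q \<in> coset p \<longleftrightarrow> q \<in> polys n \<and> curve_map n a q = curve_map n a p"
proof
  assume "q \<in> coset p"
  then obtain i where "i \<in> curve_ideal n a" "q = i + p" by (auto simp: a_r_coset_def')
  then show "q \<in> polys n \<and> curve_map n a q = curve_map n a p"
    using assms by (simp add: mem_curve_ideal polys_add curve_map_add)
next
  assume q: "q \<in> polys n \<and> curve_map n a q = curve_map n a p"
  then have "q - p \<in> curve_ideal n a" using assms by (simp add: mem_curve_ideal polys_diff curve_map_diff)
  then show "q \<in> coset p" by (force simp: a_r_coset_def')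
qed

lemma coset_eq_iff:
  assumes "p \<in> polys n" "q \<in> polys n"
  shows "coset p = coset q \<longleftrightarrow> curve_map n a p = curve_map n a q"
proof
  assume "coset p = coset q"
  moreover have "p \<in> coset p" by (simp add: mem_coset[OF assms(1)] assms(1))
  ultimately have "p \<in> coset q" by simp
  then show "curve_map n a p = curve_map n a q" by (simp add: mem_coset[OF assms(2)])
next
  assume "curve_map n a p = curve_map n a q"
  then show "coset p = coset q" by (intro Set.set_eqI) (simp add: mem_coset assms)
qed

lemma coord_ring_cring: "cring (coord_ring n a :: 'k::field mpoly set ring)"
  unfolding coord_ring_def by (rule ideal.quotient_is_cring[OF curve_ideal_ideal mpoly_ring_cring])

lemma coord_ring_carrier: "carrier (coord_ring n a) = coset ` (polys n :: 'k::field mpoly set)"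
  by (auto simp: coord_ring_def FactRing_def A_RCOSETS_def')

lemma coset_hom: "coset \<in> ring_hom (mpoly_ring n) (coord_ring n a :: 'k::field mpoly set ring)"
  unfolding coord_ring_def by (rule ideal.rcos_ring_hom[OF curve_ideal_ideal])

lemma coord_ring_ops:
  fixes p q :: "'k::field mpoly"
  assumes "p \<in> polys n" "q \<in> polys n"
  shows "coset p \<otimes>\<^bsub>coord_ring n a\<^esub> coset q = coset (p * q)"
    and "coset p \<oplus>\<^bsub>coord_ring n a\<^esub> coset q = coset (p + q)"
  using ring_hom_mult[OF coset_hom assms] ring_hom_add[OF coset_hom assms] by simp_all

lemma coord_ring_consts:
  shows "\<one>\<^bsub>coord_ring n a\<^esub> = coset (1 :: 'k::field mpoly)" and "\<zero>\<^bsub>coord_ring n a\<^esub> = coset (0 :: 'k mpoly)"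
proof -
  show "\<one>\<^bsub>coord_ring n a\<^esub> = coset (1 :: 'k mpoly)" using ring_hom_one[OF coset_hom[where ?'k = 'k]] by simp
  have "coset (0 :: 'k mpoly) = curve_ideal n a"
    by (intro Set.set_eqI) (simp add: mem_coset[OF polys_0] mem_curve_ideal curve_map_0)
  then show "\<zero>\<^bsub>coord_ring n a\<^esub> = coset (0 :: 'k mpoly)" by (simp add: coord_ring_def FactRing_def)
qed

text \<open>The contraction of an ideal of variables of k[u, v] to the coordinate ring.
  \<open>V = {}\<close> gives the zero ideal and \<open>V = {1, 2}\<close> the irrelevant
  ideal.\<close>

definition prime_of :: "nat set \<Rightarrow> 'k::field mpoly set set" where
  "prime_of V = coset ` {p \<in> polys n. curve_map n a p \<in> var_ideal V}"

lemma mem_prime_of: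
  assumes "p \<in> polys n"
  shows "coset p \<in> prime_of V \<longleftrightarrow> curve_map n a p \<in> var_ideal V"
proof
  assume "coset p \<in> prime_of V"
  then obtain q where "q \<in> polys n" "curve_map n a q \<in> var_ideal V" "coset p = coset q"
    by (auto simp: prime_of_def)
  then show "curve_map n a p \<in> var_ideal V" using coset_eq_iff[OF assms] by metis
qed (use assms in \<open>auto simp: prime_of_def\<close>)

lemma prime_of_primeideal: "primeideal (prime_of V) (coord_ring n a :: 'k::field mpoly set ring)"
proof -
  interpret R: cring "coord_ring n a :: 'k mpoly set ring" by (rule coord_ring_cring)
  let ?R = "coord_ring n a :: 'k mpoly set ring"
  have elem: "\<exists>p\<in>polys n. X = coset p" if "X \<in> carrier ?R" for X :: "'k mpoly set"
    using that by (auto simp: coord_ring_carrier)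
  have sub: "X \<in> carrier ?R" if "X \<in> prime_of V" for X :: "'k mpoly set" using that by (auto simp: prime_of_def coord_ring_carrier)
  have minus: "\<ominus>\<^bsub>?R\<^esub> coset p = coset (- p)" if p: "p \<in> polys n" for p :: "'k mpoly"
    by (rule R.minus_equality)
      (use p in \<open>auto simp: coord_ring_carrier coord_ring_ops coord_ring_consts polys_uminus\<close>)
  have um: "curve_map n a (- p) \<in> var_ideal V" if "curve_map n a p \<in> var_ideal V" for p :: "'k mpoly"
    using var_ideal_diff[OF var_ideal_0 that] curve_map_diff[of 0 p] by (simp add: curve_map_0)
  have id: "ideal (prime_of V) ?R"
  proof (rule idealI)
    show "ring ?R" by (rule R.ring_axioms)
    show "subgroup (prime_of V) (add_monoid ?R)"
    proof (rule subgroup.intro)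
      show "prime_of V \<subseteq> carrier (add_monoid ?R)" using sub by auto
      fix X Y :: "'k mpoly set" assume "X \<in> prime_of V" "Y \<in> prime_of V"
      then show "X \<otimes>\<^bsub>add_monoid ?R\<^esub> Y \<in> prime_of V"
        by (auto simp: prime_of_def coord_ring_ops curve_map_add intro!: imageI polys_add var_ideal_add)
    next
      show "\<one>\<^bsub>add_monoid ?R\<^esub> \<in> prime_of V"
        by (auto simp: prime_of_def coord_ring_consts polys_0 curve_map_0 intro!: imageI)
      fix X :: "'k mpoly set" assume "X \<in> prime_of V"
      then show "inv\<^bsub>add_monoid ?R\<^esub> X \<in> prime_of V"
        unfolding a_inv_def[symmetric]
        using um by (auto simp: prime_of_def minus intro!: imageI polys_uminus)
    qed
    fix X Y :: "'k mpoly set" assume X: "X \<in> prime_of V" and Y: "Y \<in> carrier ?R"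
    obtain p q where pq: "X = coset p" "p \<in> polys n" "curve_map n a p \<in> var_ideal V"
      "Y = coset q" "q \<in> polys n" using X elem[OF Y] by (auto simp: prime_of_def)
    then have "X \<otimes>\<^bsub>?R\<^esub> Y = coset (p * q)" by (simp add: coord_ring_ops)
    then show "X \<otimes>\<^bsub>?R\<^esub> Y \<in> prime_of V"
      using pq by (auto simp: prime_of_def curve_map_mult intro!: imageI polys_mult var_ideal_mult)
    then show "Y \<otimes>\<^bsub>?R\<^esub> X \<in> prime_of V" using R.m_comm[OF sub[OF X] Y] by simp
  qed
  show ?thesis
  proof (rule primeidealI)
    show "ideal (prime_of V) ?R" by (rule id)
    show "cring ?R" by (rule coord_ring_cring)
    have "coset (1 :: 'k mpoly) \<notin> prime_of V"
      using mem_prime_of[OF polys_1] by (simp add: curve_map_1 var_ideal_def)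
    then show "carrier ?R \<noteq> prime_of V" using polys_1 by (auto simp: coord_ring_carrier)
    fix X Y :: "'k mpoly set" assume "X \<in> carrier ?R" "Y \<in> carrier ?R" "X \<otimes>\<^bsub>?R\<^esub> Y \<in> prime_of V"
    moreover from this obtain p q where pq: "X = coset p" "p \<in> polys n"
      "Y = coset q" "q \<in> polys n" using elem by metis
    ultimately have "curve_map n a p * curve_map n a q \<in> var_ideal V"
      by (simp add: coord_ring_ops mem_prime_of polys_mult curve_map_mult)
    then show "X \<in> prime_of V \<or> Y \<in> prime_of V" using var_ideal_prime pq by (auto simp: mem_prime_of)
  qed
qed

lemma constant_in_var_ideal: "curve_map n a p \<in> var_ideal {1, 2} \<longleftrightarrow> lookup (curve_map n a p) 0 = 0"
  if "p \<in> polys n" for p :: "'k::field mpoly"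
proof -
  interpret ring_hom_ring "mpoly_ring n" "mpoly_ring 2" "curve_map n a :: 'k mpoly \<Rightarrow> _"
    by (rule curve_map_ring_hom)
  have "{1..2} = {1, 2 :: nat}" by auto
  then show ?thesis using var_ideal_all_iff[OF hom_closed[OF that]] by metis
qed

lemma prime_of_maximalideal: "maximalideal (prime_of {1, 2}) (coord_ring n a :: 'k::field mpoly set ring)"
proof -
  interpret R: cring "coord_ring n a :: 'k mpoly set ring" by (rule coord_ring_cring)
  let ?R = "coord_ring n a :: 'k mpoly set ring"
  interpret P: primeideal "prime_of {1, 2}" ?R by (rule prime_of_primeideal)
  show ?thesis
  proof (rule maximalidealI)
    show "ideal (prime_of {1, 2}) ?R" by (rule P.is_ideal)
    show "carrier ?R \<noteq> prime_of {1, 2}" by (rule P.I_notcarr)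
    fix J assume J: "ideal J ?R" "prime_of {1, 2} \<subseteq> J" "J \<subseteq> carrier ?R"
    interpret J: ideal J ?R by (rule J)
    show "J = prime_of {1, 2} \<or> J = carrier ?R"
    proof (cases "J = prime_of {1, 2}")
      case False
      then obtain X where X: "X \<in> J" "X \<notin> prime_of {1, 2}" using J by blast
      then obtain p where p: "p \<in> polys n" "X = coset p" using J by (auto simp: coord_ring_carrier)
      define \<gamma> where "\<gamma> = lookup (curve_map n a p) 0"
      have \<gamma>: "\<gamma> \<noteq> 0" using X p mem_prime_of constant_in_var_ideal \<gamma>_def by metis
      \<comment> \<open>Scaling the constant coefficient to 1 makes \<open>1 - c * p\<close> an
        element of the irrelevant ideal, so the larger ideal contains 1.\<close>
      define c :: "'k mpoly" where "c = single 0 (1 / \<gamma>)"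
      have c: "c \<in> polys n" "curve_map n a c = c"
        by (simp_all add: c_def polys_const curve_map_eq mon_map_single expo_def)
      have cp: "coset (c * p) \<in> J"
        using J.I_l_closed[OF X(1), of "coset c"] p c by (simp add: coord_ring_ops coord_ring_carrier)
      have "lookup (curve_map n a (1 - c * p)) 0 = 0"
        using \<gamma> by (simp add: curve_map_diff curve_map_mult curve_map_1 c lookup_minus lookup_mult_0 \<gamma>_def[symmetric])
          (simp add: c_def)
      moreover have q: "1 - c * p \<in> polys n" using p c by (simp add: polys_diff polys_1 polys_mult)
      ultimately have "coset (1 - c * p) \<in> J" using J(2) mem_prime_of[OF q] constant_in_var_ideal[OF q] by blast
      then have "coset (1 - c * p) \<oplus>\<^bsub>?R\<^esub> coset (c * p) \<in> J" using cp by (rule J.a_closed)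
      then have "\<one>\<^bsub>?R\<^esub> \<in> J" using q p c by (simp add: coord_ring_ops polys_mult coord_ring_consts)
      then show ?thesis using J.one_imp_carrier by blast
    qed simp
  qed
qed

text \<open>The chain 0, (v), (u, v) of k[u, v] contracts to a strict chain: the classes of
  \<open>var n\<close> and \<open>var 1\<close> separate its members.\<close>

lemma prime_height_ge: "2 \<le> prime_height (coord_ring n a :: 'k::field mpoly set ring) (prime_of {1, 2})"
proof -
  let ?R = "coord_ring n a :: 'k mpoly set ring"
  let ?Qs = "[prime_of {}, prime_of {2}, prime_of {1, 2}] :: 'k mpoly set set list"
  have sub: "prime_of V \<subseteq> (prime_of W :: 'k mpoly set set)" if "V \<subseteq> W" for V W
    using var_ideal_mono[OF that] unfolding prime_of_def by blast
  have v: "coset (var i :: 'k mpoly) \<in> prime_of V \<longleftrightarrow> curve_map n a (var i :: 'k mpoly) \<in> var_ideal V" if "i \<in> {1..n}" for i V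
    using mem_prime_of[OF polys_var[OF that]] .
  have n: "n \<in> {1..n}" "1 \<in> {1..n}" using n_ge by auto
  have d: "D \<noteq> 0" using deg_ge by simp
  have "coset (var n :: 'k mpoly) \<in> prime_of {2}" "coset (var n :: 'k mpoly) \<notin> prime_of {}"
    using v[OF n(1)] d by (simp_all add: curve_map_var_n var_ideal_def)
  then have 1: "(prime_of {} :: 'k mpoly set set) \<subset> prime_of {2}" using sub[of "{}" "{2}"] by blast
  have "coset (var 1 :: 'k mpoly) \<in> prime_of {1, 2}" "coset (var 1 :: 'k mpoly) \<notin> prime_of {2}"
    using v[OF n(2)] d by (simp_all add: curve_map_var_1 var_ideal_def del: One_nat_def)
  then have 2: "(prime_of {2} :: 'k mpoly set set) \<subset> prime_of {1, 2}" using sub[of "{2}" "{1, 2}"] by blast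
  have "?Qs \<noteq> [] \<and> last ?Qs = prime_of {1, 2} \<and> sorted_wrt (\<subset>) ?Qs \<and> (\<forall>Q\<in>set ?Qs. primeideal Q ?R)"
    using 1 2 prime_of_primeideal by auto
  then have le: "enat (length ?Qs - 1) \<le> prime_height ?R (prime_of {1, 2})"
    unfolding prime_height_def by (intro Sup_upper) blast
  have "2 = enat (length ?Qs - 1)" by (simp add: numeral_eq_enat numeral_2_eq_2)
  also note le
  finally show ?thesis .
qed

text \<open>If \<open>w\<close> is outside the ring while \<open>p w\<close> and \<open>q w\<close>
  are inside, then \<open>q (p w) = p (q w)\<close> lies in the ideal generated by \<open>p\<close>
  although \<open>p w\<close> does not. This contradicts regularity of \<open>q\<close> modulo
  \<open>p\<close>.\<close>

theorem cohen_macaulay_imp_cm_sums: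
  assumes "cohen_macaulay (coord_ring n a :: 'k::field mpoly set ring)"
  shows cm_sums
proof (rule ccontr)
  assume not_cm: "\<not> cm_sums"
  let ?R = "coord_ring n a :: 'k mpoly set ring"
  let ?P = "prime_of {1, 2} :: 'k mpoly set set"
  interpret R: cring ?R by (rule coord_ring_cring)
  have "ideal_depth ?R ?P = prime_height ?R ?P"
    using assms prime_of_maximalideal unfolding cohen_macaulay_def by blast
  then have "2 \<le> ideal_depth ?R ?P" using prime_height_ge by simp
  \<comment> \<open>A strict inequality below the supremum yields an actual regular
    sequence.\<close>
  then have "1 < ideal_depth ?R ?P" by (rule less_le_trans[rotated]) (simp add: one_enat_def numeral_eq_enat)
  then obtain xs where xs: "1 < enat (length xs)" "set xs \<subseteq> ?P" "regular_sequence ?R xs"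
    unfolding ideal_depth_def less_Sup_iff by blast
  have len: "1 < length xs" using xs(1) by (simp add: one_enat_def)
  have memP: "\<exists>p\<in>polys n. X = coset p \<and> lookup (curve_map n a p) 0 = 0" if "X \<in> ?P" for X
    using that constant_in_var_ideal by (auto simp: prime_of_def)
  have "xs ! 0 \<in> ?P" "xs ! 1 \<in> ?P" using xs(2) len by (auto intro!: subsetD[OF xs(2)] nth_mem)
  then obtain p q where p: "p \<in> polys n" "xs ! 0 = coset p" "lookup (curve_map n a p) 0 = 0"
    and q: "q \<in> polys n" "xs ! 1 = coset q" "lookup (curve_map n a q) 0 = 0"
    using memP by metis
  have reg: "xs ! i \<otimes>\<^bsub>?R\<^esub> r \<in> genideal ?R (set (take i xs)) \<Longrightarrow> r \<in> genideal ?R (set (take i xs))"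
    if "i < 2" "r \<in> carrier ?R" for i r
    using xs(3) that len unfolding regular_sequence_def by auto
  \<comment> \<open>Regularity of the first element modulo the zero ideal; this permits cancelling
    \<open>p\<close> at the end.\<close>
  have p0: "curve_map n a p \<noteq> 0"
  proof
    assume "curve_map n a p = 0"
    then have "coset p = \<zero>\<^bsub>?R\<^esub>" using p(1) by (simp add: coord_ring_consts coset_eq_iff polys_0 curve_map_0)
    then have "xs ! 0 \<otimes>\<^bsub>?R\<^esub> \<one>\<^bsub>?R\<^esub> = \<zero>\<^bsub>?R\<^esub>" using p by simp
    moreover have "\<zero>\<^bsub>?R\<^esub> \<in> genideal ?R {}"
      using R.genideal_ideal[of "{}"] by (simp add: additive_subgroup.zero_closed ideal.axioms(1))
    ultimately have "\<one>\<^bsub>?R\<^esub> \<in> genideal ?R {}" using reg[of 0 "\<one>\<^bsub>?R\<^esub>"] by simp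
    also have "genideal ?R {} \<subseteq> {\<zero>\<^bsub>?R\<^esub>}" by (rule R.genideal_minimal[OF R.zeroideal]) simp
    finally have "coset (1 :: 'k mpoly) = coset 0" by (simp add: coord_ring_consts)
    then show False by (simp add: coset_eq_iff[OF polys_1 polys_0] curve_map_1 curve_map_0)
  qed
  have "curve_map n a p \<in> curve_image" "curve_map n a q \<in> curve_image" using p q curve_map_image by blast+
  then obtain w where w: "w \<notin> curve_image" "curve_map n a p * w \<in> curve_image" "curve_map n a q * w \<in> curve_image"
    using not_cm_sums_witness[OF not_cm] p(3) q(3) by metis
  have lift: "\<exists>s\<in>polys n. curve_map n a s = v" if "v \<in> curve_image" for v :: "'k mpoly"
    using that unfolding curve_map_image[symmetric] by blast
  obtain s where s: "s \<in> polys n" "curve_map n a s = curve_map n a p * w"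
    using lift[OF w(2)] by blast
  obtain t where t: "t \<in> polys n" "curve_map n a t = curve_map n a q * w"
    using lift[OF w(3)] by blast
  have take: "set (take 1 xs) = {coset p}" using len p(2) by (cases xs) auto
  have pC: "coset p \<in> carrier ?R" using p by (simp add: coord_ring_carrier)
  have "coset q \<otimes>\<^bsub>?R\<^esub> coset s = coset p \<otimes>\<^bsub>?R\<^esub> coset t"
    using p q s t by (simp add: coord_ring_ops coset_eq_iff polys_mult curve_map_mult)
  also have "\<dots> \<in> genideal ?R {coset p}"
    using R.genideal_self'[OF pC] R.genideal_ideal[of "{coset p}"] pC t
    by (intro ideal.I_r_closed) (auto simp: coord_ring_carrier)
  finally have "coset s \<in> genideal ?R {coset p}"
    using reg[of 1 "coset s"] take q s by (simp add: coord_ring_carrier)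
  also have "genideal ?R {coset p} \<subseteq> PIdl\<^bsub>?R\<^esub> (coset p)"
    by (rule R.genideal_minimal[OF R.cgenideal_ideal[OF pC]]) (simp add: R.cgenideal_self[OF pC])
  finally obtain Y where Y: "Y \<in> carrier ?R" "coset s = Y \<otimes>\<^bsub>?R\<^esub> coset p" by (auto simp: cgenideal_def)
  then obtain y where y: "y \<in> polys n" "Y = coset y" by (auto simp: coord_ring_carrier)
  then have "curve_map n a p * w = curve_map n a p * curve_map n a y"
    using Y p s by (simp add: coord_ring_ops coset_eq_iff polys_mult curve_map_mult mult.commute)
  then have "w = curve_map n a y" using p0 by simp
  then show False using w(1) y curve_map_image by blast
qed

end

section \<open>The graded module of the curve\<close>

context curve
begin

lemma coord_module_simps:
  shows "carrier (coord_module n a :: ('k::field mpoly, 'k mpoly set) module) = carrier (coord_ring n a)"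
    and "\<zero>\<^bsub>coord_module n a :: ('k mpoly, 'k mpoly set) module\<^esub> = \<zero>\<^bsub>coord_ring n a\<^esub>"
    and "add (coord_module n a :: ('k mpoly, 'k mpoly set) module) = add (coord_ring n a)"
    and "s \<odot>\<^bsub>coord_module n a\<^esub> X = coset (s :: 'k mpoly) \<otimes>\<^bsub>coord_ring n a\<^esub> X"
  by (simp_all add: coord_module_def ring.defs module.defs)

lemma finsum_coset:
  fixes q :: "nat \<Rightarrow> 'k::field mpoly"
  assumes "finite B" "\<And>b. b \<in> B \<Longrightarrow> q b \<in> polys n" "\<And>b. b \<in> B \<Longrightarrow> X b = coset (q b)"
  shows "finsum (coord_ring n a) X B = coset (\<Sum>b\<in>B. q b)"
proof -
  interpret R: cring "coord_ring n a :: 'k mpoly set ring" by (rule coord_ring_cring)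
  show ?thesis using assms
  proof (induction B rule: finite_induct)
    case empty
    then show ?case by (simp add: coord_ring_consts)
  next
    case (insert b B)
    then have "finsum (coord_ring n a) X (insert b B) = X b \<oplus>\<^bsub>coord_ring n a\<^esub> finsum (coord_ring n a) X B"
      by (intro R.finsum_insert) (auto simp: coord_ring_carrier)
    then show ?case using insert by (simp add: coord_ring_ops polys_sum)
  qed
qed

lemma augmentation_eq:
  fixes f :: "'k::field pvec"
  assumes f: "f \<in> free_mod n (basis F 0)"
    and p: "\<And>b. b \<in> basis F 0 \<Longrightarrow> p b \<in> polys n \<and> baug F b = coset (p b)"
  shows "augmentation (coord_module n a) F f = coset (\<Sum>b\<in>keys f. lookup f b * p b)"
proof -
  have b: "p b \<in> polys n" "lookup f b \<in> polys n" "baug F b = coset (p b)" if "b \<in> keys f" for b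
    using that f p by (auto simp: free_mod_iff)
  have "augmentation (coord_module n a) F f
      = finsum (coord_ring n a) (\<lambda>b. coset (lookup f b) \<otimes>\<^bsub>coord_ring n a\<^esub> baug F b) (keys f)"
    by (simp add: augmentation_def finsum_def finprod_def coord_module_simps)
  also have "\<dots> = coset (\<Sum>b\<in>keys f. lookup f b * p b)"
    using b by (intro finsum_coset) (simp_all add: polys_mult coord_ring_ops)
  finally show ?thesis .
qed

text \<open>A monomial of degree \<open>t\<close> is mapped to total degree \<open>t * D\<close> in
  \<open>u\<close> and \<open>v\<close>. So taking homogeneous parts commutes with the map, and its
  kernel is graded.\<close>

lemma curve_map_hpart:
  assumes "p \<in> polys n" "curve_map n a p = 0"
  shows "curve_map n a (hpart j p) = (0 :: 'k::field mpoly)"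
proof -
  let ?P = "\<lambda>s. int (lookup s 1 + lookup s 2) = j * int D"
  have filter_sum: "poly_filter ?P (sum g B) = (\<Sum>b\<in>B. poly_filter ?P (g b :: 'k mpoly))" for g and B :: "(nat \<Rightarrow>\<^sub>0 nat) set"
    by (rule poly_mapping_eqI) (simp add: lookup_poly_filter lookup_sum when_def)
  have deg: "?P (expo m) \<longleftrightarrow> int (mdeg m) = j" if "m \<in> keys p" for m
  proof -
    have m: "keys m \<subseteq> {1..n}" using assms(1) that by (auto simp: polys_iff)
    have "lookup (expo m) 1 + lookup (expo m) 2 = mdeg m * D"
      using val_le[OF m] by (simp add: expo_eq[OF m] lookup_point del: One_nat_def)
    then show ?thesis using deg_ge by (simp del: One_nat_def)
  qed
  have "curve_map n a (hpart j p) = (\<Sum>m\<in>keys p. single (expo m) (lookup (hpart j p) m))"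
    by (simp add: curve_map_eq mon_map_superset[of "keys p"] keys_hpart)
  also have "\<dots> = (\<Sum>m\<in>keys p. poly_filter ?P (single (expo m) (lookup p m)))"
  proof (rule sum.cong[OF refl], rule poly_mapping_eqI)
    fix m k assume "m \<in> keys p"
    then show "lookup (single (expo m) (lookup (hpart j p) m)) k = lookup (poly_filter ?P (single (expo m) (lookup p m))) k"
      using deg[of m] by (auto simp: lookup_poly_filter lookup_hpart lookup_single when_def)
  qed
  also have "\<dots> = poly_filter ?P (curve_map n a p)"
    unfolding curve_map_eq mon_map_def by (rule filter_sum[symmetric])
  also have "\<dots> = 0" using assms(2) by (simp add: poly_mapping_eqI lookup_poly_filter)
  finally show ?thesis .
qed

text \<open>Guarantees that the \<open>SOME\<close> in \<open>Tor\<close> denotes a resolution. It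
  starts with one generator in degree 0, whose relations form the ideal of the curve, and continues
  with iterated syzygies.\<close>

lemma resolution_exists:
  "\<exists>F. graded_free_resolution n (coord_module n a :: ('k::field mpoly, 'k mpoly set) module) (coord_grading n a) F"
proof -
  let ?M = "coord_module n a :: ('k mpoly, 'k mpoly set) module"
  define K :: "'k pvec set" where "K = {f \<in> free_mod n {0}. curve_map n a (lookup f 0) = 0}"
  have c: "lookup f 0 \<in> polys n" if "f \<in> free_mod n {0}" for f :: "'k pvec"
    using that by (simp add: free_mod_iff)
  have "graded_submodule n {0} (\<lambda>_. 0) K"
    unfolding graded_submodule_def K_def
    using vec_part_homog[of _ n "{0}" "\<lambda>_. 0"] c
    by (auto simp: free_mod_0 free_mod_add free_mod_scale lookup_add curve_map_0 curve_map_add lookup_scale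
        curve_map_mult vec_homog_def lookup_vec_part curve_map_hpart)
  then obtain Bs \<delta>s ws where res: "Bs 0 = {0}" "\<delta>s 0 = (\<lambda>_. 0)"
    "\<And>i b. b \<in> Bs (Suc i) \<Longrightarrow> ws i b \<in> vec_homog n (Bs i) (\<delta>s i) (\<delta>s (Suc i) b)"
    "lin_ext (ws 0) ` free_mod n (Bs 1) = K"
    "\<And>i. {f \<in> free_mod n (Bs (Suc i)). lin_ext (ws i) f = 0} = lin_ext (ws (Suc i)) ` free_mod n (Bs (Suc (Suc i)))"
    using graded_syzygies[of n "{0}" "\<lambda>_. 0" K] by blast
  define F :: "('k, 'k mpoly set) free_complex" where
    "F = \<lparr>basis = Bs, bdeg = \<delta>s, bdiff = ws, baug = (\<lambda>_. coset 1)\<rparr>"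
  have F: "basis F = Bs" "bdeg F = \<delta>s" "bdiff F = ws" "baug F b = coset 1" for b by (simp_all add: F_def)
  have aug: "augmentation ?M F f = coset (lookup f 0)" if f: "f \<in> free_mod n {0}" for f
  proof -
    have "augmentation ?M F f = coset (\<Sum>b\<in>keys f. lookup f b * 1)"
      using f by (intro augmentation_eq) (simp_all add: F res polys_1)
    also have "(\<Sum>b\<in>keys f. lookup f b * 1) = (\<Sum>b\<in>keys f. lookup f b)" by simp
    also have "\<dots> = (\<Sum>b\<in>{0}. lookup f b)"
      using f by (intro sum.mono_neutral_left) (auto simp: free_mod_iff in_keys_iff)
    finally show ?thesis by simp
  qed
  have zero: "{f \<in> free_mod n {0}. augmentation ?M F f = \<zero>\<^bsub>?M\<^esub>} = K"
  proof -
    have "augmentation ?M F f = \<zero>\<^bsub>?M\<^esub> \<longleftrightarrow> curve_map n a (lookup f 0) = 0" if "f \<in> free_mod n {0}" for f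
      by (simp add: aug[OF that] coord_module_simps coord_ring_consts coset_eq_iff[OF c[OF that] polys_0] curve_map_0)
    then show ?thesis by (auto simp: K_def)
  qed
  have surj: "augmentation ?M F ` free_mod n {0} = carrier ?M"
  proof (intro equalityI subsetI)
    fix X assume "X \<in> augmentation ?M F ` free_mod n {0}"
    then show "X \<in> carrier ?M" using c by (auto simp: aug coord_module_simps coord_ring_carrier)
  next
    fix X assume "X \<in> carrier ?M"
    then obtain p where p: "p \<in> polys n" "X = coset p" by (auto simp: coord_module_simps coord_ring_carrier)
    have "single 0 p \<in> free_mod n {0}" using p by (auto simp: free_mod_iff lookup_single when_def polys_0)
    moreover have "X = augmentation ?M F (single 0 p)" using p aug[OF calculation] by simp
    ultimately show "X \<in> augmentation ?M F ` free_mod n {0}" by blast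
  qed
  have one: "coset (1 :: 'k mpoly) \<in> coord_grading n a 0"
    unfolding coord_grading_def using homog_const[of 1 n] by (intro imageI) simp
  have "graded_free_resolution n ?M (coord_grading n a) F"
    unfolding graded_free_resolution_def differential_def F
    using res(3) by (auto simp: res(1,2,5) zero surj one res(4)[simplified] vec_homog_def)
  then show ?thesis by blast
qed

text \<open>The coordinate module embeds into k[u, v]. Composed with this embedding the augmentation
  keeps its kernel, and the first and last variable act as \<open>u^D\<close> and \<open>v^D\<close>
  in a domain.\<close>

lemma tor_vanishes:
  fixes F :: "('k::field, 'k mpoly set) free_complex"
  assumes cm: cm_sums
    and F: "graded_free_resolution n (coord_module n a :: ('k mpoly, 'k mpoly set) module) (coord_grading n a) F"
    and j: "reg_bound < j - int i"
  shows "is_singleton (tensor_homology F i j)"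
proof -
  let ?M = "coord_module n a :: ('k mpoly, 'k mpoly set) module"
  note F' = F[unfolded graded_free_resolution_def]
  have surj: "augmentation ?M F ` free_mod n (basis F 0) = carrier ?M"
    by (rule F'[THEN conjunct2, THEN conjunct2, THEN conjunct1])
  have kernel: "{f \<in> free_mod n (basis F 0). augmentation ?M F f = \<zero>\<^bsub>?M\<^esub>}
      = differential F 0 ` free_mod n (basis F 1)"
    by (rule F'[THEN conjunct2, THEN conjunct2, THEN conjunct2, THEN conjunct1])
  have "\<forall>b\<in>basis F 0. \<exists>p. p \<in> homog n (bdeg F 0 b) \<and> baug F b = coset p"
    using F' by (auto simp: coord_grading_def)
  \<comment> \<open>Homogeneous lifts of the images of the basis elements; their homogeneity lets
    the degree bound \<open>cm_high_degree\<close> apply to \<open>lift f\<close>.\<close>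
  then obtain p where p: "\<And>b. b \<in> basis F 0 \<Longrightarrow> p b \<in> homog n (bdeg F 0 b) \<and> baug F b = coset (p b)" by metis
  then have pc: "p b \<in> polys n \<and> baug F b = coset (p b)" if "b \<in> basis F 0" for b
    using that by (auto simp: homog_iff)
  define lift where "lift f = (\<Sum>b\<in>keys f. lookup f b * p b)" for f
  define \<epsilon> where "\<epsilon> f = curve_map n a (lift f)" for f
  have lift_eq: "lift f = (\<Sum>b\<in>B. lookup f b * p b)" if "finite B" "keys f \<subseteq> B" for f B
    unfolding lift_def using that by (intro sum.mono_neutral_left) (auto simp: in_keys_iff)
  have lift_carrier: "lift f \<in> polys n" if "f \<in> free_mod n (basis F 0)" for f
    unfolding lift_def using that pc by (intro polys_sum polys_mult) (auto simp: free_mod_iff)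
  have aug: "augmentation ?M F f = coset (lift f)" if "f \<in> free_mod n (basis F 0)" for f
    unfolding lift_def by (rule augmentation_eq[OF that pc])
  have aug_0: "augmentation ?M F f = \<zero>\<^bsub>?M\<^esub> \<longleftrightarrow> \<epsilon> f = 0" if "f \<in> free_mod n (basis F 0)" for f
    using lift_carrier[OF that]
    by (simp add: aug[OF that] \<epsilon>_def coord_module_simps coord_ring_consts coset_eq_iff polys_0 curve_map_0)
  have image: "\<exists>f\<in>free_mod n (basis F 0). \<epsilon> f = v" if "v \<in> curve_image" for v
  proof -
    obtain q where q: "q \<in> polys n" "curve_map n a q = v"
      using \<open>v \<in> curve_image\<close> unfolding curve_map_image[symmetric] by blast
    then have "coset q \<in> carrier ?M" by (simp add: coord_module_simps coord_ring_carrier)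
    then obtain f where f: "f \<in> free_mod n (basis F 0)" "coset q = augmentation ?M F f"
      unfolding surj[symmetric] by blast
    then have "curve_map n a q = \<epsilon> f" using q lift_carrier by (simp add: aug \<epsilon>_def coset_eq_iff)
    then show ?thesis using f q by metis
  qed
  have in_image: "\<epsilon> f \<in> curve_image" if "f \<in> free_mod n (basis F 0)" for f
    unfolding \<epsilon>_def using lift_carrier[OF that] curve_map_image by blast
  have scale: "\<epsilon> (scale q f) = curve_map n a q * \<epsilon> f" for q f
  proof -
    have "keys (scale q f) \<subseteq> keys f" unfolding scale_def by (rule keys_map_subset)
    then have "lift (scale q f) = q * lift f"
      by (simp add: lift_eq[of "keys f"] lookup_scale sum_distrib_left mult.assoc)
    then show ?thesis by (simp add: \<epsilon>_def curve_map_mult)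
  qed
  have add: "\<epsilon> (f + g) = \<epsilon> f + \<epsilon> g" for f g
  proof -
    have "keys (f + g) \<subseteq> keys f \<union> keys g" by (rule keys_add)
    then have "lift (f + g) = lift f + lift g"
      by (simp add: lift_eq[of "keys f \<union> keys g"] lookup_add distrib_right sum.distrib)
    then show ?thesis by (simp add: \<epsilon>_def curve_map_add)
  qed
  have high: "\<exists>g\<in>free_mod n (basis F 0). \<exists>h\<in>free_mod n (basis F 0).
      \<epsilon> f = curve_map n a (var 1) * \<epsilon> g + curve_map n a (var n) * \<epsilon> h"
    if f: "f \<in> vec_homog n (basis F 0) (bdeg F 0) l" "reg_bound < l" for f l
  proof -
    have "0 \<le> reg_bound"
    proof -
      have "0 \<le> (real D - 1) / (real n - 2)" using n_ge deg_ge by simp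
      then show ?thesis unfolding reg_bound_def by linarith
    qed
    then obtain t where t: "l = int t" using f(2) by (metis less_le_trans nat_0_le order_less_imp_le order_trans)
    have "lookup f b * p b \<in> homog n (int t)" if "b \<in> keys f" for b
    proof -
      have "b \<in> basis F 0" "lookup f b \<in> homog n (l - bdeg F 0 b)"
        using that f by (auto simp: vec_homog_def free_mod_iff)
      then show ?thesis using homog_mult[of "lookup f b" n "l - bdeg F 0 b" "p b" "bdeg F 0 b"] p t by simp
    qed
    then have "lift f \<in> homog n (int t)" unfolding lift_def by (rule homog_sum)
    then have "keys (\<epsilon> f) \<subseteq> semigroup_part t" unfolding \<epsilon>_def by (rule curve_map_homog)
    then obtain u v where "u \<in> curve_image" "v \<in> curve_image"
      "\<epsilon> f = curve_map n a (var 1) * u + curve_map n a (var n) * v"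
      using cm_high_degree[OF cm, of "\<epsilon> f" t] f(2) t by auto
    then show ?thesis using image by metis
  qed
  interpret regular_resolution n F \<epsilon> "curve_map n a" 1 n reg_bound
  proof
    show "{f \<in> free_mod n (basis F 0). \<epsilon> f = 0} = differential F 0 ` free_mod n (basis F 1)"
      unfolding kernel[symmetric] using aug_0 by blast
    show "curve_map n a (var 1 :: 'k mpoly) \<noteq> 0"
      unfolding curve_map_var_1 by (metis lookup_single_eq lookup_zero one_neq_zero)
    fix f g :: "'k pvec"
    assume fg: "f \<in> free_mod n (basis F 0)" "g \<in> free_mod n (basis F 0)"
      "curve_map n a (var n) * \<epsilon> f = curve_map n a (var 1) * \<epsilon> g"
    from cm_divides[OF cm in_image[OF fg(1)] in_image[OF fg(2)] fg(3)]
    show "\<exists>h\<in>free_mod n (basis F 0). \<epsilon> f = curve_map n a (var 1) * \<epsilon> h" using image by metis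
  qed (use F' add scale high n_ge in \<open>auto simp del: One_nat_def\<close>)
  show ?thesis by (rule tensor_homology_singleton[OF j])
qed

end

theorem theorem4p7:
  fixes n :: nat and a :: "nat \<Rightarrow> nat"
  assumes "infinite (UNIV :: 'k::field set)"
    and "n \<ge> 3"
    and "a 1 = 0"
    and "strict_mono_on {1..n} a"
    and "Gcd (a ` {2..n}) = 1"
    and "cohen_macaulay (coord_ring n a :: 'k mpoly set ring)"
  shows "curve_regularity TYPE('k) n a
           \<le> ereal (real_of_int \<lceil>(real (a n) - 1) / (real n - 2)\<rceil>)"
proof -
  interpret curve n a using assms(2-5) by unfold_locales
  let ?M = "coord_module n a :: ('k mpoly, 'k mpoly set) module"
  let ?F = "SOME F. graded_free_resolution n ?M (coord_grading n a) F"
  have cm: cm_sums using assms(6) by (rule cohen_macaulay_imp_cm_sums)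
  have "graded_free_resolution n ?M (coord_grading n a) ?F" by (rule someI_ex[OF resolution_exists])
  then have le: "j - int i \<le> reg_bound" if "\<not> is_singleton (Tor n ?M (coord_grading n a) i j)" for i j
    using tor_vanishes[OF cm] that unfolding Tor_def by (meson linorder_not_less)
  show ?thesis
    unfolding curve_regularity_def regularity_def reg_bound_def[symmetric]
  proof (rule Sup_least)
    fix y assume "y \<in> {ereal (real_of_int (j - int i)) |i j. \<not> is_singleton (Tor n ?M (coord_grading n a) i j)}"
    then obtain i j where "y = ereal (real_of_int (j - int i))" "\<not> is_singleton (Tor n ?M (coord_grading n a) i j)"
      by blast
    then show "y \<le> ereal (real_of_int reg_bound)" using le by (simp only: ereal_less_eq of_int_le_iff)
  qed
qed

end
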